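(* Let $\mathcal{H}$ be a tree-to-tree Hennie machine from $\Sigma$ to $\Gamma$ and $\mathcal{N}$ an unrestricted tree-to-tree Hennie machine from $\Gamma$ to $\Xi$ that is narrow-visit on the range of $[\![\mathcal{H}]\!]$. Then $[\![\mathcal{N}]\!]\circ[\![\mathcal{H}]\!]$ is computed by some tree-to-tree Hennie machine.
   Context: Trees: ranked alphabets are finite sets with a rank function to $\mathbb{N}$; $T_\Sigma$ is the set of finite ordered $\Sigma$-labeled trees where a node labeled $\sigma$ has $\mathrm{rank}(\sigma)$ children (nodes are words over positive integers, root $\varepsilon$, $i$-th child of $u$ is $ui$); $T_\Sigma[Y]$ allows extra rank-$0$ leaves labeled in $Y$. The ancestor order on nodes is the prefix order; an antichain is a set of pairwise incomparable nodes. Hennie machines: a uTHM is $(Q,M,\top,\Sigma,\Gamma,q_{init},\delta)$ with finite states $Q$, finite memory symbols $M\ni\top$, $q_{init}\in Q$, partial $\delta:Q\times\Sigma\times M\rightharpoonup T_\Gamma[Q\times M\times D]$, $D=\{\uparrow,1,..,\max\mathrm{rank}\Sigma\}$, leaves $(q',m',d)$ of $\delta(q,\sigma,m)$ having $d\in\{\uparrow,1,..,\mathrm{rank}\sigma\}$. Configurations on $t$ are $(u,q,\mu)$, $\mu:$ nodes$\to M$, initially $(\varepsilon,q_{init},\text{constant }\top)$; the step of $(u,q,\mu)$ is $\delta(q,\mathrm{lab}_t(u),\mu(u))$ with each leaf $(q',m',d)$ replaced by $(ud,q',\mu[u\mapsto m'])$ ($ud$ the parent if $d=\uparrow$, else the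 $d$-th child; undefined if nonexistent). Confluent rewriting of configuration leaves by steps from the initial configuration yields the output $[\![\mathcal{H}]\!](t)\in T_\Gamma$, if any. A branch-outputting run is $C_0,..,C_n$ with $C_0$ initial and $C_{i+1}$ a leaf label of the step of $C_i$; its number of visits at a node set $S$ is $|\{i:\text{position of }C_i\in S\}|$. A uTHM is bounded-visit on $L$ if some $N$ bounds visits at every single node for all $t\in L$ and all runs on $t$; a THM is a uTHM bounded-visit on all inputs. A uTHM is narrow-visit on $L$ if some $N$ bounds visits at every antichain $S$ of $t$, for all $t\in L$ and all runs on $t$. *)

theory Defs
  imports Main "HOL-Library.Sublist"
begin

text \<open>Finite ordered labelled trees. A ranked alphabet is a finite set Sig together
with a rank function rk. Nodes are lists of positive integers (1-based child indices),
the root is the empty list, the i-th child of u is u @ [i].\<close>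

datatype 'a tree = Node 'a "'a tree list"

fun root_lab :: "'a tree \<Rightarrow> 'a" where
  "root_lab (Node a ts) = a"

fun wf_tree :: "'a set \<Rightarrow> ('a \<Rightarrow> nat) \<Rightarrow> 'a tree \<Rightarrow> bool" where
  "wf_tree Sig rk (Node a ts) \<longleftrightarrow> a \<in> Sig \<and> length ts = rk a \<and> (\<forall>s\<in>set ts. wf_tree Sig rk s)"

datatype ('g, 'y) otree = Leaf 'y | ONode 'g "('g, 'y) otree list"

fun wf_otree :: "'g set \<Rightarrow> ('g \<Rightarrow> nat) \<Rightarrow> ('g, 'y) otree \<Rightarrow> bool" where
  "wf_otree Gam rk (Leaf y) \<longleftrightarrow> True"
| "wf_otree Gam rk (ONode g ss) \<longleftrightarrow> g \<in> Gam \<and> length ss = rk g \<and> (\<forall>s\<in>set ss. wf_otree Gam rk s)"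

abbreviation leaves :: "('g, 'y) otree \<Rightarrow> 'y set" where
  "leaves \<equiv> set2_otree"

fun graft :: "('g, 'y) otree \<Rightarrow> ('y \<Rightarrow> 'g tree) \<Rightarrow> 'g tree" where
  "graft (Leaf y) f = f y"
| "graft (ONode g ss) f = Node g (map (\<lambda>s. graft s f) ss)"

fun subt :: "'a tree \<Rightarrow> nat list \<Rightarrow> 'a tree option" where
  "subt t [] = Some t"
| "subt (Node a ts) (i # u) = (if 1 \<le> i \<and> i \<le> length ts then subt (ts ! (i - 1)) u else None)"

definition nodes :: "'a tree \<Rightarrow> nat list set" where
  "nodes t = {u. subt t u \<noteq> None}"

definition lab :: "'a tree \<Rightarrow> nat list \<Rightarrow> 'a option" where
  "lab t u = map_option root_lab (subt t u)"

definition antichain :: "'a tree \<Rightarrow> nat list set \<Rightarrow> bool" where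
  "antichain t S \<longleftrightarrow> S \<subseteq> nodes t \<and> (\<forall>u\<in>S. \<forall>v\<in>S. prefix u v \<longrightarrow> u = v)"

datatype dir = Up | Down nat

record ('q, 'm, 'a, 'g) hm =
  st :: "'q set"
  mem :: "'m set"
  topm :: 'm
  qinit :: 'q
  delta :: "'q \<Rightarrow> 'a \<Rightarrow> 'm \<Rightarrow> ('g, 'q \<times> 'm \<times> dir) otree option"

definition is_uthm :: "'a set \<Rightarrow> ('a \<Rightarrow> nat) \<Rightarrow> 'g set \<Rightarrow> ('g \<Rightarrow> nat) \<Rightarrow> ('q, 'm, 'a, 'g) hm \<Rightarrow> bool" where
  "is_uthm Sig rkS Gam rkG H \<longleftrightarrow>
     finite Sig \<and> finite Gam \<and> finite (st H) \<and> finite (mem H) \<and> topm H \<in> mem H \<and> qinit H \<in> st H \<and>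
     (\<forall>q \<sigma> m s. delta H q \<sigma> m = Some s \<longrightarrow>
        q \<in> st H \<and> \<sigma> \<in> Sig \<and> m \<in> mem H \<and> wf_otree Gam rkG s \<and>
        (\<forall>(q', m', d) \<in> leaves s. q' \<in> st H \<and> m' \<in> mem H \<and>
             (d = Up \<or> (\<exists>i. d = Down i \<and> 1 \<le> i \<and> i \<le> rkS \<sigma>))))"

type_synonym ('q, 'm) conf = "nat list \<times> 'q \<times> (nat list \<Rightarrow> 'm)"

definition init_conf :: "('q, 'm, 'a, 'g) hm \<Rightarrow> ('q, 'm) conf" where
  "init_conf H = ([], qinit H, (\<lambda>_. topm H))"

fun move :: "'a tree \<Rightarrow> nat list \<Rightarrow> dir \<Rightarrow> nat list option" where
  "move t u Up = (if u = [] then None else Some (butlast u))"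
| "move t u (Down i) = (if u @ [i] \<in> nodes t then Some (u @ [i]) else None)"

definition step :: "('q, 'm, 'a, 'g) hm \<Rightarrow> 'a tree \<Rightarrow> ('q, 'm) conf \<Rightarrow> ('g, ('q, 'm) conf) otree option" where
  "step H t c = (case c of (u, q, \<mu>) \<Rightarrow>
     (case lab t u of None \<Rightarrow> None | Some \<sigma> \<Rightarrow>
       (case delta H q \<sigma> (\<mu> u) of None \<Rightarrow> None | Some s \<Rightarrow>
         (if \<forall>(q', m', d) \<in> leaves s. move t u d \<noteq> None
          then Some (map_otree id (\<lambda>(q', m', d). (the (move t u d), q', \<mu>(u := m'))) s)
          else None))))"

text \<open>Output of the (confluent) rewriting started at configuration c: least relation,
 i.e. only terminating rewritings produce an output.\<close>
inductive outputs :: "('q, 'm, 'a, 'g) hm \<Rightarrow> 'a tree \<Rightarrow> ('q, 'm) conf \<Rightarrow> 'g tree \<Rightarrow> bool"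
  for H t where
  "step H t c = Some s \<Longrightarrow> (\<forall>c' \<in> leaves s. outputs H t c' (f c')) \<Longrightarrow> outputs H t c (graft s f)"

definition sem :: "('q, 'm, 'a, 'g) hm \<Rightarrow> 'a tree \<Rightarrow> 'g tree option" where
  "sem H t = (if \<exists>r. outputs H t (init_conf H) r then Some (THE r. outputs H t (init_conf H) r) else None)"

definition range_sem :: "'a set \<Rightarrow> ('a \<Rightarrow> nat) \<Rightarrow> ('q, 'm, 'a, 'g) hm \<Rightarrow> 'g tree set" where
  "range_sem Sig rkS H = {r. \<exists>t. wf_tree Sig rkS t \<and> sem H t = Some r}"

definition is_run :: "('q, 'm, 'a, 'g) hm \<Rightarrow> 'a tree \<Rightarrow> ('q, 'm) conf list \<Rightarrow> bool" where
  "is_run H t cs \<longleftrightarrow> cs \<noteq> [] \<and> cs ! 0 = init_conf H \<and>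
     (\<forall>i. Suc i < length cs \<longrightarrow> (\<exists>s. step H t (cs ! i) = Some s \<and> cs ! Suc i \<in> leaves s))"

definition visits :: "('q, 'm) conf list \<Rightarrow> nat list set \<Rightarrow> nat" where
  "visits cs S = card {i. i < length cs \<and> fst (cs ! i) \<in> S}"

definition bounded_visit :: "('q, 'm, 'a, 'g) hm \<Rightarrow> 'a tree set \<Rightarrow> bool" where
  "bounded_visit H L \<longleftrightarrow> (\<exists>N. \<forall>t\<in>L. \<forall>cs. is_run H t cs \<longrightarrow> (\<forall>u \<in> nodes t. visits cs {u} \<le> N))"

definition narrow_visit :: "('q, 'm, 'a, 'g) hm \<Rightarrow> 'a tree set \<Rightarrow> bool" where
  "narrow_visit H L \<longleftrightarrow> (\<exists>N. \<forall>t\<in>L. \<forall>cs. is_run H t cs \<longrightarrow> (\<forall>S. antichain t S \<longrightarrow> visits cs S \<le> N))"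

definition is_thm :: "'a set \<Rightarrow> ('a \<Rightarrow> nat) \<Rightarrow> 'g set \<Rightarrow> ('g \<Rightarrow> nat) \<Rightarrow> ('q, 'm, 'a, 'g) hm \<Rightarrow> bool" where
  "is_thm Sig rkS Gam rkG H \<longleftrightarrow> is_uthm Sig rkS Gam rkG H \<and> bounded_visit H {t. wf_tree Sig rkS t}"

end

theory Submission
  imports Defs
begin

text \<open>The composed machine simulates N on the virtual tree r = [[H]](t), walking forwards and backwards in
  the computation tree of H. Every touched node of that tree is kept as a record at the input node
  where H sits, so that moves of H can be undone. After a visit counter is added to H, records at the
  same input node with the same pending output and the same memory of H are incomparable in the
  computation tree, hence describe an antichain of visited nodes of r; as N is narrow-visit, the number
  of records per input node is bounded. Departures from a record are charged to visits of N at the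
  corresponding node of r, so the visits of the composed machine are bounded as well.

  Branches of H that N never visits may still fail, so t has to be tested for membership in the domain
  of H beforehand. This domain is recognizable: with the visit counter, the behaviour of a subtree
  towards its context has finite depth, so bisimilarity of annotated trees is a congruence of finite
  index, and a depth-first traversal computes the class of t.\<close>

section \<open>Rewriting systems with tree outputs\<close>

text \<open>The branching of H can place unboundedly many nodes of r at one input node, on different
  branches of the computation tree, and each needs its own memory of N. A bound per node of r would
  therefore leave the number of records unbounded; a bound per antichain does not. Records are never
  deleted, since N may come back to any of them.

  Why agreement makes records incomparable: of two nested configurations of H at one input node, the
  later one either belongs to a later visit, and then the counter is larger, or to the same visit,
  and then its pending output is smaller.

  Narrowness is given only on the range, whereas the result must be bounded-visit on every input. So
  the composed machine is cut off as soon as it leaves prescribed finite sets or misses a required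
  increase of a potential; an invariant shows that inputs in the domain of H never trigger this.

  Running H cannot serve as the domain test, because its branches cannot be rejoined afterwards;
  this forces the detour through recognizability.\<close>

fun obind :: "('g, 'y) otree \<Rightarrow> ('y \<Rightarrow> ('g, 'z) otree) \<Rightarrow> ('g, 'z) otree" where
  "obind (Leaf y) f = f y"
| "obind (ONode g ss) f = ONode g (map (\<lambda>s. obind s f) ss)"

lemma graft_cong: "(\<And>y. y \<in> leaves s \<Longrightarrow> f y = g y) \<Longrightarrow> graft s f = graft s g"
  by (induction s) auto

lemma graft_map_otree: "graft (map_otree id h s) f = graft s (\<lambda>y. f (h y))"
  by (induction s) auto

lemma graft_obind: "graft (obind s f) g = graft s (\<lambda>y. graft (f y) g)"
  by (induction s) auto

lemma leaves_obind: "leaves (obind s f) = (\<Union>y\<in>leaves s. leaves (f y))"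
  by (induction s) auto

lemma wf_otree_obind:
  "wf_otree X rk s \<Longrightarrow> (\<And>y. y \<in> leaves s \<Longrightarrow> wf_otree X rk (f y)) \<Longrightarrow> wf_otree X rk (obind s f)"
  by (induction s) auto

lemma wf_otree_map: "wf_otree X rk (map_otree id h s) = wf_otree X rk s"
  by (induction s) auto

lemma obind_cong: "(\<And>y. y \<in> leaves s \<Longrightarrow> f y = g y) \<Longrightarrow> obind s f = obind s g"
  by (induction s) auto

lemma graft_rel:
  "rel_otree (=) P s s' \<Longrightarrow> (\<And>y y'. y \<in> leaves s \<Longrightarrow> y' \<in> leaves s' \<Longrightarrow> P y y' \<Longrightarrow> f y = g y')
     \<Longrightarrow> graft s f = graft s' g"
proof (induction s arbitrary: s')
  case (Leaf y)
  then show ?case by (cases s') auto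
next
  case (ONode a ss)
  from ONode.prems(1) obtain ss' where ss': "s' = ONode a ss'" "list_all2 (rel_otree (=) P) ss ss'"
    by (cases s') auto
  have "graft (ss ! i) f = graft (ss' ! i) g" if i: "i < length ss" for i
  proof (rule ONode.IH)
    have i': "i < length ss'" using i ss'(2) by (auto dest: list_all2_lengthD)
    show "ss ! i \<in> set ss" using i by simp
    show "rel_otree (=) P (ss ! i) (ss' ! i)" using ss'(2) i by (auto dest: list_all2_nthD)
    fix y y' assume "y \<in> leaves (ss ! i)" "y' \<in> leaves (ss' ! i)" "P y y'"
    then show "f y = g y'" using i i' by (intro ONode.prems(2)) (auto simp: ss')
  qed
  then show ?case using ss' by (auto simp: list_all2_conv_all_nth intro: nth_equalityI)
qed

lemma rel_otree_leaves:
  assumes "rel_otree (=) P s s'"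
  shows "\<And>y. y \<in> leaves s \<Longrightarrow> \<exists>y'\<in>leaves s'. P y y'" and "\<And>y'. y' \<in> leaves s' \<Longrightarrow> \<exists>y\<in>leaves s. P y y'"
proof -
  have "rel_set P (leaves s) (leaves s')"
    using assms otree.set_transfer(2)[of "(=)" P] by (auto simp: rel_fun_def)
  then show "\<And>y. y \<in> leaves s \<Longrightarrow> \<exists>y'\<in>leaves s'. P y y'" "\<And>y'. y' \<in> leaves s' \<Longrightarrow> \<exists>y\<in>leaves s. P y y'"
    by (auto simp: rel_set_def)
qed

lemma rel_otree_map:
  assumes "\<And>y. y \<in> leaves s \<Longrightarrow> P (h y) (k y)"
  shows "rel_otree (=) P (map_otree id h s) (map_otree id k s)"
  unfolding otree.rel_map using assms by (intro otree.rel_refl_strong) auto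

text \<open>With the machine abstracted to a step function, ordinary machines, machines with stay
  moves and guarded machines share one simulation theorem.\<close>

inductive out :: "('c \<Rightarrow> ('g, 'c) otree option) \<Rightarrow> 'c \<Rightarrow> 'g tree \<Rightarrow> bool" for T where
  "T c = Some s \<Longrightarrow> (\<forall>c' \<in> leaves s. out T c' (f c')) \<Longrightarrow> out T c (graft s f)"

lemma outputs_eq_out: "outputs H t c r \<longleftrightarrow> out (step H t) c r"
proof
  show "outputs H t c r \<Longrightarrow> out (step H t) c r"
    by (induction rule: outputs.induct) (auto intro: out.intros)
  show "out (step H t) c r \<Longrightarrow> outputs H t c r"
    by (induction rule: out.induct) (auto intro: outputs.intros)
qed

lemma out_deterministic: "out T c r \<Longrightarrow> out T c r' \<Longrightarrow> r = r'"
proof (induction arbitrary: r' rule: out.induct)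
  case (1 c s f)
  from 1(3) show ?case
  proof cases
    case (1 s' f')
    then show ?thesis using \<open>T c = Some s\<close> "1.IH" by (auto intro!: graft_cong)
  qed
qed

definition halts :: "('c \<Rightarrow> ('g, 'c) otree option) \<Rightarrow> 'c \<Rightarrow> bool" where
  "halts T c \<longleftrightarrow> (\<exists>r. out T c r)"

definition result :: "('c \<Rightarrow> ('g, 'c) otree option) \<Rightarrow> 'c \<Rightarrow> 'g tree" where
  "result T c = (THE r. out T c r)"

lemma out_result: "out T c r \<Longrightarrow> result T c = r"
  unfolding result_def by (blast intro: out_deterministic)

lemma halts_out: "halts T c \<Longrightarrow> out T c (result T c)"
  unfolding halts_def using out_result by metis

lemma out_iff: "out T c r \<longleftrightarrow> halts T c \<and> r = result T c"
  using out_result halts_out halts_def by metis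

lemma halts_step:
  "T c = Some s \<Longrightarrow> (\<And>c'. c' \<in> leaves s \<Longrightarrow> halts T c') \<Longrightarrow> out T c (graft s (result T))"
  by (blast intro: out.intros halts_out)

lemma halts_iff: "halts T c \<longleftrightarrow> (\<exists>s. T c = Some s \<and> (\<forall>c'\<in>leaves s. halts T c'))"
proof
  assume "halts T c"
  then show "\<exists>s. T c = Some s \<and> (\<forall>c'\<in>leaves s. halts T c')"
    unfolding halts_def by (meson out.cases)
next
  assume "\<exists>s. T c = Some s \<and> (\<forall>c'\<in>leaves s. halts T c')"
  then show "halts T c" using halts_step halts_def by metis
qed

lemma halts_induct [consumes 1, case_names step]:
  assumes "halts T c"
    and "\<And>c s. T c = Some s \<Longrightarrow> (\<And>c'. c' \<in> leaves s \<Longrightarrow> halts T c') \<Longrightarrow>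
      (\<And>c'. c' \<in> leaves s \<Longrightarrow> P c') \<Longrightarrow> P c"
  shows "P c"
proof -
  from assms(1) obtain r where "out T c r" by (auto simp: halts_def)
  then show ?thesis
  proof (induction rule: out.induct)
    case (1 c s f)
    then show ?case by (intro assms(2)[of c s]) (auto simp: halts_def)
  qed
qed

lemma sem_Some: "sem H t = Some r \<longleftrightarrow> out (step H t) (init_conf H) r"
  proof -
  have "out (step H t) (init_conf H) r \<Longrightarrow> (THE r. out (step H t) (init_conf H) r) = r" for r
    using out_result unfolding result_def .
  then show ?thesis unfolding sem_def outputs_eq_out by auto
qed

section \<open>Simulation up to silent steps\<close>

definition silent :: "('c \<Rightarrow> ('g, 'c) otree option) \<Rightarrow> 'c \<Rightarrow> 'c \<Rightarrow> bool" where
  "silent T = (\<lambda>c c'. T c = Some (Leaf c'))\<^sup>*\<^sup>*"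

lemma silent_refl [simp, intro]: "silent T c c"
  by (simp add: silent_def)

lemma silent_step: "T c = Some (Leaf c') \<Longrightarrow> silent T c' d \<Longrightarrow> silent T c d"
  unfolding silent_def by (rule converse_rtranclp_into_rtranclp)

lemma silent_trans: "silent T c d \<Longrightarrow> silent T d e \<Longrightarrow> silent T c e"
  unfolding silent_def by (rule rtranclp_trans)

lemma out_Leaf: "T c = Some (Leaf c') \<Longrightarrow> out T c r \<longleftrightarrow> out T c' r"
proof
  assume "T c = Some (Leaf c')" "out T c r"
  from this(2) this(1) show "out T c' r" by cases auto
next
  assume "T c = Some (Leaf c')" "out T c' r"
  then have "out T c (graft (Leaf c') (\<lambda>_. r))" by (intro out.intros) auto
  then show "out T c r" by simp
qed

lemma out_silent: "silent T c d \<Longrightarrow> out T c r \<longleftrightarrow> out T d r"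
  unfolding silent_def by (induction rule: converse_rtranclp_induct) (auto simp: out_Leaf)

lemma simulation_halts:
  assumes sim: "\<And>c1 c2. R c1 c2 \<Longrightarrow>
      \<exists>d. silent T2 c2 d \<and> rel_option (rel_otree (=) R) (T1 c1) (T2 d)"
  shows "halts T1 c1 \<Longrightarrow> R c1 c2 \<Longrightarrow> halts T2 c2 \<and> result T2 c2 = result T1 c1"
proof (induction arbitrary: c2 rule: halts_induct)
  case (step c1 s)
  from sim[OF step.prems] obtain d s' where d: "silent T2 c2 d" "T2 d = Some s'"
      and s': "rel_otree (=) R s s'"
    using step(1) by (auto simp: option_rel_Some1)
  have o1: "out T1 c1 (graft s (result T1))" using step by (auto intro: halts_step)
  have h: "halts T2 c'" if "c' \<in> leaves s'" for c'
    using rel_otree_leaves(2)[OF s' that] step.IH by blast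
  have "out T2 d (graft s' (result T2))" using d(2) h by (rule halts_step)
  moreover have "graft s (result T1) = graft s' (result T2)"
  proof (rule graft_rel[OF s'])
    fix y y' assume "y \<in> leaves s" "R y y'"
    then show "result T1 y = result T2 y'" using step.IH[of y y'] by simp
  qed
  ultimately have "out T2 c2 (graft s (result T1))" using out_silent[OF d(1)] by metis
  then show ?case using o1 by (auto simp: out_iff)
qed

text \<open>Induction over the computation of \<open>T2\<close>. The hypothesis is the unfolded
  simulation condition instead of \<open>R c1 c2\<close>, because the configurations between
  \<open>c2\<close> and \<open>d\<close> need not be related to anything, yet the silent path still
  leads from them to \<open>d\<close>.\<close>

lemma simulation_halts_converse:
  assumes sim: "\<And>c1 c2. R c1 c2 \<Longrightarrow>
      \<exists>d. silent T2 c2 d \<and> rel_option (rel_otree (=) R) (T1 c1) (T2 d)"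
  shows "halts T2 c2 \<Longrightarrow> \<exists>d. silent T2 c2 d \<and> rel_option (rel_otree (=) R) (T1 c1) (T2 d) \<Longrightarrow> halts T1 c1"
proof (induction arbitrary: c1 rule: halts_induct)
  case (step c2 s2)
  then obtain d where d: "silent T2 c2 d" "rel_option (rel_otree (=) R) (T1 c1) (T2 d)" by auto
  show ?case
  proof (cases "c2 = d")
    case True
    then obtain s where s: "T1 c1 = Some s" "rel_otree (=) R s s2"
      using d step(1) by (auto simp: option_rel_Some2)
    have "halts T1 c'" if "c' \<in> leaves s" for c'
    proof -
      obtain c'' where c'': "c'' \<in> leaves s2" "R c' c''"
        using rel_otree_leaves(1)[OF s(2) \<open>c' \<in> leaves s\<close>] by blast
      show ?thesis by (rule step.IH[OF c''(1) sim[OF c''(2)]])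
    qed
    then show ?thesis unfolding halts_iff[of T1 c1] using s(1) by simp
  next
    case False
    obtain c where "T2 c2 = Some (Leaf c)" "silent T2 c d"
      using d(1) unfolding silent_def by (cases rule: converse_rtranclpE) (use False in auto)
    then show ?thesis using step.hyps(1) step.IH[of c c1] d(2) by auto
  qed
qed

theorem simulation_out:
  assumes sim: "\<And>c1 c2. R c1 c2 \<Longrightarrow>
      \<exists>d. silent T2 c2 d \<and> rel_option (rel_otree (=) R) (T1 c1) (T2 d)"
    and R: "R c1 c2"
  shows "out T1 c1 r \<longleftrightarrow> out T2 c2 r"
  using simulation_halts[of R T2 T1, OF sim _ R] simulation_halts_converse[of R T2 T1, OF sim _ sim[OF R]]
  by (auto simp: out_iff)

lemma visits_snoc: "visits (cs @ [c]) S = visits cs S + (if fst c \<in> S then 1 else 0)"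
proof -
  have "{i. i < length (cs @ [c]) \<and> fst ((cs @ [c]) ! i) \<in> S} =
    {i. i < length cs \<and> fst (cs ! i) \<in> S} \<union> (if fst c \<in> S then {length cs} else {})"
    by (auto simp: nth_append less_Suc_eq)
  then show ?thesis by (auto simp: visits_def card_Un_disjoint)
qed

lemma is_run_snoc:
  assumes "is_run H t cs" "step H t (last cs) = Some s" "c \<in> leaves s"
  shows "is_run H t (cs @ [c])"
proof -
  have "cs \<noteq> []" using assms(1) by (simp add: is_run_def)
  then have "last cs = cs ! (length cs - 1)" by (simp add: last_conv_nth)
  then show ?thesis using assms \<open>cs \<noteq> []\<close> unfolding is_run_def
    by (auto simp: nth_append less_Suc_eq dest!: sym[of "Suc _" "length cs"])
qed

lemma is_run_init: "is_run H t [init_conf H]"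
  by (simp add: is_run_def)

section \<open>Machines with stay moves\<close>

fun xmove :: "'a tree \<Rightarrow> nat list \<Rightarrow> dir option \<Rightarrow> nat list option" where
  "xmove t u None = Some u"
| "xmove t u (Some d) = move t u d"

definition child_index :: "nat list \<Rightarrow> nat" where
  "child_index u = (if u = [] then 0 else last u)"

type_synonym ('q, 'm, 'a, 'g) xdelta =
  "'q \<Rightarrow> 'a \<Rightarrow> nat \<Rightarrow> 'm \<Rightarrow> ('g, 'q \<times> 'm \<times> dir option) otree option"

definition xstep :: "('q, 'm, 'a, 'g) xdelta \<Rightarrow> 'a tree \<Rightarrow> ('q, 'm) conf \<Rightarrow> ('g, ('q, 'm) conf) otree option" where
  "xstep \<delta> t c = (case c of (u, q, \<mu>) \<Rightarrow>
     (case lab t u of None \<Rightarrow> None | Some \<sigma> \<Rightarrow>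
       (case \<delta> q \<sigma> (child_index u) (\<mu> u) of None \<Rightarrow> None | Some s \<Rightarrow>
         (if \<forall>(q', m', d) \<in> leaves s. xmove t u d \<noteq> None
          then Some (map_otree id (\<lambda>(q', m', d). (the (xmove t u d), q', \<mu>(u := m'))) s)
          else None))))"

text \<open>The potential is the source of visit bounds: a proper move raises the potential of the
  memory at the node it leaves, and stay moves never lower it, so a node whose memory has maximal
  potential cannot be left any more.\<close>

definition leaf_ok :: "('a \<Rightarrow> nat) \<Rightarrow> 'q set \<Rightarrow> 'm set \<Rightarrow> ('m \<Rightarrow> nat) \<Rightarrow> 'a \<Rightarrow> 'm \<Rightarrow> 'q \<times> 'm \<times> dir option \<Rightarrow> bool" where
  "leaf_ok rkS Q M pot \<sigma> m = (\<lambda>(q', m', d). q' \<in> Q \<and> m' \<in> M \<and>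
     (case d of None \<Rightarrow> pot m \<le> pot m'
      | Some d \<Rightarrow> pot m < pot m' \<and> (d = Up \<or> (\<exists>i. d = Down i \<and> 1 \<le> i \<and> i \<le> rkS \<sigma>))))"

definition xclosed :: "'a set \<Rightarrow> ('a \<Rightarrow> nat) \<Rightarrow> 'g set \<Rightarrow> ('g \<Rightarrow> nat) \<Rightarrow> 'q set \<Rightarrow> 'm set \<Rightarrow> ('m \<Rightarrow> nat)
    \<Rightarrow> ('q, 'm, 'a, 'g) xdelta \<Rightarrow> bool" where
  "xclosed Sig rkS Xi rkX Q M pot \<delta> \<longleftrightarrow>
     (\<forall>q\<in>Q. \<forall>\<sigma>\<in>Sig. \<forall>c. \<forall>m\<in>M. \<forall>s. \<delta> q \<sigma> c m = Some s \<longrightarrow>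
        wf_otree Xi rkX s \<and> (\<forall>l\<in>leaves s. leaf_ok rkS Q M pot \<sigma> m l))"

section \<open>Nodes, labels and moves in well-formed trees\<close>

lemma nodes_snocD: "u @ [i] \<in> nodes t \<Longrightarrow> 1 \<le> i"
proof (induction u arbitrary: t)
  case Nil
  then show ?case by (cases t) (auto simp: nodes_def split: if_splits)
next
  case (Cons a u)
  then show ?case by (cases t) (auto simp: nodes_def split: if_splits)
qed

lemma subt_append: "subt t (u @ v) = Option.bind (subt t u) (\<lambda>s. subt s v)"
proof (induction u arbitrary: t)
  case Nil
  then show ?case by simp
next
  case (Cons a u)
  then show ?case by (cases t) auto
qed

lemma wf_tree_subt: "wf_tree Sig rk t \<Longrightarrow> subt t u = Some s \<Longrightarrow> wf_tree Sig rk s"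
proof (induction u arbitrary: t)
  case Nil
  then show ?case by simp
next
  case (Cons a u)
  obtain b ts where t: "t = Node b ts" by (cases t)
  have "1 \<le> a" "a \<le> length ts" "subt (ts ! (a - 1)) u = Some s"
    using Cons.prems(2) by (auto simp: t split: if_splits)
  moreover have "wf_tree Sig rk (ts ! (a - 1))" using Cons.prems(1) calculation(1,2) by (auto simp: t)
  ultimately show ?case using Cons.IH by blast
qed

lemma lab_SomeE:
  assumes "lab t u = Some \<sigma>"
  obtains ts where "subt t u = Some (Node \<sigma> ts)"
proof -
  obtain s where s: "subt t u = Some s" "root_lab s = \<sigma>" using assms by (auto simp: lab_def)
  then show ?thesis using that by (cases s) auto
qed

lemma lab_in_alphabet: "wf_tree Sig rk t \<Longrightarrow> lab t u = Some \<sigma> \<Longrightarrow> \<sigma> \<in> Sig"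
  using wf_tree_subt by (fastforce elim: lab_SomeE)

lemma wf_tree_move_Down:
  assumes "wf_tree Sig rk t" "lab t u = Some \<sigma>" "1 \<le> i" "i \<le> rk \<sigma>"
  shows "move t u (Down i) = Some (u @ [i])"
proof -
  obtain ts where s: "subt t u = Some (Node \<sigma> ts)"
    using assms(2) by (rule lab_SomeE)
  then have "length ts = rk \<sigma>" using wf_tree_subt[OF assms(1) s] by simp
  then have "u @ [i] \<in> nodes t" using s assms(3,4) by (auto simp: nodes_def subt_append)
  then show ?thesis by simp
qed

text \<open>A least relation, so that endless stay moves have no closure; this agrees with
  \<open>out\<close>, where such a computation has no output either.\<close>

inductive stay_closure :: "('q, 'm, 'a, 'g) xdelta \<Rightarrow> 'a \<Rightarrow> nat \<Rightarrow> 'q \<Rightarrow> 'm \<Rightarrow> ('g, 'q \<times> 'm \<times> dir) otree \<Rightarrow> bool"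
  for \<delta> \<sigma> c where
  "\<delta> q \<sigma> c m = Some s \<Longrightarrow>
   (\<forall>q' m'. (q', m', None) \<in> leaves s \<longrightarrow> stay_closure \<delta> \<sigma> c q' m' (f q' m')) \<Longrightarrow>
   stay_closure \<delta> \<sigma> c q m
     (obind s (\<lambda>(q', m', d). case d of None \<Rightarrow> f q' m' | Some d' \<Rightarrow> Leaf (q', m', d')))"

lemma stay_closure_deterministic:
  "stay_closure \<delta> \<sigma> c q m s \<Longrightarrow> stay_closure \<delta> \<sigma> c q m s' \<Longrightarrow> s = s'"
proof (induction arbitrary: s' rule: stay_closure.induct)
  case (1 q m s f)
  from 1(3) show ?case
  proof cases
    case (1 s1 f1)
    then show ?thesis using \<open>\<delta> q \<sigma> c m = Some s\<close> "1.IH"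
      by (auto intro!: obind_cong split: option.splits)
  qed
qed

lemma stay_closure_ok:
  assumes xc: "xclosed Sig rkS Xi rkX Q M pot \<delta>" and "\<sigma> \<in> Sig"
  shows "stay_closure \<delta> \<sigma> c q m s \<Longrightarrow> q \<in> Q \<Longrightarrow> m \<in> M \<Longrightarrow>
    wf_otree Xi rkX s \<and> (\<forall>(q', m', d)\<in>leaves s. leaf_ok rkS Q M pot \<sigma> m (q', m', Some d))"
proof (induction rule: stay_closure.induct)
  case (1 q m s f)
  have s: "wf_otree Xi rkX s" "\<And>l. l \<in> leaves s \<Longrightarrow> leaf_ok rkS Q M pot \<sigma> m l"
    using xc 1 assms(2) unfolding xclosed_def by auto
  have IH: "wf_otree Xi rkX (f q' m') \<and> (\<forall>(q'', m'', d)\<in>leaves (f q' m'). leaf_ok rkS Q M pot \<sigma> m (q'', m'', Some d))"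
    if "(q', m', None) \<in> leaves s" for q' m'
  proof -
    have "leaf_ok rkS Q M pot \<sigma> m (q', m', None)" using s(2) that by auto
    then have *: "q' \<in> Q" "m' \<in> M" "pot m \<le> pot m'" by (auto simp: leaf_ok_def)
    then have "wf_otree Xi rkX (f q' m') \<and> (\<forall>(q'', m'', d)\<in>leaves (f q' m'). leaf_ok rkS Q M pot \<sigma> m' (q'', m'', Some d))"
      using 1(2) that by auto
    then show ?thesis using *(3) unfolding leaf_ok_def by fastforce
  qed
  show ?case
    using s IH by (fastforce simp: leaves_obind intro!: wf_otree_obind split: option.splits)
qed

text \<open>A machine with stay moves and access to the child index of the current node becomes an
  ordinary one by contracting maximal sequences of stay moves and by remembering the child index of
  every node that was entered from above; the index 0 stands for the root or an unknown index.\<close>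

locale xmachine =
  fixes Sig :: "'a set" and rkS :: "'a \<Rightarrow> nat" and Xi :: "'g set" and rkX :: "'g \<Rightarrow> nat"
    and Q :: "'q set" and M :: "'m set" and pot :: "'m \<Rightarrow> nat" and \<delta> :: "('q, 'm, 'a, 'g) xdelta"
    and q0 :: 'q and m0 :: 'm
  assumes fin: "finite Sig" "finite Xi" "finite Q" "finite M"
    and init: "q0 \<in> Q" "m0 \<in> M"
    and closed: "xclosed Sig rkS Xi rkX Q M pot \<delta>"
begin

definition maxrk :: nat where "maxrk = Max (insert 0 (rkS ` Sig))"

lemma rk_le_maxrk: "\<sigma> \<in> Sig \<Longrightarrow> rkS \<sigma> \<le> maxrk"
  unfolding maxrk_def using fin by (intro Max_ge) auto

text \<open>Coding into \<open>nat\<close> gives the machine the type that the theorem asks for. The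
  second component of a state is the index of the edge just descended, 0 after an upward move; that
  of a memory symbol is the index remembered at the node.\<close>

definition encq :: "'q \<times> nat \<Rightarrow> nat" where
  "encq = (SOME f. inj_on f (Q \<times> {..maxrk}))"

definition encm :: "'m \<times> nat \<Rightarrow> nat" where
  "encm = (SOME f. inj_on f (M \<times> {..maxrk}))"

lemma inj_encq: "inj_on encq (Q \<times> {..maxrk})"
proof -
  obtain f :: "'q \<times> nat \<Rightarrow> nat" where "inj_on f (Q \<times> {..maxrk})"
    using finite_imp_inj_to_nat_seg[of "Q \<times> {..maxrk}"] fin by auto
  then show ?thesis unfolding encq_def by (rule someI[where P = "\<lambda>f. inj_on f _"])
qed

lemma inj_encm: "inj_on encm (M \<times> {..maxrk})"
proof -
  obtain f :: "'m \<times> nat \<Rightarrow> nat" where "inj_on f (M \<times> {..maxrk})"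
    using finite_imp_inj_to_nat_seg[of "M \<times> {..maxrk}"] fin by auto
  then show ?thesis unfolding encm_def by (rule someI[where P = "\<lambda>f. inj_on f _"])
qed

definition decq :: "nat \<Rightarrow> 'q \<times> nat" where "decq = inv_into (Q \<times> {..maxrk}) encq"
definition decm :: "nat \<Rightarrow> 'm \<times> nat" where "decm = inv_into (M \<times> {..maxrk}) encm"

lemma decq_encq: "q \<in> Q \<Longrightarrow> j \<le> maxrk \<Longrightarrow> decq (encq (q, j)) = (q, j)"
  unfolding decq_def by (rule inv_into_f_f[OF inj_encq]) auto

lemma decm_encm: "m \<in> M \<Longrightarrow> j \<le> maxrk \<Longrightarrow> decm (encm (m, j)) = (m, j)"
  unfolding decm_def by (rule inv_into_f_f[OF inj_encm]) auto

definition kleaf :: "nat \<Rightarrow> 'q \<times> 'm \<times> dir \<Rightarrow> nat \<times> nat \<times> dir" where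
  "kleaf c = (\<lambda>(q', m', d). (encq (q', case d of Up \<Rightarrow> 0 | Down i \<Rightarrow> i), encm (m', c), d))"

definition kdelta :: "nat \<Rightarrow> 'a \<Rightarrow> nat \<Rightarrow> ('g, nat \<times> nat \<times> dir) otree option" where
  "kdelta n \<sigma> k = (case (decq n, decm k) of ((q, j), (m, co)) \<Rightarrow>
     let c = (if j \<noteq> 0 then j else co) in
     if n \<in> encq ` (Q \<times> {..maxrk}) \<and> k \<in> encm ` (M \<times> {..maxrk}) \<and> \<sigma> \<in> Sig \<and> (\<exists>s. stay_closure \<delta> \<sigma> c q m s)
     then Some (map_otree id (kleaf c) (THE s. stay_closure \<delta> \<sigma> c q m s)) else None)"

definition machine :: "(nat, nat, 'a, 'g) hm" where
  "machine = \<lparr>st = encq ` (Q \<times> {..maxrk}), mem = encm ` (M \<times> {..maxrk}), topm = encm (m0, 0),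
     qinit = encq (q0, 0), delta = kdelta\<rparr>"

lemma kdelta_eq:
  assumes "q \<in> Q" "j \<le> maxrk" "m \<in> M" "co \<le> maxrk" "\<sigma> \<in> Sig"
  shows "kdelta (encq (q, j)) \<sigma> (encm (m, co)) = Some s' \<longleftrightarrow>
    (\<exists>s. stay_closure \<delta> \<sigma> (if j \<noteq> 0 then j else co) q m s \<and>
      s' = map_otree id (kleaf (if j \<noteq> 0 then j else co)) s)"
proof -
  have "(THE s. stay_closure \<delta> \<sigma> c q m s) = s" if "stay_closure \<delta> \<sigma> c q m s" for c s
    using that by (blast intro: stay_closure_deterministic)
  then show ?thesis using assms by (auto simp: kdelta_def decq_encq decm_encm Let_def)
qed

lemma kdelta_SomeE:
  assumes "kdelta n \<sigma> k = Some s'"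
  obtains q j m co s where "n = encq (q, j)" "k = encm (m, co)" "q \<in> Q" "j \<le> maxrk" "m \<in> M" "co \<le> maxrk"
    "\<sigma> \<in> Sig" "stay_closure \<delta> \<sigma> (if j \<noteq> 0 then j else co) q m s"
    "s' = map_otree id (kleaf (if j \<noteq> 0 then j else co)) s"
proof -
  from assms have *: "n \<in> encq ` (Q \<times> {..maxrk})" "k \<in> encm ` (M \<times> {..maxrk})" "\<sigma> \<in> Sig"
    by (auto simp: kdelta_def Let_def split: prod.splits if_splits)
  then obtain q j m co where **: "n = encq (q, j)" "k = encm (m, co)" "q \<in> Q" "j \<le> maxrk" "m \<in> M" "co \<le> maxrk"
    by auto
  from kdelta_eq[OF **(3-6) *(3)] assms ** *(3) that show ?thesis by metis
qed

lemma kdelta_leaf: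
  assumes "q \<in> Q" "m \<in> M" "c \<le> maxrk" "\<sigma> \<in> Sig" "stay_closure \<delta> \<sigma> c q m s"
    "(q', m', d) \<in> leaves s"
  shows "q' \<in> Q" "m' \<in> M" "pot m < pot m'" "d = Up \<or> (\<exists>i. d = Down i \<and> 1 \<le> i \<and> i \<le> rkS \<sigma>)"
    "(case d of Up \<Rightarrow> 0 | Down i \<Rightarrow> i) \<le> maxrk"
proof -
  have "leaf_ok rkS Q M pot \<sigma> m (q', m', Some d)"
    using stay_closure_ok[OF closed assms(4,5,1,2)] assms(6) by auto
  then show "q' \<in> Q" "m' \<in> M" "pot m < pot m'" and d: "d = Up \<or> (\<exists>i. d = Down i \<and> 1 \<le> i \<and> i \<le> rkS \<sigma>)"
    by (auto simp: leaf_ok_def)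
  from d show "(case d of Up \<Rightarrow> 0 | Down i \<Rightarrow> i) \<le> maxrk"
    using rk_le_maxrk[OF assms(4)] by auto
qed

lemma machine_uthm: "is_uthm Sig rkS Xi rkX machine"
proof -
  have "n \<in> st machine \<and> \<sigma> \<in> Sig \<and> k \<in> mem machine \<and> wf_otree Xi rkX s' \<and>
      (\<forall>(n', k', d) \<in> leaves s'. n' \<in> st machine \<and> k' \<in> mem machine \<and>
             (d = Up \<or> (\<exists>i. d = Down i \<and> 1 \<le> i \<and> i \<le> rkS \<sigma>)))"
    if "kdelta n \<sigma> k = Some s'" for n \<sigma> k s'
    using that
  proof (rule kdelta_SomeE)
    fix q j m co s
    assume *: "n = encq (q, j)" "k = encm (m, co)" "q \<in> Q" "j \<le> maxrk" "m \<in> M" "co \<le> maxrk"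
    "\<sigma> \<in> Sig" and cl: "stay_closure \<delta> \<sigma> (if j \<noteq> 0 then j else co) q m s" (is "stay_closure _ _ ?c _ _ _")
    and s': "s' = map_otree id (kleaf (if j \<noteq> 0 then j else co)) s"
    have c: "?c \<le> maxrk" using * by auto
    have l: "n' \<in> st machine \<and> k' \<in> mem machine \<and> (d = Up \<or> (\<exists>i. d = Down i \<and> 1 \<le> i \<and> i \<le> rkS \<sigma>))"
      if lf: "(n', k', d) \<in> leaves s'" for n' k' d
    proof -
      obtain q' m' where qm: "(q', m', d) \<in> leaves s" "n' = encq (q', case d of Up \<Rightarrow> 0 | Down i \<Rightarrow> i)" "k' = encm (m', ?c)"
        using lf by (auto simp: s' otree.set_map kleaf_def)
      show ?thesis using kdelta_leaf[OF *(3) *(5) c *(7) cl qm(1)] c qm(2,3) by (simp add: machine_def)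
    qed
    have "wf_otree Xi rkX s'"
      using stay_closure_ok[OF closed *(7) cl *(3,5)] by (simp add: s' wf_otree_map)
    then show ?thesis using l * by (auto simp: machine_def)
  qed
  then show ?thesis unfolding is_uthm_def using fin init by (auto simp: machine_def)
qed

text \<open>The last configuration is left out because its visit is not over: the potential of a
  node rises only when the node is left.\<close>

lemma run_potential:
  assumes "is_run machine t cs"
  shows "(\<forall>x. snd (snd (last cs)) x \<in> mem machine) \<and> fst (snd (last cs)) \<in> st machine \<and>
    (\<forall>x. visits (butlast cs) {x} \<le> pot (fst (decm (snd (snd (last cs)) x))))"
  using assms
proof (induction cs rule: rev_induct)
  case Nil
  then show ?case by (simp add: is_run_def)
next
  case (snoc c cs)
  show ?case
  proof (cases "cs = []")
    case True
    then show ?thesis using snoc(2) init by (auto simp: is_run_def init_conf_def machine_def visits_def)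
  next
    case False
    then have run: "is_run machine t cs" using snoc(2)
      unfolding is_run_def by (auto simp: nth_append split: if_splits)
    obtain u n \<mu> where l: "last cs = (u, n, \<mu>)" by (metis prod_cases3)
    obtain s where s: "step machine t (u, n, \<mu>) = Some s" "c \<in> leaves s"
      using snoc(2) False l unfolding is_run_def
      by (auto simp: nth_append last_conv_nth dest!: spec[of _ "length cs - 1"])
    then obtain \<sigma> s' n' k' d where s': "kdelta n \<sigma> (\<mu> u) = Some s'" "(n', k', d) \<in> leaves s'"
        "c = (the (move t u d), n', \<mu>(u := k'))"
      by (auto simp: step_def machine_def otree.set_map split: option.splits if_splits)
    have IH: "\<And>x. \<mu> x \<in> mem machine" "\<And>x. visits (butlast cs) {x} \<le> pot (fst (decm (\<mu> x)))"
      using snoc(1)[OF run] l by auto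
    have u': "n' \<in> st machine" "k' \<in> mem machine" using machine_uthm s'(1,2)
      unfolding is_uthm_def by (fastforce simp: machine_def)+
    have pot: "pot (fst (decm (\<mu> u))) < pot (fst (decm k'))"
      using s'(1)
    proof (rule kdelta_SomeE)
      fix q j m co s
      assume *: "n = encq (q, j)" "\<mu> u = encm (m, co)" "q \<in> Q" "j \<le> maxrk" "m \<in> M" "co \<le> maxrk"
      "\<sigma> \<in> Sig" and cl: "stay_closure \<delta> \<sigma> (if j \<noteq> 0 then j else co) q m s" (is "stay_closure _ _ ?c _ _ _")
      and s: "s' = map_otree id (kleaf (if j \<noteq> 0 then j else co)) s"
      have c: "?c \<le> maxrk" using * by auto
      obtain q' m' where qm: "(q', m', d) \<in> leaves s" "k' = encm (m', ?c)"
        using s'(2) by (auto simp: s otree.set_map kleaf_def)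
      show ?thesis using kdelta_leaf[OF *(3) *(5) c *(7) cl qm(1)] c qm(2) * by (simp add: decm_encm)
    qed
    have "visits cs {x} = visits (butlast cs) {x} + (if x = u then 1 else 0)" for x
    proof -
      have "cs = butlast cs @ [(u, n, \<mu>)]" using l False by (metis append_butlast_last_id)
      then show ?thesis using visits_snoc[of "butlast cs" "(u, n, \<mu>)" "{x}"] by auto
    qed
    then show ?thesis using IH u' pot s'(3) by (auto simp: Suc_le_eq order.strict_trans1 intro: le_less_trans)
  qed
qed

lemma machine_thm: "is_thm Sig rkS Xi rkX machine"
proof -
  let ?B = "Max (pot ` M)"
  have "visits cs {u} \<le> Suc ?B" if "is_run machine t cs" for t cs u
  proof -
    have "snd (snd (last cs)) u \<in> encm ` (M \<times> {..maxrk})"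
      using run_potential[OF that] by (auto simp: machine_def)
    then have "fst (decm (snd (snd (last cs)) u)) \<in> M" by (auto simp: decm_encm)
    then have b: "visits (butlast cs) {u} \<le> ?B"
      using run_potential[OF that] fin(4) by (meson Max_ge finite_imageI image_eqI order_trans)
    have "cs \<noteq> []" using that by (auto simp: is_run_def)
    then obtain ds c where cs: "cs = ds @ [c]" by (metis append_butlast_last_id)
    then show ?thesis using b by (simp add: visits_snoc)
  qed
  then have "bounded_visit machine {t. wf_tree Sig rkS t}" unfolding bounded_visit_def by blast
  then show ?thesis using machine_uthm by (simp add: is_thm_def)
qed

text \<open>A correct remembered index is demanded only at proper ancestors of the current node,
  which stored it when they were left downwards. At the current node it may still sit in the state
  alone, and elsewhere the memory may hold any index in range.\<close>

definition conf_rel :: "(nat, nat) conf \<Rightarrow> ('q, 'm) conf \<Rightarrow> bool" where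
  "conf_rel = (\<lambda>(u, n, \<kappa>) (v, q, \<mu>). u = v \<and> q \<in> Q \<and> (\<forall>x. \<mu> x \<in> M) \<and>
     (\<exists>j co. j \<le> maxrk \<and> (\<forall>x. co x \<le> maxrk) \<and> n = encq (q, j) \<and> (\<forall>x. \<kappa> x = encm (\<mu> x, co x)) \<and>
       (if j \<noteq> 0 then j else co u) = child_index u \<and> (\<forall>x. strict_prefix x u \<longrightarrow> co x = child_index x)))"

lemma conf_rel_leaf:
  assumes "q' \<in> Q" "m' \<in> M" "\<forall>x. \<mu> x \<in> M" "child_index u \<le> maxrk" "\<forall>x. co x \<le> maxrk"
    "\<forall>x. strict_prefix x u \<longrightarrow> co x = child_index x" "\<forall>x. \<kappa> x = encm (\<mu> x, co x)"
    "(case d of Up \<Rightarrow> 0 | Down i \<Rightarrow> i) \<le> maxrk" "move t u d = Some v"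
  shows "conf_rel (v, encq (q', case d of Up \<Rightarrow> 0 | Down i \<Rightarrow> i), \<kappa>(u := encm (m', child_index u))) (v, q', \<mu>(u := m'))"
proof -
  let ?co = "co(u := child_index u)"
  have v: "(if (case d of Up \<Rightarrow> 0 | Down i \<Rightarrow> i) \<noteq> 0 then (case d of Up \<Rightarrow> 0 | Down i \<Rightarrow> i) else ?co v) = child_index v
      \<and> (\<forall>x. strict_prefix x v \<longrightarrow> ?co x = child_index x)"
  proof (cases d)
    case Up
    then have "u \<noteq> []" "v = butlast u" using assms(9) by (auto split: if_splits)
    then have "\<exists>a. u = v @ [a]" by (metis append_butlast_last_id)
    then show ?thesis using assms(6) Up by (auto simp: strict_prefix_def)
  next
    case (Down i)
    then have "v = u @ [i]" "u @ [i] \<in> nodes t" using assms(9) by (auto split: if_splits)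
    moreover have "strict_prefix x (u @ [i]) \<longleftrightarrow> x = u \<or> strict_prefix x u" for x
      by (auto simp: strict_prefix_def)
    moreover have "child_index (u @ [i]) = i" by (simp add: child_index_def)
    ultimately show ?thesis using assms(6) Down nodes_snocD[of u i t] by auto
  qed
  then show ?thesis unfolding conf_rel_def prod.case using assms
    by (intro conjI exI[of _ "case d of Up \<Rightarrow> 0 | Down i \<Rightarrow> i"] exI[of _ ?co]) auto
qed

lemma stay_closure_out:
  assumes "lab t u = Some \<sigma>" "c = child_index u"
  shows "stay_closure \<delta> \<sigma> c q m s \<Longrightarrow> \<mu> u = m \<Longrightarrow>
    (\<forall>(q', m', d) \<in> leaves s. move t u d \<noteq> None \<and> out (xstep \<delta> t) (the (move t u d), q', \<mu>(u := m')) (g (q', m', d)))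
    \<Longrightarrow> out (xstep \<delta> t) (u, q, \<mu>) (graft s g)"
proof (induction arbitrary: \<mu> rule: stay_closure.induct)
  case (1 q m s f)
  let ?F = "\<lambda>(q', m', d). case d of None \<Rightarrow> f q' m' | Some d' \<Rightarrow> Leaf (q', m', d')"
  let ?h = "\<lambda>(q', m', d). (the (xmove t u d), q', \<mu>(u := m'))"
  have l: "xmove t u d \<noteq> None \<and> out (xstep \<delta> t) (?h (q', m', d)) (graft (?F (q', m', d)) g)"
    if "(q', m', d) \<in> leaves s" for q' m' d
  proof (cases d)
    case None
    have "out (xstep \<delta> t) (u, q', \<mu>(u := m')) (graft (f q' m') g)"
    proof (rule 1(2)[rule_format, THEN conjunct2, rule_format])
      show "(q', m', None) \<in> leaves s" using that None by simp
      show "(\<mu>(u := m')) u = m'" by simp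
      fix l assume "l \<in> leaves (f q' m')"
      then have "l \<in> leaves (obind s ?F)" using that None by (force simp: leaves_obind)
      then show "case l of (q'', m'', d) \<Rightarrow> move t u d \<noteq> None \<and>
          out (xstep \<delta> t) (the (move t u d), q'', (\<mu>(u := m'))(u := m'')) (g (q'', m'', d))"
        using bspec[OF 1(4)] by (auto simp: fun_upd_def cong: if_cong)
    qed
    then show ?thesis using None by simp
  next
    case (Some d')
    then have "(q', m', d') \<in> leaves (obind s ?F)" using that by (force simp: leaves_obind)
    then show ?thesis using bspec[OF 1(4)] Some by (auto simp: fun_upd_def)
  qed
  let ?s = "map_otree id ?h s"
  have st: "xstep \<delta> t (u, q, \<mu>) = Some ?s" using l 1(1,3) assms by (auto simp: xstep_def)
  have "out (xstep \<delta> t) (u, q, \<mu>) (graft ?s (result (xstep \<delta> t)))"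
    using st l by (intro halts_step) (fastforce simp: otree.set_map halts_def)+
  also have "graft ?s (result (xstep \<delta> t)) = graft (obind s ?F) g"
    unfolding graft_map_otree graft_obind
    using l by (intro graft_cong) (auto simp: out_iff split: prod.splits)
  finally show ?case .
qed

text \<open>One step of the machine contracts a whole tree of stay steps, which may output and
  branch, so \<open>simulation_out\<close> with its silent catching up does not apply. The two
  directions are separate inductions, here and in \<open>machine_halts\<close>.\<close>

lemma machine_out_imp:
  "halts (step machine t) k \<Longrightarrow> wf_tree Sig rkS t \<Longrightarrow> conf_rel k e \<Longrightarrow> out (xstep \<delta> t) e (result (step machine t) k)"
proof (induction arbitrary: e rule: halts_induct)
  case (step k s1)
  obtain u n \<kappa> where k: "k = (u, n, \<kappa>)" by (metis prod_cases3)
  obtain q \<mu> where e: "e = (u, q, \<mu>)" using step.prems(2) k by (cases e) (auto simp: conf_rel_def)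
  obtain j co where R: "q \<in> Q" "\<forall>x. \<mu> x \<in> M" "j \<le> maxrk" "\<forall>x. co x \<le> maxrk" "n = encq (q, j)"
    "\<forall>x. \<kappa> x = encm (\<mu> x, co x)" "(if j \<noteq> 0 then j else co u) = child_index u"
    "\<forall>x. strict_prefix x u \<longrightarrow> co x = child_index x"
    using step.prems(2) unfolding conf_rel_def k e by auto
  have c: "child_index u \<le> maxrk" using R(3,4,7) by (metis)
  obtain \<sigma> where \<sigma>: "lab t u = Some \<sigma>" using step.hyps(1) k by (auto simp: step_def split: option.splits)
  have \<sigma>S: "\<sigma> \<in> Sig" using lab_in_alphabet[OF step.prems(1) \<sigma>] .
  obtain s' where s': "kdelta n \<sigma> (\<kappa> u) = Some s'" "\<forall>(q', m', d) \<in> leaves s'. move t u d \<noteq> None"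
      "s1 = map_otree id (\<lambda>(q', m', d). (the (move t u d), q', \<kappa>(u := m'))) s'"
    using step.hyps(1) k \<sigma> by (auto simp: step_def machine_def split: option.splits if_splits)
  obtain s where s: "stay_closure \<delta> \<sigma> (child_index u) q (\<mu> u) s" "s' = map_otree id (kleaf (child_index u)) s"
    using s'(1) kdelta_eq[of q j "\<mu> u" "co u" \<sigma> s'] R \<sigma>S by auto
  let ?k = "\<lambda>(q', m', d). (the (move t u d), encq (q', case d of Up \<Rightarrow> 0 | Down i \<Rightarrow> i), \<kappa>(u := encm (m', child_index u)))"
  have s1: "s1 = map_otree id ?k s" unfolding s'(3) s(2) otree.map_comp
    by (rule otree.map_cong) (auto simp: kleaf_def)
  let ?T = "step machine t"
  have leafs: "move t u d \<noteq> None \<and>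
       out (xstep \<delta> t) (the (move t u d), q', \<mu>(u := m')) (result ?T (?k (q', m', d)))"
    if l: "(q', m', d) \<in> leaves s" for q' m' d
  proof
    show mv: "move t u d \<noteq> None" using l s'(2) by (force simp: s(2) otree.set_map kleaf_def)
    show "out (xstep \<delta> t) (the (move t u d), q', \<mu>(u := m')) (result ?T (?k (q', m', d)))"
    proof (rule step.IH)
      show "?k (q', m', d) \<in> leaves s1" using l unfolding s1 otree.set_map by blast
      show "wf_tree Sig rkS t" by fact
      have m: "\<mu> u \<in> M" using R by simp
      from mv obtain v where v: "move t u d = Some v" by auto
      show "conf_rel (?k (q', m', d)) (the (move t u d), q', \<mu>(u := m'))"
        using conf_rel_leaf[OF kdelta_leaf(1,2)[OF R(1) m c \<sigma>S s(1) l] R(2) c R(4,8,6) kdelta_leaf(5)[OF R(1) m c \<sigma>S s(1) l] v] v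
        by simp
    qed
  qed
  have "out (xstep \<delta> t) (u, q, \<mu>) (graft s (\<lambda>l. result ?T (?k l)))"
    by (rule stay_closure_out[where \<mu> = \<mu> and g = "\<lambda>l. result ?T (?k l)", OF \<sigma> refl s(1) refl])
      (use leafs in \<open>auto simp: fun_upd_def\<close>)
  also have "graft s (\<lambda>l. result ?T (?k l)) = graft s1 (result ?T)" by (simp add: s1 graft_map_otree)
  also have "\<dots> = result ?T k"
    using halts_step[OF step.hyps] by (simp add: out_iff)
  finally show ?case using e by simp
qed

lemma machine_halts:
  "halts (xstep \<delta> t) e \<Longrightarrow> wf_tree Sig rkS t \<Longrightarrow> conf_rel k e \<Longrightarrow> halts (step machine t) k"
proof (induction arbitrary: k rule: halts_induct)
  case (step e s1)
  obtain u n \<kappa> where k: "k = (u, n, \<kappa>)" by (metis prod_cases3)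
  obtain q \<mu> where e: "e = (u, q, \<mu>)" using step.prems(2) k by (cases e) (auto simp: conf_rel_def)
  obtain j co where R: "q \<in> Q" "\<forall>x. \<mu> x \<in> M" "j \<le> maxrk" "\<forall>x. co x \<le> maxrk" "n = encq (q, j)"
    "\<forall>x. \<kappa> x = encm (\<mu> x, co x)" "(if j \<noteq> 0 then j else co u) = child_index u"
    "\<forall>x. strict_prefix x u \<longrightarrow> co x = child_index x"
    using step.prems(2) unfolding conf_rel_def k e by auto
  let ?c = "child_index u"
  have c: "?c \<le> maxrk" using R(3,4,7) by (metis)
  obtain \<sigma> where \<sigma>: "lab t u = Some \<sigma>" using step.hyps(1) e by (auto simp: xstep_def split: option.splits)
  have \<sigma>S: "\<sigma> \<in> Sig" using lab_in_alphabet[OF step.prems(1) \<sigma>] .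
  have m: "\<mu> u \<in> M" using R by simp
  let ?h = "\<lambda>(q', m', d). (the (xmove t u d), q', \<mu>(u := m'))"
  let ?k = "\<lambda>(q', m', d). (the (move t u d), encq (q', case d of Up \<Rightarrow> 0 | Down i \<Rightarrow> i), \<kappa>(u := encm (m', ?c)))"
  obtain s where s: "\<delta> q \<sigma> ?c (\<mu> u) = Some s" "\<forall>(q', m', d) \<in> leaves s. xmove t u d \<noteq> None"
      "s1 = map_otree id ?h s"
    using step.hyps(1) e \<sigma> by (auto simp: xstep_def split: option.splits if_splits)
  have lok: "leaf_ok rkS Q M pot \<sigma> (\<mu> u) l" if "l \<in> leaves s" for l
    using closed s(1) R(1) m \<sigma>S that unfolding xclosed_def by blast
  have IH: "halts (step machine t) k'" if "l \<in> leaves s" "conf_rel k' (?h l)" for l k'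
    using step.IH[of "?h l" k'] step.prems(1) that by (auto simp: s(3) otree.set_map)
  have ex: "\<exists>s'. stay_closure \<delta> \<sigma> ?c q' m' s' \<and>
      (\<forall>(q'', m'', d)\<in>leaves s'. move t u d \<noteq> None \<and> halts (step machine t) (?k (q'', m'', d)))"
    if l: "(q', m', None) \<in> leaves s" for q' m'
  proof -
    have ok: "q' \<in> Q" "m' \<in> M" using lok[OF l] by (auto simp: leaf_ok_def)
    \<comment> \<open>The machine need not ever reach this configuration. It is posited so that the
      induction hypothesis applies to the stay leaf; since it halts it has a step, and this step
      exhibits the stay closure sought.\<close>
    let ?k' = "(u, encq (q', j), \<kappa>(u := encm (m', co u)))"
    have "conf_rel ?k' (?h (q', m', None))" unfolding conf_rel_def prod.case
      using ok R by (intro conjI exI[of _ j] exI[of _ co]) auto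
    from IH[OF l this] obtain s2 where s2: "step machine t ?k' = Some s2" "\<forall>c'\<in>leaves s2. halts (step machine t) c'"
      unfolding halts_iff[of _ ?k'] by auto
    then obtain s3 where s3: "kdelta (encq (q', j)) \<sigma> (encm (m', co u)) = Some s3" "\<forall>(q', m', d) \<in> leaves s3. move t u d \<noteq> None"
      "s2 = map_otree id (\<lambda>(q', m'', d). (the (move t u d), q', (\<kappa>(u := encm (m', co u)))(u := m''))) s3"
      using \<sigma> by (auto simp: step_def machine_def split: option.splits if_splits)
    obtain s4 where s4: "stay_closure \<delta> \<sigma> ?c q' m' s4" "s3 = map_otree id (kleaf ?c) s4"
      using s3(1) kdelta_eq[of q' j m' "co u" \<sigma> s3] R \<sigma>S ok by auto
    have "move t u d \<noteq> None \<and> halts (step machine t) (?k (q'', m'', d))" if "(q'', m'', d)\<in>leaves s4" for q'' m'' d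
    proof
      have "kleaf ?c (q'', m'', d) \<in> leaves s3" using that by (auto simp: s4(2) otree.set_map)
      then show "move t u d \<noteq> None" "halts (step machine t) (?k (q'', m'', d))"
        using s3(2) s2(2) by (force simp: s3(3) otree.set_map kleaf_def)+
    qed
    then show ?thesis using s4(1) by blast
  qed
  define f where "f q' m' = (SOME s'. stay_closure \<delta> \<sigma> ?c q' m' s' \<and>
      (\<forall>(q'', m'', d)\<in>leaves s'. move t u d \<noteq> None \<and> halts (step machine t) (?k (q'', m'', d))))" for q' m'
  have f: "stay_closure \<delta> \<sigma> ?c q' m' (f q' m')"
      "\<forall>(q'', m'', d)\<in>leaves (f q' m'). move t u d \<noteq> None \<and> halts (step machine t) (?k (q'', m'', d))"
      if "(q', m', None) \<in> leaves s" for q' m'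
    using someI_ex[OF ex[OF that]] unfolding f_def by auto
  let ?F = "\<lambda>(q', m', d). case d of None \<Rightarrow> f q' m' | Some d' \<Rightarrow> Leaf (q', m', d')"
  have cl: "stay_closure \<delta> \<sigma> ?c q (\<mu> u) (obind s ?F)"
    using s(1) f(1) by (intro stay_closure.intros) auto
  have all: "move t u d \<noteq> None \<and> halts (step machine t) (?k (q', m', d))" if l: "(q', m', d) \<in> leaves (obind s ?F)" for q' m' d
  proof -
    from l obtain q1 m1 d1 where l1: "(q1, m1, d1) \<in> leaves s" "(q', m', d) \<in> leaves (?F (q1, m1, d1))"
      by (auto simp: leaves_obind)
    show ?thesis
    proof (cases d1)
      case None
      then show ?thesis using f(2)[of q1 m1] l1 by auto
    next
      case (Some d')
      then have l2: "(q', m', Some d) \<in> leaves s" using l1 by auto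
      then have mv: "move t u d \<noteq> None" using s(2) by auto
      then obtain v where v: "move t u d = Some v" by auto
      have "halts (step machine t) (?k (q', m', d))"
        using IH[OF l2] conf_rel_leaf[OF kdelta_leaf(1,2)[OF R(1) m c \<sigma>S cl l] R(2) c R(4,8,6) kdelta_leaf(5)[OF R(1) m c \<sigma>S cl l] v] v
        by simp
      then show ?thesis using mv by simp
    qed
  qed
  have "kdelta n \<sigma> (\<kappa> u) = Some (map_otree id (kleaf ?c) (obind s ?F))"
    using kdelta_eq[of q j "\<mu> u" "co u" \<sigma>] R \<sigma>S cl by auto
  then have "step machine t k = Some (map_otree id (\<lambda>(q', m', d). (the (move t u d), q', \<kappa>(u := m'))) (map_otree id (kleaf ?c) (obind s ?F)))"
    using \<sigma> all by (auto simp: k step_def machine_def otree.set_map kleaf_def)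
  moreover have "\<forall>c'\<in>leaves (map_otree id (\<lambda>(q', m', d). (the (move t u d), q', \<kappa>(u := m'))) (map_otree id (kleaf ?c) (obind s ?F))). halts (step machine t) c'"
    using all by (fastforce simp: otree.set_map kleaf_def)
  ultimately show ?case unfolding halts_iff[of _ k] by blast
qed

theorem machine_sem:
  assumes "wf_tree Sig rkS t"
  shows "sem machine t = Some r \<longleftrightarrow> out (xstep \<delta> t) ([], q0, \<lambda>_. m0) r"
proof -
  have R: "conf_rel (init_conf machine) ([], q0, \<lambda>_. m0)"
    unfolding conf_rel_def init_conf_def machine_def using init
    by (auto simp: child_index_def intro!: exI[of _ 0] exI[of _ "\<lambda>_. 0"])
  show ?thesis unfolding sem_Some
    using machine_out_imp[OF _ assms R] machine_halts[OF _ assms R] by (metis out_iff)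
qed

end

section \<open>Counting visits\<close>

definition counted :: "nat \<Rightarrow> ('q, 'm, 'a, 'g) hm \<Rightarrow> ('q, 'm \<times> nat, 'a, 'g) hm" where
  "counted C H = \<lparr>st = st H, mem = mem H \<times> {..C}, topm = (topm H, 0), qinit = qinit H,
     delta = (\<lambda>q \<sigma> (m, k). if k < C
       then map_option (map_otree id (\<lambda>(q', m', d). (q', (m', Suc k), d))) (delta H q \<sigma> m) else None)\<rparr>"

lemma counted_deltaE:
  assumes "delta (counted C H) q \<sigma> m = Some s"
  obtains s0 where "delta H q \<sigma> (fst m) = Some s0" "snd m < C"
    "s = map_otree id (\<lambda>(q', m', d). (q', (m', Suc (snd m)), d)) s0"
  using assms by (auto simp: counted_def split: if_splits prod.splits)

lemma counted_uthm:
  assumes "is_uthm Sig rkS Gam rkG H"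
  shows "is_uthm Sig rkS Gam rkG (counted C H)"
proof -
  have "q \<in> st (counted C H) \<and> \<sigma> \<in> Sig \<and> m \<in> mem (counted C H) \<and> wf_otree Gam rkG s \<and>
        (\<forall>(q', m', d) \<in> leaves s. q' \<in> st (counted C H) \<and> m' \<in> mem (counted C H) \<and>
             (d = Up \<or> (\<exists>i. d = Down i \<and> 1 \<le> i \<and> i \<le> rkS \<sigma>)))"
    if "delta (counted C H) q \<sigma> m = Some s" for q \<sigma> m s
    using that
  proof (rule counted_deltaE)
    fix s0 assume s0: "delta H q \<sigma> (fst m) = Some s0" "snd m < C"
      "s = map_otree id (\<lambda>(q', m', d). (q', (m', Suc (snd m)), d)) s0"
    from assms s0(1) have *: "q \<in> st H \<and> \<sigma> \<in> Sig \<and> fst m \<in> mem H \<and> wf_otree Gam rkG s0 \<and>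
        (\<forall>(q', m', d) \<in> leaves s0. q' \<in> st H \<and> m' \<in> mem H \<and>
             (d = Up \<or> (\<exists>i. d = Down i \<and> 1 \<le> i \<and> i \<le> rkS \<sigma>)))"
      unfolding is_uthm_def by blast
    then show ?thesis using s0(2)
      by (cases m) (auto simp: s0(3) wf_otree_map otree.set_map counted_def)
  qed
  then show ?thesis using assms unfolding is_uthm_def[of _ _ _ _ "counted C H"]
    by (auto simp: is_uthm_def counted_def)
qed

lemma counted_delta:
  assumes "delta (counted C H) q \<sigma> m = Some s"
  shows "snd m < C" and "(q', m', d) \<in> leaves s \<Longrightarrow> snd m < snd m'"
  using assms by (auto simp: counted_def otree.set_map split: if_splits prod.splits)

text \<open>The counter is the number of earlier visits along the present branch, so the relation
  \<open>R\<close> has to carry a run that leads to the configuration. The bound \<open>C\<close>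
  also covers the visit in progress, hence the counter is still below \<open>C\<close> and the
  cutoff never takes effect.\<close>

lemma counted_sem:
  assumes "\<And>cs u. is_run H t cs \<Longrightarrow> u \<in> nodes t \<Longrightarrow> visits cs {u} \<le> C"
  shows "sem (counted C H) t = sem H t"
proof -
  define R :: "('a, 'b) conf \<Rightarrow> ('a, 'b \<times> nat) conf \<Rightarrow> bool" where
    "R c c' \<longleftrightarrow> (\<exists>cs u q \<mu>. is_run H t (cs @ [c]) \<and> c = (u, q, \<mu>) \<and> c' = (u, q, \<lambda>x. (\<mu> x, visits cs {x})))" for c c'
  have sim: "rel_option (rel_otree (=) R) (step H t c) (step (counted C H) t c')" if R: "R c c'" for c c'
  proof -
    from R obtain cs u q \<mu> where r: "is_run H t (cs @ [c])" and c: "c = (u, q, \<mu>)"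
      and c': "c' = (u, q, \<lambda>x. (\<mu> x, visits cs {x}))" unfolding R_def by blast
    show ?thesis
    proof (cases "lab t u")
      case None
      then show ?thesis by (simp add: step_def c c')
    next
      case (Some \<sigma>)
      then have "u \<in> nodes t" by (auto simp: lab_def nodes_def)
      then have less: "visits cs {u} < C" using assms[OF r, of u] by (simp add: visits_snoc c)
      show ?thesis
      proof (cases "step H t c")
        case None
        then have "step (counted C H) t c' = None"
          using less Some by (auto simp: step_def c c' counted_def otree.set_map split: option.splits if_splits)
        then show ?thesis using None by simp
      next
        case st: (Some s)
        then obtain s0 where s0: "delta H q \<sigma> (\<mu> u) = Some s0"
          "\<forall>(q', m', d)\<in>leaves s0. move t u d \<noteq> None"
          "s = map_otree id (\<lambda>(q', m', d). (the (move t u d), q', \<mu>(u := m'))) s0"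
          using Some by (auto simp: step_def c split: option.splits if_splits)
        have st': "step (counted C H) t c' = Some (map_otree id (\<lambda>(q', m', d).
            (the (move t u d), q', (\<lambda>x. (\<mu> x, visits cs {x}))(u := m')))
              (map_otree id (\<lambda>(q', m', d). (q', (m', Suc (visits cs {u})), d)) s0))"
          using Some less s0 by (auto simp: step_def c' counted_def otree.set_map)
        have "R (the (move t u d), q', \<mu>(u := m'))
            (the (move t u d), q', (\<lambda>x. (\<mu> x, visits cs {x}))(u := (m', Suc (visits cs {u}))))"
          if l: "(q', m', d) \<in> leaves s0" for q' m' d
        proof -
          have "is_run H t ((cs @ [c]) @ [(the (move t u d), q', \<mu>(u := m'))])"
            by (rule is_run_snoc[OF r]) (use st l in \<open>force simp: s0(3) otree.set_map\<close>)+
          moreover have "(\<lambda>x. (\<mu> x, visits cs {x}))(u := (m', Suc (visits cs {u}))) =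
              (\<lambda>x. ((\<mu>(u := m')) x, visits (cs @ [c]) {x}))"
            by (auto simp: visits_snoc c)
          ultimately show ?thesis unfolding R_def
            by (intro exI[of _ "cs @ [c]"] exI[of _ "the (move t u d)"] exI[of _ q'] exI[of _ "\<mu>(u := m')"]) simp
        qed
        then have "rel_otree (=) R s (map_otree id (\<lambda>(q', m', d).
            (the (move t u d), q', (\<lambda>x. (\<mu> x, visits cs {x}))(u := m')))
              (map_otree id (\<lambda>(q', m', d). (q', (m', Suc (visits cs {u})), d)) s0))"
          unfolding s0(3) otree.map_comp by (simp, intro rel_otree_map) auto
        then show ?thesis using st st' by simp
      qed
    qed
  qed
  have "R (init_conf H) (init_conf (counted C H))"
    unfolding R_def by (rule exI[of _ "[]"]) (auto simp: is_run_init[unfolded init_conf_def] init_conf_def counted_def visits_def)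
  then have "out (step H t) (init_conf H) r \<longleftrightarrow> out (step (counted C H) t) (init_conf (counted C H)) r" for r
    using simulation_out[of R] sim by blast
  then show ?thesis by (metis (no_types) sem_Some option.exhaust)
qed

section \<open>The domain is recognizable\<close>

text \<open>Freezing the memory into the labels detaches a subtree from its position, so that
  subtrees of different inputs become comparable.\<close>

function annot :: "'a tree \<Rightarrow> (nat list \<Rightarrow> 'm) \<Rightarrow> ('a \<times> 'm) tree" where
  "annot (Node a ts) \<mu> = Node (a, \<mu> []) (map (\<lambda>i. annot (ts ! i) (\<lambda>v. \<mu> (Suc i # v))) [0..<length ts])"
  by pat_completeness auto
termination
proof (relation "measure (\<lambda>(t, _). size t)")
  fix a :: 'a and ts :: "'a tree list" and \<mu> :: "nat list \<Rightarrow> 'm" and i assume "i \<in> set [0..<length ts]"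
  then have "size (ts ! i) \<le> size_list size ts" by (intro size_list_estimation'[of "ts ! i"]) auto
  then show "((ts ! i, \<lambda>v. \<mu> (Suc i # v)), Node a ts, \<mu>) \<in> measure (\<lambda>(t, _). size t)" by simp
qed simp

definition annot_at :: "'a tree \<Rightarrow> nat list \<Rightarrow> (nat list \<Rightarrow> 'm) \<Rightarrow> ('a \<times> 'm) tree" where
  "annot_at t u \<mu> = annot (the (subt t u)) (\<lambda>v. \<mu> (u @ v))"

lemma annot_at_Node:
  assumes "subt t u = Some (Node \<sigma> ts)"
  shows "annot_at t u \<mu> = Node (\<sigma>, \<mu> u) (map (\<lambda>i. annot_at t (u @ [Suc i]) \<mu>) [0..<length ts])"
proof -
  have "subt t (u @ [Suc i]) = Some (ts ! i)" if "i < length ts" for i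
    using assms that by (simp add: subt_append)
  then show ?thesis using assms by (auto simp: annot_at_def)
qed

lemma annot_cong: "(\<And>v. \<mu> v = \<mu>' v) \<Longrightarrow> annot s \<mu> = annot s \<mu>'"
  by (metis ext)

lemma annot_at_cong: "(\<And>v. prefix u v \<Longrightarrow> \<mu> v = \<mu>' v) \<Longrightarrow> annot_at t u \<mu> = annot_at t u \<mu>'"
  unfolding annot_at_def by (rule annot_cong) auto

lemma annot_at_upd:
  assumes "subt t u = Some (Node \<sigma> ts)"
  shows "annot_at t u (\<mu>(u := m')) = Node (\<sigma>, m') (map (\<lambda>i. annot_at t (u @ [Suc i]) \<mu>) [0..<length ts])"
  unfolding annot_at_Node[OF assms] by (auto intro!: annot_at_cong simp: prefix_def)

lemma annot_at_child_upd:
  assumes "subt t u = Some (Node \<sigma> ts)" "1 \<le> i" "i \<le> length ts" "\<And>v. \<not> prefix (u @ [i]) v \<Longrightarrow> \<mu>' v = (\<mu>(u := m')) v"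
  shows "annot_at t u \<mu>' = Node (\<sigma>, m')
    ((map (\<lambda>i. annot_at t (u @ [Suc i]) \<mu>) [0..<length ts])[i - 1 := annot_at t (u @ [i]) \<mu>'])"
proof -
  have "annot_at t (u @ [Suc j]) \<mu>' = annot_at t (u @ [Suc j]) \<mu>" if "Suc j \<noteq> i" for j
  proof (rule annot_at_cong)
    fix v assume "prefix (u @ [Suc j]) v"
    then have "\<not> prefix (u @ [i]) v" "v \<noteq> u" using that by (auto simp: prefix_def)
    then show "\<mu>' v = \<mu> v" using assms(4) by simp
  qed
  moreover have "\<mu>' u = m'" using assms(4)[of u] by (auto simp: prefix_def)
  ultimately show ?thesis using assms(2,3) unfolding annot_at_Node[OF assms(1)]
    by (auto intro!: nth_equalityI simp: nth_list_update)
qed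

lemma finite_nodes: "finite (nodes t)"
proof (induction t)
  case (Node a ts)
  have "nodes (Node a ts) \<subseteq> insert [] (\<Union>s\<in>set ts. \<Union>i\<in>{..length ts}. (#) i ` nodes s)"
  proof
    fix u assume u: "u \<in> nodes (Node a ts)"
    show "u \<in> insert [] (\<Union>s\<in>set ts. \<Union>i\<in>{..length ts}. (#) i ` nodes s)"
    proof (cases u)
      case (Cons i v)
      then have "1 \<le> i" "i \<le> length ts" "v \<in> nodes (ts ! (i - 1))"
        using u by (auto simp: nodes_def split: if_splits)
      then show ?thesis unfolding Cons by (intro insertI2 UN_I[of "ts ! (i - 1)"] UN_I[of i]) auto
    qed simp
  qed
  then show ?case by (rule finite_subset) (use Node in auto)
qed

lemma finite_image_factor:
  assumes "finite (D ` U)" "\<And>x y. x \<in> U \<Longrightarrow> y \<in> U \<Longrightarrow> D x = D y \<Longrightarrow> f x = f y"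
  shows "finite (f ` U)"
proof -
  have "f ` U \<subseteq> (\<lambda>d. f (SOME x. x \<in> U \<and> D x = d)) ` D ` U"
  proof
    fix y assume "y \<in> f ` U"
    then obtain x where x: "x \<in> U" "y = f x" by auto
    have "(SOME z. z \<in> U \<and> D z = D x) \<in> U \<and> D (SOME z. z \<in> U \<and> D z = D x) = D x"
      by (rule someI[of _ x]) (use x in simp)
    then have "f (SOME z. z \<in> U \<and> D z = D x) = y" using assms(2) x by blast
    then show "y \<in> (\<lambda>d. f (SOME x. x \<in> U \<and> D x = d)) ` D ` U" using x by blast
  qed
  then show ?thesis using assms(1) by (meson finite_imageI finite_subset)
qed

text \<open>These properties are all that is used of the visit counter; the instance is
  \<open>counted C H\<close> with \<open>pot = snd\<close>.\<close>

locale potential_machine =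
  fixes Sig :: "'a set" and rkS :: "'a \<Rightarrow> nat" and Gam :: "'g set" and rkG :: "'g \<Rightarrow> nat"
    and H :: "('q, 'm, 'a, 'g) hm" and pot :: "'m \<Rightarrow> nat" and C :: nat
  assumes uthm: "is_uthm Sig rkS Gam rkG H"
    and pot_less: "\<And>q \<sigma> m s. delta H q \<sigma> m = Some s \<Longrightarrow> pot m < C"
    and pot_leaf: "\<And>q \<sigma> m s q' m' d. delta H q \<sigma> m = Some s \<Longrightarrow> (q', m', d) \<in> leaves s \<Longrightarrow> pot m < pot m'"
begin

lemma delta_leaf:
  assumes "delta H q \<sigma> m = Some s" "(q', m', d) \<in> leaves s"
  shows "q' \<in> st H" "m' \<in> mem H" "d = Up \<or> (\<exists>i. d = Down i \<and> 1 \<le> i \<and> i \<le> rkS \<sigma>)"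
proof -
  have "\<forall>(q', m', d) \<in> leaves s. q' \<in> st H \<and> m' \<in> mem H \<and> (d = Up \<or> (\<exists>i. d = Down i \<and> 1 \<le> i \<and> i \<le> rkS \<sigma>))"
    using uthm assms(1) unfolding is_uthm_def by blast
  then show "q' \<in> st H" "m' \<in> mem H" "d = Up \<or> (\<exists>i. d = Down i \<and> 1 \<le> i \<and> i \<le> rkS \<sigma>)"
    using assms(2) by auto
qed

lemma delta_in:
  assumes "delta H q \<sigma> m = Some s"
  shows "q \<in> st H" "\<sigma> \<in> Sig" "m \<in> mem H"
  using uthm assms unfolding is_uthm_def by blast+

text \<open>One branch of the computation inside an annotated subtree, entered at its root in state q:
  it gets stuck (None), or it leaves the subtree through its root, in some state and with some new
  annotation.\<close>

inductive visit :: "('a \<times> 'm) tree \<Rightarrow> 'q \<Rightarrow> ('q \<times> ('a \<times> 'm) tree) option \<Rightarrow> bool" where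
  stuck: "delta H q \<sigma> m = None \<Longrightarrow> visit (Node (\<sigma>, m) ts) q None"
| up: "delta H q \<sigma> m = Some s \<Longrightarrow> (q', m', Up) \<in> leaves s \<Longrightarrow> visit (Node (\<sigma>, m) ts) q (Some (q', Node (\<sigma>, m') ts))"
| down_stuck: "delta H q \<sigma> m = Some s \<Longrightarrow> (q', m', Down i) \<in> leaves s \<Longrightarrow> 1 \<le> i \<Longrightarrow> i \<le> length ts \<Longrightarrow>
    visit (ts ! (i - 1)) q' None \<Longrightarrow> visit (Node (\<sigma>, m) ts) q None"
| down: "delta H q \<sigma> m = Some s \<Longrightarrow> (q', m', Down i) \<in> leaves s \<Longrightarrow> 1 \<le> i \<Longrightarrow> i \<le> length ts \<Longrightarrow>
    visit (ts ! (i - 1)) q' (Some (q'', T)) \<Longrightarrow> visit (Node (\<sigma>, m') (ts[i - 1 := T])) q'' x \<Longrightarrow>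
    visit (Node (\<sigma>, m) ts) q x"

text \<open>The source of finite depth: an exit requires a transition at the root, which raises the
  potential there and is impossible once it has reached \<open>C\<close>.\<close>

lemma visit_exit:
  "visit T q x \<Longrightarrow> x = Some (q', T') \<Longrightarrow> q' \<in> st H \<and> pot (snd (root_lab T)) < pot (snd (root_lab T')) \<and> pot (snd (root_lab T)) < C"
proof (induction arbitrary: q' T' rule: visit.induct)
  case (up q \<sigma> m s q1 m' ts)
  then show ?case using delta_leaf(1)[OF up(1,2)] pot_leaf[OF up(1,2)] pot_less[OF up(1)] by auto
next
  case (down q \<sigma> m s q1 m' i ts q'' T x)
  then show ?case using pot_leaf[OF down(1,2)] pot_less[OF down(1)] by fastforce
qed auto

text \<open>A context can only enter the subtree, see the branch get stuck or exit in some state,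
  and possibly enter the changed subtree again. Trees that agree in this respect forever are
  interchangeable in every context.\<close>

coinductive bisim :: "('a \<times> 'm) tree \<Rightarrow> ('a \<times> 'm) tree \<Rightarrow> bool" where
  "(\<And>q. visit T q None \<longleftrightarrow> visit T' q None) \<Longrightarrow>
   (\<And>q q' T1. visit T q (Some (q', T1)) \<Longrightarrow> \<exists>T1'. visit T' q (Some (q', T1')) \<and> bisim T1 T1') \<Longrightarrow>
   (\<And>q q' T1'. visit T' q (Some (q', T1')) \<Longrightarrow> \<exists>T1. visit T q (Some (q', T1)) \<and> bisim T1 T1') \<Longrightarrow>
   bisim T T'"

section \<open>Bisimilarity is a congruence\<close>

lemma bisimD:
  assumes "bisim T T'"
  shows "visit T q None \<longleftrightarrow> visit T' q None"
    and "visit T q (Some (q', T1)) \<Longrightarrow> \<exists>T1'. visit T' q (Some (q', T1')) \<and> bisim T1 T1'"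
    and "visit T' q (Some (q', T1')) \<Longrightarrow> \<exists>T1. visit T q (Some (q', T1)) \<and> bisim T1 T1'"
  using assms by (auto elim: bisim.cases)

lemma bisim_refl: "bisim T T"
  by (coinduction arbitrary: T) auto

lemma bisim_coinduct_sym:
  assumes "X T T'" and sym: "\<And>T T'. X T T' \<Longrightarrow> X T' T"
    and stk: "\<And>T T' q. X T T' \<Longrightarrow> visit T q None \<Longrightarrow> visit T' q None"
    and ext: "\<And>T T' q q' T1. X T T' \<Longrightarrow> visit T q (Some (q', T1)) \<Longrightarrow> \<exists>T1'. visit T' q (Some (q', T1')) \<and> X T1 T1'"
  shows "bisim T T'"
  using assms(1)
proof (coinduction arbitrary: T T')
  case (bisim T T')
  have a: "visit T q None \<longleftrightarrow> visit T' q None" for q using stk[OF bisim] stk[OF sym[OF bisim]] by blast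
  have b: "\<exists>T1'. visit T' q (Some (q', T1')) \<and> X T1 T1'" if "visit T q (Some (q', T1))" for q q' T1
    using ext[OF bisim that] .
  have c: "\<exists>T1. visit T q (Some (q', T1)) \<and> X T1 T1'" if "visit T' q (Some (q', T1'))" for q q' T1'
    using ext[OF sym[OF bisim] that] sym by blast
  show ?case
    by (rule exI[of _ T], rule exI[of _ T'], intro conjI refl allI impI a, use b in fast, use c in fast)
qed

lemma bisim_sym:
  assumes "bisim T T'"
  shows "bisim T' T"
proof (rule bisim_coinduct_sym[of "\<lambda>T T'. bisim T T' \<or> bisim T' T"])
  show "bisim T' T \<or> bisim T T'" using assms by simp
next
  fix T T' q q' T1 assume X: "bisim T T' \<or> bisim T' T" and v: "visit T q (Some (q', T1))"
  show "\<exists>T1'. visit T' q (Some (q', T1')) \<and> (bisim T1 T1' \<or> bisim T1' T1)"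
    using X
  proof
    assume "bisim T T'" then show ?thesis using bisimD(2)[OF _ v] by blast
  next
    assume "bisim T' T" then show ?thesis using bisimD(3)[OF _ v] by blast
  qed
qed (auto simp: bisimD(1))

lemma bisim_trans:
  assumes "bisim T T'" "bisim T' T''"
  shows "bisim T T''"
proof (rule bisim_coinduct_sym[of "\<lambda>T T''. \<exists>T'. bisim T T' \<and> bisim T' T''"])
  show "\<exists>T'. bisim T T' \<and> bisim T' T''" using assms by blast
next
  fix T T'' assume "\<exists>T'. bisim T T' \<and> bisim T' T''"
  then show "\<exists>T'. bisim T'' T' \<and> bisim T' T" using bisim_sym by blast
next
  fix T T'' q q' T1 assume "\<exists>T'. bisim T T' \<and> bisim T' T''" and v: "visit T q (Some (q', T1))"
  then obtain T' where "bisim T T'" "bisim T' T''" by blast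
  then show "\<exists>T1''. visit T'' q (Some (q', T1'')) \<and> (\<exists>T'. bisim T1 T' \<and> bisim T' T1'')"
    using bisimD(2)[OF _ v] bisimD(2) by meson
qed (auto simp: bisimD(1))

text \<open>The computation sees the children only through their own visits, so it can be replayed
  over bisimilar children. After an exit the children are again pairwise bisimilar, which is what
  the coinduction in \<open>bisim_Node\<close> needs.\<close>

lemma visit_cong:
  "visit T q x \<Longrightarrow> T = Node a ts \<Longrightarrow> list_all2 bisim ts ts' \<Longrightarrow>
    (case x of None \<Rightarrow> visit (Node a ts') q None
     | Some (q', T1) \<Rightarrow> \<exists>b us us'. T1 = Node b us \<and> visit (Node a ts') q (Some (q', Node b us')) \<and> list_all2 bisim us us')"
proof (induction arbitrary: a ts ts' rule: visit.induct)
  case (stuck q \<sigma> m ts)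
  then show ?case by (auto intro: visit.stuck)
next
  case (up q \<sigma> m s q' m' ts)
  then show ?case by (auto intro: visit.up)
next
  case (down_stuck q \<sigma> m s q' m' i us)
  have "visit (ts' ! (i - 1)) q' None"
    using down_stuck bisimD(1)[OF list_all2_nthD[OF down_stuck.prems(2), of "i - 1"]] by auto
  then show ?case using down_stuck list_all2_lengthD[OF down_stuck.prems(2)]
    by (auto intro: visit.down_stuck)
next
  case (down q \<sigma> m s q' m' i us q'' T x)
  have [simp]: "a = (\<sigma>, m)" "us = ts" using down by auto
  have bs: "bisim (ts ! (i - 1)) (ts' ! (i - 1))"
    using down list_all2_nthD[OF down.prems(2), of "i - 1"] by auto
  obtain T' where T': "visit (ts' ! (i - 1)) q' (Some (q'', T'))" "bisim T T'"
    using bisimD(2)[OF bs, of q' q'' T] down(5) by auto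
  have l: "list_all2 bisim (ts[i - 1 := T]) (ts'[i - 1 := T'])"
    using down.prems(2) T'(2) by (rule list_all2_update_cong)
  have d: "\<And>x. visit (Node (\<sigma>, m') (ts'[i - 1 := T'])) q'' x \<Longrightarrow> visit (Node (\<sigma>, m) ts') q x"
    using down(1-4) T'(1) list_all2_lengthD[OF down.prems(2)] by (auto intro: visit.down)
  show ?case using down.IH(2)[OF _ l, of "(\<sigma>, m')"] d by (fastforce split: option.splits)
qed

lemma bisim_Node:
  assumes "list_all2 bisim ts ts'"
  shows "bisim (Node a ts) (Node a ts')"
proof -
  let ?X = "\<lambda>T T'. \<exists>a ts ts'. T = Node a ts \<and> T' = Node a ts' \<and> list_all2 bisim ts ts'"
  have sym: "?X T' T" if X: "?X T T'" for T T'
  proof -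
    obtain a ts ts' where *: "T = Node a ts" "T' = Node a ts'" "list_all2 bisim ts ts'" using X by blast
    then have "list_all2 bisim ts' ts" by (auto simp: list_all2_conv_all_nth intro: bisim_sym)
    then show ?thesis using *(1,2) by blast
  qed
  have stk: "visit T' q None" if "?X T T'" "visit T q None" for T T' q
    using visit_cong[OF that(2)] that(1) by fastforce
  have ext: "\<exists>T1'. visit T' q (Some (q', T1')) \<and> ?X T1 T1'" if "?X T T'" "visit T q (Some (q', T1))" for T T' q q' T1
    using visit_cong[OF that(2)] that(1) by fastforce
  show ?thesis by (rule bisim_coinduct_sym[of ?X, OF _ sym stk ext]) (use assms in auto)
qed

section \<open>Bisimilarity has finite index\<close>

definition bclass :: "('a \<times> 'm) tree \<Rightarrow> ('a \<times> 'm) tree set" where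
  "bclass T = {T'. bisim T T'}"

lemma bclass_eq: "bclass T = bclass T' \<longleftrightarrow> bisim T T'"
  unfolding bclass_def using bisim_refl bisim_sym bisim_trans by blast

text \<open>Induction on the potential that the root may still gain. With none left there are no
  exits; otherwise exits lead to trees with less to gain, which fall into finitely many classes by
  induction.\<close>

lemma finite_bclass: "finite (bclass ` {T. C \<le> pot (snd (root_lab T)) + k})"
proof (induction k)
  \<comment> \<open>One unfolding of bisimilarity: the outcomes for each state, with exit trees
    replaced by their classes. Restricting to \<open>st H\<close> loses nothing, as any other state
    is stuck at once.\<close>
  let ?D = "\<lambda>T. {(q, x). q \<in> st H \<and> (\<exists>y. visit T q y \<and> x = map_option (map_prod id bclass) y)}"
  have outside: "visit T q y \<longleftrightarrow> y = None" if "q \<notin> st H" for T q y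
  proof -
    have "delta H q \<sigma> m = None" for \<sigma> m using delta_in(1) that by fastforce
    then show ?thesis by (cases T) (force intro: visit.stuck elim: visit.cases)
  qed
  have D: "bclass T = bclass T'" if "?D T = ?D T'" for T T'
  proof -
    have half: "(visit T q None \<longrightarrow> visit T' q None) \<and>
        (\<forall>q' T1. visit T q (Some (q', T1)) \<longrightarrow> (\<exists>T1'. visit T' q (Some (q', T1')) \<and> bclass T1 = bclass T1'))"
      if sub: "?D T \<subseteq> ?D T'" for T T' q
    proof (cases "q \<in> st H")
      case False
      then show ?thesis using outside by simp
    next
      case True
      have "\<exists>y'. visit T' q y' \<and> map_option (map_prod id bclass) y' = map_option (map_prod id bclass) y"
        if "visit T q y" for y
      proof -
        have "(q, map_option (map_prod id bclass) y) \<in> ?D T" using that True by auto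
        then have "(q, map_option (map_prod id bclass) y) \<in> ?D T'" by (rule subsetD[OF sub])
        then show ?thesis by auto
      qed
      from this[of None] this[of "Some (_, _)"] show ?thesis by fastforce
    qed
    note h1 = half[OF equalityD1[OF that], unfolded bclass_eq]
    note h2 = half[OF equalityD2[OF that], unfolded bclass_eq]
    have "bisim T T'"
      by (rule bisim.intros) (use h1 h2 bisim_sym in blast)+
    then show ?thesis by (simp add: bclass_eq)
  qed
  have fin: "finite (st H)" using uthm by (simp add: is_uthm_def)
  {
    case 0
    have "?D ` {T. C \<le> pot (snd (root_lab T)) + 0} \<subseteq> Pow (st H \<times> {None})"
    proof clarsimp
      fix T :: "('a \<times> 'm) tree" and q y assume "C \<le> pot (snd (root_lab T))" "visit T q y"
      then show "y = None" using visit_exit[of T q y] by (cases y) fastforce+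
    qed
    then have "finite (?D ` {T. C \<le> pot (snd (root_lab T)) + 0})"
      by (rule finite_subset) (use fin in simp)
    then show ?case by (rule finite_image_factor) (use D in blast)
  next
    case (Suc k)
    let ?U = "bclass ` {T. C \<le> pot (snd (root_lab T)) + k}"
    have "?D ` {T. C \<le> pot (snd (root_lab T)) + Suc k} \<subseteq> Pow (st H \<times> insert None (Some ` (st H \<times> ?U)))"
    proof clarsimp
      fix T :: "('a \<times> 'm) tree" and q y
      assume T: "C \<le> Suc (pot (snd (root_lab T)) + k)" and y: "visit T q y" "map_option (map_prod id bclass) y \<notin> Some ` (st H \<times> ?U)"
      show "y = None"
      proof (cases y)
        case (Some z)
        obtain q' T' where z: "z = (q', T')" by (cases z)
        have "q' \<in> st H" "pot (snd (root_lab T)) < pot (snd (root_lab T'))"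
          using visit_exit[OF y(1), of q' T'] Some z by auto
        then have "(q', bclass T') \<in> st H \<times> ?U" using T by auto
        then show ?thesis using y(2) Some z by auto
      qed simp
    qed
    then have "finite (?D ` {T. C \<le> pot (snd (root_lab T)) + Suc k})"
      by (rule finite_subset) (use fin Suc in simp)
    then show ?case by (rule finite_image_factor) (use D in blast)
  }
qed

lemma finite_range_bclass: "finite (range bclass)"
  using finite_bclass[of C] by (rule finite_subset[rotated]) auto

text \<open>A halting computation has no stuck branch and no move above the root. So a visit can
  only end by returning to the parent, in a configuration that halts as a part of the same
  computation; at the root no outcome remains.\<close>

lemma visit_halts:
  "visit T q x \<Longrightarrow> u \<in> nodes t \<Longrightarrow> T = annot_at t u \<mu> \<Longrightarrow> halts (step H t) (u, q, \<mu>) \<Longrightarrow>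
    \<exists>q' \<mu>'. x = Some (q', annot_at t u \<mu>') \<and> u \<noteq> [] \<and> (\<forall>v. \<not> prefix u v \<longrightarrow> \<mu>' v = \<mu> v) \<and>
      halts (step H t) (butlast u, q', \<mu>')"
proof (induction arbitrary: u \<mu> rule: visit.induct)
  case (stuck q \<sigma> m ts)
  obtain \<sigma>' us where t: "subt t u = Some (Node \<sigma>' us)"
    using stuck.prems(1) by (auto simp: nodes_def) (metis tree.exhaust)
  have "step H t (u, q, \<mu>) = None"
    using stuck.hyps stuck.prems(2) annot_at_Node[OF t, of \<mu>] t by (simp add: step_def lab_def)
  then show ?case using stuck.prems(3) by (simp add: halts_iff[of _ "(u, q, \<mu>)"])
next
  case (up q \<sigma> m s q' m' ts)
  obtain \<sigma>' us where t: "subt t u = Some (Node \<sigma>' us)"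
    using up.prems(1) by (auto simp: nodes_def) (metis tree.exhaust)
  have T: "\<sigma>' = \<sigma>" "\<mu> u = m" "ts = map (\<lambda>i. annot_at t (u @ [Suc i]) \<mu>) [0..<length us]"
    using up.prems(2) unfolding annot_at_Node[OF t] by auto
  have h: "move t u Up \<noteq> None \<and> halts (step H t) (the (move t u Up), q', \<mu>(u := m'))"
    using up.prems(3) up.hyps t T unfolding halts_iff[of _ "(u, q, \<mu>)"]
    by (force simp: step_def lab_def otree.set_map split: if_splits)
  then have u: "u \<noteq> []" by auto
  have "halts (step H t) (butlast u, q', \<mu>(u := m'))" using h u by simp
  moreover have "\<forall>v. \<not> prefix u v \<longrightarrow> (\<mu>(u := m')) v = \<mu> v" by auto
  moreover have "Node (\<sigma>, m') ts = annot_at t u (\<mu>(u := m'))" using annot_at_upd[OF t, of \<mu> m'] T by simp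
  ultimately show ?case using u by blast
next
  case (down_stuck q \<sigma> m s q' m' i ts)
  obtain \<sigma>' us where t: "subt t u = Some (Node \<sigma>' us)"
    using down_stuck.prems(1) by (auto simp: nodes_def) (metis tree.exhaust)
  have T: "\<sigma>' = \<sigma>" "\<mu> u = m" "ts = map (\<lambda>i. annot_at t (u @ [Suc i]) \<mu>) [0..<length us]"
    using down_stuck.prems(2) unfolding annot_at_Node[OF t] by auto
  have h: "move t u (Down i) \<noteq> None \<and> halts (step H t) (the (move t u (Down i)), q', \<mu>(u := m'))"
    using down_stuck.prems(3) down_stuck.hyps t T unfolding halts_iff[of _ "(u, q, \<mu>)"]
    by (force simp: step_def lab_def otree.set_map split: if_splits)
  have "ts ! (i - 1) = annot_at t (u @ [i]) (\<mu>(u := m'))"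
    using down_stuck.hyps(3,4) T(3) by (auto intro!: annot_at_cong simp: prefix_def)
  from down_stuck.IH[OF _ this] h show ?case by (auto simp: fun_upd_def split: if_splits)
next
  case (down q \<sigma> m s q' m' i ts q'' T x)
  obtain \<sigma>' us where t: "subt t u = Some (Node \<sigma>' us)"
    using down.prems(1) by (auto simp: nodes_def) (metis tree.exhaust)
  have T: "\<sigma>' = \<sigma>" "\<mu> u = m" "ts = map (\<lambda>i. annot_at t (u @ [Suc i]) \<mu>) [0..<length us]"
    using down.prems(2) unfolding annot_at_Node[OF t] by auto
  have h: "move t u (Down i) \<noteq> None \<and> halts (step H t) (the (move t u (Down i)), q', \<mu>(u := m'))"
    using down.prems(3) down.hyps t T unfolding halts_iff[of _ "(u, q, \<mu>)"]
    by (force simp: step_def lab_def otree.set_map split: if_splits)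
  have "ts ! (i - 1) = annot_at t (u @ [i]) (\<mu>(u := m'))"
    using down.hyps(3,4) T(3) by (auto intro!: annot_at_cong simp: prefix_def)
  moreover have "u @ [i] \<in> nodes t" "halts (step H t) (u @ [i], q', \<mu>(u := m'))"
    using h by (auto simp: fun_upd_def split: if_splits)
  ultimately obtain \<mu>' where \<mu>': "T = annot_at t (u @ [i]) \<mu>'"
      "\<forall>v. \<not> prefix (u @ [i]) v \<longrightarrow> \<mu>' v = (\<mu>(u := m')) v" "halts (step H t) (u, q'', \<mu>')"
    using down.IH(1)[of "u @ [i]" "\<mu>(u := m')"] unfolding butlast_snoc by blast
  have "annot_at t u \<mu>' = Node (\<sigma>, m') (ts[i - 1 := T])"
    using annot_at_child_upd[OF t, of i \<mu>' \<mu> m'] down.hyps(3,4) \<mu>'(1,2) T by simp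
  from down.IH(2)[OF down.prems(1) this[symmetric] \<mu>'(3)] obtain q3 \<mu>3 where
    3: "x = Some (q3, annot_at t u \<mu>3)" "u \<noteq> []" "\<forall>v. \<not> prefix u v \<longrightarrow> \<mu>3 v = \<mu>' v" "halts (step H t) (butlast u, q3, \<mu>3)"
    by blast
  moreover have "\<mu>3 v = \<mu> v" if "\<not> prefix u v" for v
  proof -
    have "\<not> prefix (u @ [i]) v" "v \<noteq> u" using that by (auto simp: prefix_def)
    then show ?thesis using 3(3) \<mu>'(2) that by auto
  qed
  ultimately show ?case by blast
qed

text \<open>Every step lowers the sum of the remaining potentials, so failure to halt never comes
  from an endless branch: some branch gets stuck or climbs above the root. The decrease is part of
  the conclusion because, after the return from a child, the induction hypothesis is applied a
  second time, at the node itself.\<close>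

lemma not_halts_visit:
  assumes wf: "wf_tree Sig rkS t"
  shows "u \<in> nodes t \<Longrightarrow> \<not> halts (step H t) (u, q, \<mu>) \<Longrightarrow> visit (annot_at t u \<mu>) q None \<or>
    (\<exists>q' \<mu>'. visit (annot_at t u \<mu>) q (Some (q', annot_at t u \<mu>')) \<and>
       (u \<noteq> [] \<longrightarrow> (\<forall>v. \<not> prefix u v \<longrightarrow> \<mu>' v = \<mu> v) \<and> \<not> halts (step H t) (butlast u, q', \<mu>') \<and>
          (\<Sum>x\<in>nodes t. C - pot (\<mu>' x)) < (\<Sum>x\<in>nodes t. C - pot (\<mu> x))))"
proof (induction "\<Sum>x\<in>nodes t. C - pot (\<mu> x)" arbitrary: u q \<mu> rule: less_induct)
  case less
  let ?M = "\<lambda>\<mu>. \<Sum>x\<in>nodes t. C - pot (\<mu> x)"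
  obtain \<sigma> us where t: "subt t u = Some (Node \<sigma> us)"
    using less.prems(1) by (auto simp: nodes_def) (metis tree.exhaust)
  then have lab: "lab t u = Some \<sigma>" by (simp add: lab_def)
  have len: "length us = rkS \<sigma>" using wf_tree_subt[OF wf t] by simp
  let ?ts = "map (\<lambda>i. annot_at t (u @ [Suc i]) \<mu>) [0..<length us]"
  have T: "annot_at t u \<mu> = Node (\<sigma>, \<mu> u) ?ts" by (rule annot_at_Node[OF t])
  show ?case
  proof (cases "delta H q \<sigma> (\<mu> u)")
    case None
    then show ?thesis unfolding T by (auto intro: visit.stuck)
  next
    case (Some s)
    have M: "?M (\<mu>(u := m')) < ?M \<mu>" if "(q', m', d) \<in> leaves s" for q' m' d
      using pot_leaf[OF Some that] pot_less[OF Some] less.prems(1) finite_nodes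
      by (intro sum_strict_mono_ex1) (auto intro!: bexI[of _ u])
    show ?thesis
    proof (cases "\<exists>(q', m', d) \<in> leaves s. move t u d = None")
      case True
      then obtain q' m' d where l: "(q', m', d) \<in> leaves s" "move t u d = None" by auto
      \<comment> \<open>In a well-formed tree only the parent of the root can be missing; this
        failure shows up as an exit through the root.\<close>
      then have "d = Up" "u = []" using delta_leaf(3)[OF Some l(1)] wf_tree_move_Down[OF wf lab]
        by (force split: if_splits)+
      then show ?thesis using visit.up[OF Some, of q' m' ?ts] l annot_at_upd[OF t, of \<mu> m'] T by metis
    next
      case False
      then obtain q' m' d where l: "(q', m', d) \<in> leaves s" "\<not> halts (step H t) (the (move t u d), q', \<mu>(u := m'))"
        using less.prems(2) lab Some unfolding halts_iff[of _ "(u, q, \<mu>)"]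
        by (auto simp: step_def otree.set_map split: if_splits)
      show ?thesis
      proof (cases d)
        case Up
        then have "visit (annot_at t u \<mu>) q (Some (q', annot_at t u (\<mu>(u := m'))))"
          using visit.up[OF Some, of q' m' ?ts] l annot_at_upd[OF t, of \<mu> m'] T by simp
        moreover have "\<not> halts (step H t) (butlast u, q', \<mu>(u := m'))" if "u \<noteq> []"
          using l(2) Up that by simp
        ultimately show ?thesis using M[OF l(1)] by (auto intro!: exI[of _ q'] exI[of _ "\<mu>(u := m')"])
      next
        case (Down i)
        then have i: "1 \<le> i" "i \<le> rkS \<sigma>" using delta_leaf(3)[OF Some l(1)] by auto
        have mv: "move t u d = Some (u @ [i])" "u @ [i] \<in> nodes t"
          using wf_tree_move_Down[OF wf lab i] Down by (auto split: if_splits)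
        have ch: "?ts ! (i - 1) = annot_at t (u @ [i]) (\<mu>(u := m'))" using i len
          by (auto intro!: annot_at_cong simp: prefix_def)
        have nh: "\<not> halts (step H t) (u @ [i], q', \<mu>(u := m'))" using l(2) mv by simp
        have l': "(q', m', Down i) \<in> leaves s" using l(1) Down by simp
        have i': "1 \<le> i" "i \<le> length ?ts" using i len by auto
        from less.hyps[OF M[OF l(1)] mv(2) nh] show ?thesis
        proof
          assume "visit (annot_at t (u @ [i]) (\<mu>(u := m'))) q' None"
          then have "visit (annot_at t u \<mu>) q None" unfolding T
            using visit.down_stuck[OF Some l' i'] ch by simp
          then show ?thesis ..
        next
          assume "\<exists>q'' \<mu>'. visit (annot_at t (u @ [i]) (\<mu>(u := m'))) q' (Some (q'', annot_at t (u @ [i]) \<mu>')) \<and>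
            (u @ [i] \<noteq> [] \<longrightarrow> (\<forall>v. \<not> prefix (u @ [i]) v \<longrightarrow> \<mu>' v = (\<mu>(u := m')) v) \<and>
              \<not> halts (step H t) (butlast (u @ [i]), q'', \<mu>') \<and> ?M \<mu>' < ?M (\<mu>(u := m')))"
          then obtain q'' \<mu>' where v: "visit (annot_at t (u @ [i]) (\<mu>(u := m'))) q' (Some (q'', annot_at t (u @ [i]) \<mu>'))"
            and \<mu>': "\<forall>v. \<not> prefix (u @ [i]) v \<longrightarrow> \<mu>' v = (\<mu>(u := m')) v" and nh': "\<not> halts (step H t) (u, q'', \<mu>')"
            and M': "?M \<mu>' < ?M (\<mu>(u := m'))" by auto
          have T': "annot_at t u \<mu>' = Node (\<sigma>, m') (?ts[i - 1 := annot_at t (u @ [i]) \<mu>'])"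
            using annot_at_child_upd[OF t, of i \<mu>' \<mu> m'] i len \<mu>' by simp
          have dn: "visit (annot_at t u \<mu>) q x" if "visit (annot_at t u \<mu>') q'' x" for x
            unfolding T using visit.down[OF Some l' i' _ that[unfolded T']] v ch by simp
          have out: "\<mu>' v = \<mu> v" if "\<not> prefix u v" for v
          proof -
            have "\<not> prefix (u @ [i]) v" "v \<noteq> u" using that by (auto simp: prefix_def)
            then show ?thesis using \<mu>' by auto
          qed
          show ?thesis using less.hyps[OF _ less.prems(1) nh'] M' M[OF l(1)] dn out
            by (smt (verit, best) order.strict_trans)
        qed
      qed
    qed
  qed
qed

text \<open>A deterministic bottom-up tree automaton in disguise: \<open>range ty\<close> are its
  states, \<open>F\<close> its transition function, \<open>Acc\<close> its accepting states.
  \<open>F\<close> works on representatives of classes, and \<open>bisim_Node\<close> makes the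
  choice irrelevant.\<close>

theorem domain_recognizable:
  obtains ty :: "'a tree \<Rightarrow> nat" and F Acc where "finite (range ty)" "\<And>\<sigma> ts. ty (Node \<sigma> ts) = F \<sigma> (map ty ts)"
    "\<And>t. wf_tree Sig rkS t \<Longrightarrow> ty t \<in> Acc \<longleftrightarrow> halts (step H t) (init_conf H)"
proof -
  obtain g :: "('a \<times> 'm) tree set \<Rightarrow> nat" where g: "inj_on g (range bclass)"
    using finite_imp_inj_to_nat_seg[OF finite_range_bclass] by blast
  define num where "num T = g (bclass T)" for T
  have num: "num T = num T' \<longleftrightarrow> bisim T T'" for T T'
    unfolding num_def bclass_eq[symmetric] using g by (auto dest: inj_onD)
  define ty where "ty t = num (annot t (\<lambda>_. topm H))" for t
  define pick where "pick n = (SOME T. num T = n)" for n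
  have pick: "num (pick (num T)) = num T" for T
    unfolding pick_def by (rule someI[of _ T]) simp
  define F where "F \<sigma> ns = num (Node (\<sigma>, topm H) (map pick ns))" for \<sigma> ns
  \<comment> \<open>At the root both kinds of outcome are failures, getting stuck as well as moving
    above the root; acceptance means that there is no outcome.\<close>
  define Acc where "Acc = {num T | T. \<nexists>x. visit T (qinit H) x}"
  show ?thesis
  proof
    have "range ty \<subseteq> g ` range bclass" by (auto simp: ty_def num_def)
    then show "finite (range ty)" using finite_range_bclass by (meson finite_imageI finite_subset)
    show "ty (Node \<sigma> ts) = F \<sigma> (map ty ts)" for \<sigma> ts
      unfolding ty_def F_def num annot.simps
      by (rule bisim_Node) (auto simp: list_all2_conv_all_nth num[symmetric] pick)
    show "ty t \<in> Acc \<longleftrightarrow> halts (step H t) (init_conf H)" if wf: "wf_tree Sig rkS t" for t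
    proof -
      let ?T = "annot_at t [] (\<lambda>_. topm H)"
      have T: "annot t (\<lambda>_. topm H) = ?T" by (simp add: annot_at_def)
      have "ty t \<in> Acc \<longleftrightarrow> (\<exists>T. bisim ?T T \<and> (\<nexists>x. visit T (qinit H) x))"
        unfolding ty_def Acc_def T by (auto simp: num)
      also have "\<dots> \<longleftrightarrow> (\<nexists>x. visit ?T (qinit H) x)"
      proof
        assume "\<exists>T. bisim ?T T \<and> (\<nexists>x. visit T (qinit H) x)"
        then obtain T where "bisim ?T T" "\<nexists>x. visit T (qinit H) x" by blast
        then show "\<nexists>x. visit ?T (qinit H) x"
          using bisimD(1,2)[of ?T T "qinit H"] by (metis option.exhaust surj_pair)
      qed (use bisim_refl in blast)
      also have "\<dots> \<longleftrightarrow> halts (step H t) (init_conf H)"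
        using visit_halts[of ?T "qinit H" _ "[]" t "\<lambda>_. topm H"] not_halts_visit[OF wf, of "[]" "qinit H" "\<lambda>_. topm H"]
        by (auto simp: init_conf_def nodes_def)
      finally show ?thesis .
    qed
  qed
qed

end

section \<open>Restricting a machine to a recognizable domain\<close>

locale guarded_xmachine = xmachine Sig rkS Xi rkX Q M pot \<delta> q0 m0
  for Sig :: "'a set" and rkS and Xi :: "'g set" and rkX and Q :: "'q set" and M :: "'m set" and pot
    and \<delta> :: "('q, 'm, 'a, 'g) xdelta" and q0 m0 +
  fixes ty :: "'a tree \<Rightarrow> nat" and F :: "'a \<Rightarrow> nat list \<Rightarrow> nat" and Acc :: "nat set"
  assumes finite_ty: "finite (range ty)"
    and ty_Node: "\<And>\<sigma> ts. ty (Node \<sigma> ts) = F \<sigma> (map ty ts)"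
begin

primrec strip :: "nat list + 'm \<Rightarrow> 'm" where
  "strip (Inl l) = m0"
| "strip (Inr m) = m"

text \<open>Depth-first evaluation of ty: a node collects a dummy 0 for the message that first enters it
  and then the types of its children, one per return; at the root the original machine is started if
  the type is accepting. The memory left behind counts as m0.\<close>

fun gdelta :: "(nat + 'q, nat list + 'm, 'a, 'g) xdelta" where
  "gdelta (Inl n) \<sigma> c (Inl l) =
    (let l' = l @ [n]; f = F \<sigma> (tl l') in
     if length l < rkS \<sigma> then Some (Leaf (Inl 0, Inl l', Some (Down (length l'))))
     else if length l = rkS \<sigma> \<and> f \<in> range ty then
       (if c = 0 then (if f \<in> Acc then Some (Leaf (Inr q0, Inr m0, None)) else None)
        else Some (Leaf (Inl f, Inl l', Some Up)))
     else None)"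
| "gdelta (Inl n) \<sigma> c (Inr m) = None"
| "gdelta (Inr q) \<sigma> c mm = map_option (map_otree id (\<lambda>(q', m', d). (Inr q', Inr m', d))) (\<delta> q \<sigma> c (strip mm))"

definition gQ :: "(nat + 'q) set" where
  "gQ = Inl ` insert 0 (range ty) \<union> Inr ` Q"

definition gM :: "(nat list + 'm) set" where
  "gM = Inl ` {l. set l \<subseteq> insert 0 (range ty) \<and> length l \<le> Suc maxrk} \<union> Inr ` M"

text \<open>Each departure of the traversal lengthens the list by one, up to
  \<open>Suc maxrk\<close> entries (the dummy and one type per child). The shift by
  \<open>Suc maxrk\<close> lets the original machine start above all of this.\<close>

definition gpot :: "nat list + 'm \<Rightarrow> nat" where
  "gpot mm = (case mm of Inl l \<Rightarrow> length l | Inr m \<Rightarrow> Suc maxrk + pot m)"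

lemma gdelta_closed: "xclosed Sig rkS Xi rkX gQ gM gpot gdelta"
  unfolding xclosed_def
proof (intro ballI allI impI)
  fix q \<sigma> c m s assume q: "q \<in> gQ" and \<sigma>: "\<sigma> \<in> Sig" and m: "m \<in> gM" and s: "gdelta q \<sigma> c m = Some s"
  have rk: "rkS \<sigma> \<le> maxrk" using rk_le_maxrk[OF \<sigma>] .
  show "wf_otree Xi rkX s \<and> (\<forall>l\<in>leaves s. leaf_ok rkS gQ gM gpot \<sigma> m l)"
  proof (cases q)
    case (Inl n)
    then obtain l where l: "m = Inl l" using s by (cases m) auto
    have "set l \<subseteq> insert 0 (range ty)" "n \<in> insert 0 (range ty)" "length l \<le> Suc maxrk"
      using q m Inl l by (auto simp: gQ_def gM_def)
    then show ?thesis using s rk init unfolding Inl l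
      by (auto simp: Let_def leaf_ok_def gQ_def gM_def gpot_def split: if_splits)
  next
    case (Inr p)
    have p: "p \<in> Q" using q Inr by (auto simp: gQ_def)
    have sm: "strip m \<in> M" "gpot m \<le> Suc maxrk + pot (strip m)" using m init by (auto simp: gM_def gpot_def)
    obtain s0 where s0: "\<delta> p \<sigma> c (strip m) = Some s0" "s = map_otree id (\<lambda>(q', m', d). (Inr q', Inr m', d)) s0"
      using s Inr by auto
    have "wf_otree Xi rkX s0" "\<And>l. l \<in> leaves s0 \<Longrightarrow> leaf_ok rkS Q M pot \<sigma> (strip m) l"
      using closed p \<sigma> sm(1) s0(1) unfolding xclosed_def by auto
    then show ?thesis using sm(2)
      by (fastforce simp: s0(2) wf_otree_map otree.set_map leaf_ok_def gQ_def gM_def gpot_def split: option.splits)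
  qed
qed

lemma finite_gQ: "finite gQ"
  unfolding gQ_def using finite_ty fin(3) by simp

lemma finite_gM: "finite gM"
  unfolding gM_def using finite_lists_length_le[of "insert 0 (range ty)" "Suc maxrk"] finite_ty fin(4) by auto

text \<open>The loop over the children. Their traversal is a hypothesis, so that the loop serves
  inner nodes in \<open>dfs_subtree\<close> as well as the root in \<open>gdelta_out\<close>, where
  it ends differently. The last message \<open>n\<close> has been received but not yet appended to
  \<open>l\<close>.\<close>

lemma dfs_children:
  assumes wf: "wf_tree Sig rkS t" and t: "subt t u = Some (Node \<sigma> ts)"
    and top: "\<And>v. prefix u v \<Longrightarrow> \<mu> v = Inl []"
    and child: "\<And>i \<mu>. i < length ts \<Longrightarrow> (\<And>v. prefix (u @ [Suc i]) v \<Longrightarrow> \<mu> v = Inl []) \<Longrightarrow>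
      \<exists>\<mu>'. (\<forall>v. \<not> prefix (u @ [Suc i]) v \<longrightarrow> \<mu>' v = \<mu> v) \<and> (\<forall>v. prefix (u @ [Suc i]) v \<longrightarrow> (\<exists>l. \<mu>' v = Inl l)) \<and>
        silent (xstep gdelta t) (u @ [Suc i], Inl 0, \<mu>) (u, Inl (ty (ts ! i)), \<mu>')"
  shows "k \<le> length ts \<Longrightarrow> \<exists>\<mu>' l n. silent (xstep gdelta t) (u, Inl 0, \<mu>) (u, Inl n, \<mu>') \<and> \<mu>' u = Inl l \<and>
      l @ [n] = 0 # map ty (take k ts) \<and> (\<forall>v. \<not> prefix u v \<longrightarrow> \<mu>' v = \<mu> v) \<and>
      (\<forall>v. prefix u v \<longrightarrow> (\<exists>l. \<mu>' v = Inl l)) \<and> (\<forall>i v. k \<le> i \<longrightarrow> prefix (u @ [Suc i]) v \<longrightarrow> \<mu>' v = Inl [])"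
proof (induction k)
  case 0
  have "prefix u v" if "prefix (u @ [Suc i]) v" for i v using that by (auto simp: prefix_def)
  then show ?case using top by (intro exI[of _ \<mu>] exI[of _ "[]"] exI[of _ 0]) auto
next
  case (Suc k)
  have len: "length ts = rkS \<sigma>" using wf_tree_subt[OF wf t] by simp
  have lab: "lab t u = Some \<sigma>" using t by (simp add: lab_def)
  from Suc obtain \<mu>1 l n where 1: "silent (xstep gdelta t) (u, Inl 0, \<mu>) (u, Inl n, \<mu>1)" "\<mu>1 u = Inl l"
      "l @ [n] = 0 # map ty (take k ts)" "\<forall>v. \<not> prefix u v \<longrightarrow> \<mu>1 v = \<mu> v"
      "\<forall>v. prefix u v \<longrightarrow> (\<exists>l. \<mu>1 v = Inl l)" "\<forall>i v. k \<le> i \<longrightarrow> prefix (u @ [Suc i]) v \<longrightarrow> \<mu>1 v = Inl []"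
    by auto
  have ll: "length l = k" using arg_cong[OF 1(3), of length] Suc.prems by simp
  let ?\<mu> = "\<mu>1(u := Inl (l @ [n]))"
  have mv: "move t u (Down (Suc k)) = Some (u @ [Suc k])"
    using wf_tree_move_Down[OF wf lab, of "Suc k"] Suc.prems len by simp
  have st: "xstep gdelta t (u, Inl n, \<mu>1) = Some (Leaf (u @ [Suc k], Inl 0, ?\<mu>))"
    using lab 1(2) ll Suc.prems len mv by (simp add: xstep_def Let_def)
  have "k < length ts" using Suc.prems by simp
  moreover have "?\<mu> v = Inl []" if "prefix (u @ [Suc k]) v" for v
    using that 1(6) by (auto simp: prefix_def)
  ultimately obtain \<mu>2 where 2: "\<forall>v. \<not> prefix (u @ [Suc k]) v \<longrightarrow> \<mu>2 v = ?\<mu> v"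
      "\<forall>v. prefix (u @ [Suc k]) v \<longrightarrow> (\<exists>l. \<mu>2 v = Inl l)"
      "silent (xstep gdelta t) (u @ [Suc k], Inl 0, ?\<mu>) (u, Inl (ty (ts ! k)), \<mu>2)"
    using child[of k ?\<mu>] by blast
  have "silent (xstep gdelta t) (u, Inl 0, \<mu>) (u, Inl (ty (ts ! k)), \<mu>2)"
    using 1(1) silent_step[OF st 2(3)] by (rule silent_trans)
  moreover have "\<mu>2 u = Inl (l @ [n])" using 2(1) by (simp add: prefix_def)
  moreover have "(l @ [n]) @ [ty (ts ! k)] = 0 # map ty (take (Suc k) ts)"
    unfolding 1(3) using Suc.prems by (simp add: take_Suc_conv_app_nth)
  moreover have "\<mu>2 v = \<mu> v" if "\<not> prefix u v" for v
  proof -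
    have "\<not> prefix (u @ [Suc k]) v" "v \<noteq> u" using that by (auto simp: prefix_def)
    then show ?thesis using 2(1) 1(4) that by simp
  qed
  moreover have "\<exists>l. \<mu>2 v = Inl l" if "prefix u v" for v
    using 2(1,2) 1(5) that by (cases "prefix (u @ [Suc k]) v") auto
  moreover have "\<mu>2 v = Inl []" if i: "Suc k \<le> i" "prefix (u @ [Suc i]) v" for i v
  proof -
    have "\<not> prefix (u @ [Suc k]) v" "v \<noteq> u" using i by (auto simp: prefix_def)
    moreover have "\<mu>1 v = Inl []" using 1(6) i by (meson Suc_leD)
    ultimately show ?thesis using 2(1) by simp
  qed
  ultimately show ?case by blast
qed

lemma dfs_subtree:
  assumes wf: "wf_tree Sig rkS t"
  shows "subt t u = Some s \<Longrightarrow> u \<noteq> [] \<Longrightarrow> (\<And>v. prefix u v \<Longrightarrow> \<mu> v = Inl []) \<Longrightarrow>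
    \<exists>\<mu>'. (\<forall>v. \<not> prefix u v \<longrightarrow> \<mu>' v = \<mu> v) \<and> (\<forall>v. prefix u v \<longrightarrow> (\<exists>l. \<mu>' v = Inl l)) \<and>
        silent (xstep gdelta t) (u, Inl 0, \<mu>) (butlast u, Inl (ty s), \<mu>')"
proof (induction s arbitrary: u \<mu>)
  case (Node \<sigma> ts)
  have len: "length ts = rkS \<sigma>" using wf_tree_subt[OF wf Node.prems(1)] by simp
  have lab: "lab t u = Some \<sigma>" using Node.prems(1) by (simp add: lab_def)
  have "\<exists>\<mu>'. (\<forall>v. \<not> prefix (u @ [Suc i]) v \<longrightarrow> \<mu>' v = \<mu> v) \<and> (\<forall>v. prefix (u @ [Suc i]) v \<longrightarrow> (\<exists>l. \<mu>' v = Inl l)) \<and>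
        silent (xstep gdelta t) (u @ [Suc i], Inl 0, \<mu>) (u, Inl (ty (ts ! i)), \<mu>')"
    if "i < length ts" "\<And>v. prefix (u @ [Suc i]) v \<Longrightarrow> \<mu> v = Inl []" for i \<mu>
    using Node.IH[of "ts ! i" "u @ [Suc i]" \<mu>] that Node.prems(1) by (simp add: subt_append)
  from dfs_children[where \<mu> = \<mu>, OF wf Node.prems(1,3) this order_refl] obtain \<mu>1 l n where
    1: "silent (xstep gdelta t) (u, Inl 0, \<mu>) (u, Inl n, \<mu>1)" "\<mu>1 u = Inl l" "l @ [n] = 0 # map ty ts"
      "\<forall>v. \<not> prefix u v \<longrightarrow> \<mu>1 v = \<mu> v" "\<forall>v. prefix u v \<longrightarrow> (\<exists>l. \<mu>1 v = Inl l)"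
    by auto
  have ll: "length l = rkS \<sigma>" using arg_cong[OF 1(3), of length] len by simp
  have "u \<in> nodes t" using Node.prems(1) by (simp add: nodes_def)
  \<comment> \<open>A positive child index makes the node report its type to the parent instead of
    starting the original machine.\<close>
  then have "child_index u \<noteq> 0" using nodes_snocD[of "butlast u" "last u" t] Node.prems(2)
    by (simp add: child_index_def)
  then have "xstep gdelta t (u, Inl n, \<mu>1) = Some (Leaf (butlast u, Inl (ty (Node \<sigma> ts)), \<mu>1(u := Inl (l @ [n]))))"
    using lab 1(2,3) ll Node.prems(2) by (simp add: xstep_def Let_def ty_Node[symmetric])
  from silent_trans[OF 1(1) silent_step[where T = "xstep gdelta t", OF this silent_refl]]
  show ?case using 1(4,5) by (intro exI[of _ "\<mu>1(u := Inl (l @ [n]))"]) (auto simp: fun_upd_def)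
qed

lemma gdelta_main:
  assumes "\<forall>v. strip (\<mu> v) = m0"
  shows "out (xstep \<delta> t) ([], q0, \<lambda>_. m0) r \<longleftrightarrow> out (xstep gdelta t) ([], Inr q0, \<mu>) r"
proof -
  let ?R = "\<lambda>(u :: nat list, q :: 'q, \<mu>0) (u', q' :: nat + 'q, \<mu> :: nat list \<Rightarrow> nat list + 'm). u = u' \<and> q' = Inr q \<and> \<mu>0 = (\<lambda>v. strip (\<mu> v))"
  have sim: "rel_option (rel_otree (=) ?R) (xstep \<delta> t (u, q, \<lambda>v. strip (\<mu> v))) (xstep gdelta t (u, Inr q, \<mu>))" for u q \<mu>
  proof (cases "lab t u")
    case None
    then show ?thesis by (simp add: xstep_def)
  next
    case (Some \<sigma>)
    show ?thesis
    proof (cases "\<delta> q \<sigma> (child_index u) (strip (\<mu> u))")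
      case None
      then show ?thesis using Some by (simp add: xstep_def)
    next
      case s: (Some s)
      have mv: "(\<forall>l\<in>leaves (map_otree id (\<lambda>(q', m', d). (Inr q' :: nat + 'q, Inr m' :: nat list + 'm, d)) s). case l of (q', m', d) \<Rightarrow> xmove t u d \<noteq> None)
        = (\<forall>(q', m', d)\<in>leaves s. xmove t u d \<noteq> None)"
        by (auto simp: otree.set_map split: prod.splits)
      have "rel_otree (=) ?R (map_otree id (\<lambda>(q', m', d). (the (xmove t u d), q', (\<lambda>v. strip (\<mu> v))(u := m'))) s)
         (map_otree id (\<lambda>(q', m', d). (the (xmove t u d), q', \<mu>(u := m'))) (map_otree id (\<lambda>(q', m', d). (Inr q', Inr m', d)) s))"
        unfolding otree.map_comp id_o by (rule rel_otree_map) auto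
      then show ?thesis using Some s mv by (auto simp: xstep_def)
    qed
  qed
  show ?thesis
  proof (rule simulation_out[of ?R])
    fix c1 c2 assume "?R c1 c2"
    then obtain u q \<mu> where c: "c1 = (u, q, \<lambda>v. strip (\<mu> v))" "c2 = (u, Inr q, \<mu>)" by (cases c1; cases c2) auto
    show "\<exists>d. silent (xstep gdelta t) c2 d \<and> rel_option (rel_otree (=) ?R) (xstep \<delta> t c1) (xstep gdelta t d)"
      unfolding c by (intro exI conjI, rule silent_refl, rule sim)
  qed (use assms in auto)
qed

theorem gdelta_out:
  assumes wf: "wf_tree Sig rkS t"
  shows "out (xstep gdelta t) ([], Inl 0, \<lambda>_. Inl []) r \<longleftrightarrow> ty t \<in> Acc \<and> out (xstep \<delta> t) ([], q0, \<lambda>_. m0) r"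
proof -
  obtain \<sigma> ts where t: "t = Node \<sigma> ts" by (cases t)
  have st: "subt t [] = Some (Node \<sigma> ts)" by (simp add: t)
  have len: "length ts = rkS \<sigma>" using wf by (simp add: t)
  have lab: "lab t [] = Some \<sigma>" by (simp add: t lab_def)
  have "\<exists>\<mu>'. (\<forall>v. \<not> prefix ([] @ [Suc i]) v \<longrightarrow> \<mu>' v = \<mu> v) \<and> (\<forall>v. prefix ([] @ [Suc i]) v \<longrightarrow> (\<exists>l. \<mu>' v = Inl l)) \<and>
        silent (xstep gdelta t) ([] @ [Suc i], Inl 0, \<mu>) ([], Inl (ty (ts ! i)), \<mu>')"
    if "i < length ts" "\<And>v. prefix ([] @ [Suc i]) v \<Longrightarrow> \<mu> v = Inl []" for i \<mu>
    using dfs_subtree[OF wf, of "[Suc i]" "ts ! i" \<mu>] that by (simp add: t)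
  from dfs_children[OF wf st _ this order_refl, of "\<lambda>_. Inl []"] obtain \<mu>1 l n where
    1: "silent (xstep gdelta t) ([], Inl 0, \<lambda>_. Inl []) ([], Inl n, \<mu>1)" "\<mu>1 [] = Inl l" "l @ [n] = 0 # map ty ts"
      "\<forall>v. \<exists>l. \<mu>1 v = Inl l"
    by auto
  have ll: "length l = rkS \<sigma>" using arg_cong[OF 1(3), of length] len by simp
  have step: "xstep gdelta t ([], Inl n, \<mu>1) = (if ty t \<in> Acc then Some (Leaf ([], Inr q0, \<mu>1([] := Inr m0))) else None)"
    using lab 1(2,3) ll by (simp add: xstep_def Let_def ty_Node[symmetric] child_index_def t)
  have strip: "\<forall>v. strip ((\<mu>1([] := Inr m0)) v) = m0" using 1(4) by (metis fun_upd_apply strip.simps)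
  show ?thesis
  proof (cases "ty t \<in> Acc")
    case True
    then show ?thesis using out_silent[OF 1(1)] out_Leaf[of "xstep gdelta t"] step gdelta_main[OF strip]
      by (simp add: fun_upd_def)
  next
    case False
    then have "\<not> out (xstep gdelta t) ([], Inl n, \<mu>1) r" using step by (auto elim: out.cases)
    then show ?thesis using out_silent[OF 1(1)] False by simp
  qed
qed

theorem guarded_machine:
  "\<exists>K :: (nat, nat, 'a, 'g) hm. is_thm Sig rkS Xi rkX K \<and> (\<forall>t r. wf_tree Sig rkS t \<longrightarrow>
     (sem K t = Some r \<longleftrightarrow> ty t \<in> Acc \<and> out (xstep \<delta> t) ([], q0, \<lambda>_. m0) r))"
proof -
  interpret g: xmachine Sig rkS Xi rkX gQ gM gpot gdelta "Inl 0" "Inl []"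
    by unfold_locales (use fin finite_gQ finite_gM gdelta_closed in \<open>auto simp: gQ_def gM_def\<close>)
  show ?thesis using g.machine_thm g.machine_sem gdelta_out by blast
qed

end

section \<open>The computation tree\<close>

lemma move_neq: "move t u d = Some v \<Longrightarrow> v \<noteq> u"
proof (cases d)
  case Up
  assume "move t u d = Some v"
  then have "u \<noteq> []" "v = butlast u" using Up by (auto split: if_splits)
  then show ?thesis by (metis append_butlast_last_id not_Cons_self2 self_append_conv)
qed (auto split: if_splits)

lemma xmove_inj:
  assumes "xmove t u d = Some v" "xmove t u d' = Some v"
  shows "d = d'"
proof -
  have "case d of None \<Rightarrow> v = u | Some Up \<Rightarrow> Suc (length v) = length u | Some (Down i) \<Rightarrow> v = u @ [i]"
    if "xmove t u d = Some v" for d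
    using that by (auto split: option.splits dir.splits if_splits)
  from this[OF assms(1)] this[OF assms(2)] show ?thesis
    by (auto split: option.splits dir.splits)
qed

text \<open>To undo an upward move one must know which child it came from; for this reason
  transitions were given access to the child index.\<close>

lemma move_back:
  "u \<in> nodes t \<Longrightarrow> move t u d = Some v \<Longrightarrow>
     move t v (case d of Up \<Rightarrow> Down (child_index u) | Down _ \<Rightarrow> Up) = Some u"
proof (cases d)
  case Up
  assume "u \<in> nodes t" "move t u d = Some v"
  then have "u \<noteq> []" "v = butlast u" using Up by (auto split: if_splits)
  then show ?thesis using \<open>u \<in> nodes t\<close> Up by (simp add: child_index_def)
qed (auto split: if_splits)

fun subotrees :: "('g, 'y) otree \<Rightarrow> ('g, 'y) otree set" where
  "subotrees (Leaf y) = {Leaf y}"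
| "subotrees (ONode g ss) = insert (ONode g ss) (\<Union>s\<in>set ss. subotrees s)"

lemma finite_subotrees: "finite (subotrees s)"
  by (induction s) auto

lemma subotrees_self: "s \<in> subotrees s"
  by (cases s) auto

lemma subotrees_trans: "s' \<in> subotrees s \<Longrightarrow> s'' \<in> subotrees s' \<Longrightarrow> s'' \<in> subotrees s"
  by (induction s) auto

lemma subotrees_leaves: "s' \<in> subotrees s \<Longrightarrow> leaves s' \<subseteq> leaves s"
  by (induction s) auto

lemma subotrees_child: "ONode g ss \<in> subotrees s \<Longrightarrow> i < length ss \<Longrightarrow> ss ! i \<in> subotrees s"
  by (erule subotrees_trans) (auto intro!: bexI[of _ "ss ! i"] simp: subotrees_self)

text \<open>The computation of H is refined so that a step either outputs one symbol or applies one leaf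
  of a right-hand side; a configuration carries the part of the right-hand side that is still to be
  output. Along the computation tree the edges are numbered 0 for a move of H and from 1 for the
  children of an output symbol, so that erasing the 0s of an address gives the address of the
  corresponding node of the output tree.\<close>

type_synonym ('q, 'm, 'g) hconf = "nat list \<times> ('g, 'q \<times> 'm \<times> dir) otree \<times> (nat list \<Rightarrow> 'm)"

fun hnext :: "('q, 'm, 'a, 'g) hm \<Rightarrow> 'a tree \<Rightarrow> ('q, 'm, 'g) hconf \<Rightarrow> nat \<Rightarrow> ('q, 'm, 'g) hconf option" where
  "hnext H t (u, ONode g ss, \<mu>) j = (if 1 \<le> j \<and> j \<le> length ss then Some (u, ss ! (j - 1), \<mu>) else None)"
| "hnext H t (u, Leaf (q, m, d), \<mu>) j = (if j = 0 then
     Option.bind (move t u d) (\<lambda>v. Option.bind (lab t v) (\<lambda>\<sigma>.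
       map_option (\<lambda>s. (v, s, \<mu>(u := m))) (delta H q \<sigma> ((\<mu>(u := m)) v)))) else None)"

lemma hnextE:
  assumes "hnext H t c j = Some c'"
  obtains (node) u g ss \<mu> where "c = (u, ONode g ss, \<mu>)" "1 \<le> j" "j \<le> length ss" "c' = (u, ss ! (j - 1), \<mu>)"
  | (leaf) u q m d \<mu> v \<sigma> s where "c = (u, Leaf (q, m, d), \<mu>)" "j = 0" "move t u d = Some v" "lab t v = Some \<sigma>"
      "delta H q \<sigma> ((\<mu>(u := m)) v) = Some s" "c' = (v, s, \<mu>(u := m))"
proof -
  obtain u s \<mu> where c: "c = (u, s, \<mu>)" by (metis prod_cases3)
  show ?thesis
  proof (cases s)
    case (Leaf l)
    then show ?thesis using assms leaf c by (cases l) (auto simp: bind_eq_Some_conv split: if_splits)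
  next
    case (ONode g ss)
    then show ?thesis using assms node c by (auto split: if_splits)
  qed
qed

text \<open>Big-step evaluation over the refined configurations. Its derivations are the finite
  computation trees, and \<open>forward\<close> recurses on them to find the next output
  symbol.\<close>

inductive yields :: "('q, 'm, 'a, 'g) hm \<Rightarrow> 'a tree \<Rightarrow> ('q, 'm, 'g) hconf \<Rightarrow> 'g tree \<Rightarrow> bool" for H t where
  node: "length rs = length ss \<Longrightarrow> (\<And>i. i < length ss \<Longrightarrow> yields H t (u, ss ! i, \<mu>) (rs ! i)) \<Longrightarrow>
    yields H t (u, ONode g ss, \<mu>) (Node g rs)"
| leaf: "hnext H t (u, Leaf l, \<mu>) 0 = Some c \<Longrightarrow> yields H t c r \<Longrightarrow> yields H t (u, Leaf l, \<mu>) r"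

lemma out_yields:
  "out (step H t) c r \<Longrightarrow> c = (u, q, \<mu>) \<Longrightarrow> \<exists>\<sigma> s. lab t u = Some \<sigma> \<and> delta H q \<sigma> (\<mu> u) = Some s \<and> yields H t (u, s, \<mu>) r"
proof (induction arbitrary: u q \<mu> rule: out.induct)
  case (1 c s1 f)
  define h where "h = (\<lambda>(q' :: 'a, m' :: 'b, d). (the (move t u d), q', \<mu>(u := m')))"
  obtain \<sigma> s where s: "lab t u = Some \<sigma>" "delta H q \<sigma> (\<mu> u) = Some s"
    "\<forall>(q', m', d) \<in> leaves s. move t u d \<noteq> None" "s1 = map_otree id h s"
    using 1(1,3) by (auto simp: h_def step_def split: option.splits if_splits)
  have "leaves s' \<subseteq> leaves s \<Longrightarrow> yields H t (u, s', \<mu>) (graft (map_otree id h s') f)" for s'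
  proof (induction s')
    case (Leaf l)
    obtain q' m' d where l: "l = (q', m', d)" by (metis prod_cases3)
    have ls: "(q', m', d) \<in> leaves s" using Leaf l by simp
    then obtain v where v: "move t u d = Some v" using s(3) by auto
    have "h (q', m', d) \<in> leaves s1" using ls unfolding s(4) otree.set_map by blast
    then obtain \<sigma>' s' where "lab t v = Some \<sigma>'" "delta H q' \<sigma>' ((\<mu>(u := m')) v) = Some s'"
        "yields H t (v, s', \<mu>(u := m')) (f (v, q', \<mu>(u := m')))"
      using 1(2) v by (fastforce simp: h_def)
    then show ?case unfolding l using v
      by (intro yields.leaf[where c = "(v, s', \<mu>(u := m'))"]) (auto simp: h_def fun_upd_def)
  next
    case (ONode g ss)
    have "yields H t (u, ss ! i, \<mu>) (map (\<lambda>s. graft (map_otree id h s) f) ss ! i)" if "i < length ss" for i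
    proof -
      have "ss ! i \<in> set ss" using that by simp
      moreover have "leaves (ss ! i) \<subseteq> leaves s" using ONode.prems that by force
      ultimately have "yields H t (u, ss ! i, \<mu>) (graft (map_otree id h (ss ! i)) f)" by (rule ONode.IH)
      then show ?thesis using that by simp
    qed
    then show ?case by (auto intro!: yields.node simp: comp_def id_def)
  qed
  then show ?case using s by auto
qed

section \<open>Addresses in the computation tree and in the output tree\<close>

definition hcomp :: "('q, 'm, 'a, 'g) hm \<Rightarrow> 'a tree \<Rightarrow> ('q, 'm, 'g) hconf \<Rightarrow> nat list \<Rightarrow> ('q, 'm, 'g) hconf option" where
  "hcomp H t c \<alpha> = foldl (\<lambda>co j. Option.bind co (\<lambda>c. hnext H t c j)) (Some c) \<alpha>"

definition addr :: "nat list \<Rightarrow> nat list" where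
  "addr \<alpha> = filter (\<lambda>j. j \<noteq> 0) \<alpha>"

lemma addr_simps [simp]:
  "addr [] = []" "addr (\<alpha> @ \<beta>) = addr \<alpha> @ addr \<beta>" "addr (j # \<alpha>) = (if j = 0 then addr \<alpha> else j # addr \<alpha>)"
  by (auto simp: addr_def)

lemma hcomp_Nil [simp]: "hcomp H t c [] = Some c"
  by (simp add: hcomp_def)

lemma hcomp_snoc [simp]: "hcomp H t c (\<alpha> @ [j]) = Option.bind (hcomp H t c \<alpha>) (\<lambda>c'. hnext H t c' j)"
  by (simp add: hcomp_def)

lemma hcomp_append: "hcomp H t c (\<alpha> @ \<beta>) = Option.bind (hcomp H t c \<alpha>) (\<lambda>c'. hcomp H t c' \<beta>)"
proof (induction \<beta> rule: rev_induct)
  case Nil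
  then show ?case by simp
next
  case (snoc j \<beta>)
  have "hcomp H t c (\<alpha> @ \<beta> @ [j]) = Option.bind (hcomp H t c (\<alpha> @ \<beta>)) (\<lambda>c'. hnext H t c' j)"
    using hcomp_snoc[of H t c "\<alpha> @ \<beta>" j] by simp
  then show ?case using snoc by (simp add: bind_assoc)
qed

lemma hcomp_Cons: "hcomp H t c (j # \<beta>) = Option.bind (hnext H t c j) (\<lambda>c'. hcomp H t c' \<beta>)"
  using hcomp_append[of H t c "[j]" \<beta>] hcomp_snoc[of H t c "[]" j] by simp

lemma hcomp_yields:
  assumes "yields H t c0 r"
  shows "hcomp H t c0 \<alpha> = Some c \<Longrightarrow> \<exists>r'. subt r (addr \<alpha>) = Some r' \<and> yields H t c r'"
proof (induction \<alpha> arbitrary: c rule: rev_induct)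
  case Nil
  then show ?case using assms by simp
next
  case (snoc j \<alpha>)
  then obtain c1 where c1: "hcomp H t c0 \<alpha> = Some c1" "hnext H t c1 j = Some c" by (auto simp: bind_eq_Some_conv)
  from snoc.IH[OF c1(1)] obtain r' where r': "subt r (addr \<alpha>) = Some r'" "yields H t c1 r'" by blast
  from r'(2) show ?case
  proof cases
    case (node rs ss u \<mu> g)
    then have "1 \<le> j" "j \<le> length ss" "c = (u, ss ! (j - 1), \<mu>)" using c1(2) by (auto split: if_splits)
    then show ?thesis using node r'(1) by (auto simp: subt_append)
  next
    case (leaf u l \<mu> c')
    then have "j = 0" using c1(2) by (cases l) (auto split: if_splits)
    then show ?thesis using leaf r'(1) c1(2) by simp
  qed
qed

lemma hcomp_output_node:
  assumes "yields H t c0 r" "hcomp H t c0 \<alpha> = Some (u, ONode g ss, \<mu>)"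
  shows "lab r (addr \<alpha>) = Some g" "addr \<alpha> @ [j] \<in> nodes r \<longleftrightarrow> 1 \<le> j \<and> j \<le> length ss"
proof -
  obtain r' where r': "subt r (addr \<alpha>) = Some r'" "yields H t (u, ONode g ss, \<mu>) r'"
    using hcomp_yields[OF assms] by blast
  from r'(2) obtain rs where "r' = Node g rs" "length rs = length ss" by cases auto
  then show "lab r (addr \<alpha>) = Some g" "addr \<alpha> @ [j] \<in> nodes r \<longleftrightarrow> 1 \<le> j \<and> j \<le> length ss"
    using r'(1) by (auto simp: lab_def nodes_def subt_append)
qed

lemma hcomp_addr_nodes: "yields H t c0 r \<Longrightarrow> hcomp H t c0 \<alpha> = Some c \<Longrightarrow> addr \<alpha> \<in> nodes r"
  using hcomp_yields by (fastforce simp: nodes_def)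

text \<open>Where two addresses diverge, one configuration has two different outgoing edges. It must
  be an output node, so both edges are nonzero and the divergence survives the erasure of the
  0s.\<close>

lemma hcomp_prefix:
  assumes "hcomp H t c0 \<alpha> = Some c" "hcomp H t c0 \<beta> = Some c'" "prefix (addr \<alpha>) (addr \<beta>)"
  shows "prefix \<alpha> \<beta> \<or> prefix \<beta> \<alpha>"
proof (rule ccontr)
  assume "\<not> ?thesis"
  then have "parallel \<alpha> \<beta>" by auto
  then obtain \<gamma> i \<alpha>' j \<beta>' where *: "i \<noteq> j" "\<alpha> = \<gamma> @ i # \<alpha>'" "\<beta> = \<gamma> @ j # \<beta>'"
    using parallel_decomp by blast
  obtain c1 where c1: "hcomp H t c0 \<gamma> = Some c1"
    using assms(1) * by (auto simp: hcomp_append bind_eq_Some_conv)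
  then obtain c2 c3 where "hnext H t c1 i = Some c2" "hnext H t c1 j = Some c3"
    using assms(1,2) * by (auto simp: hcomp_append hcomp_Cons bind_eq_Some_conv)
  then have "1 \<le> i \<and> 1 \<le> j" using *(1) by (elim hnextE) auto
  then show False using *(1,2,3) assms(3) by auto
qed

text \<open>Equal images make the two addresses comparable, with only 0s in the difference; but an
  output node has no edge 0.\<close>

lemma hcomp_output_unique:
  assumes "hcomp H t c0 \<alpha> = Some (u, ONode g ss, \<mu>)" "hcomp H t c0 \<beta> = Some (u', ONode g' ss', \<mu>')" "addr \<alpha> = addr \<beta>"
  shows "\<alpha> = \<beta>"
proof -
  have *: "\<gamma> = []" if "hcomp H t c0 (\<alpha> @ \<gamma>) \<noteq> None" "addr \<gamma> = []" "hcomp H t c0 \<alpha> = Some (u, ONode g ss, \<mu>)" for \<alpha> \<gamma> u g ss \<mu>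
    using that by (cases \<gamma>) (auto simp: hcomp_append hcomp_Cons bind_eq_Some_conv split: if_splits)
  have "prefix \<alpha> \<beta> \<or> prefix \<beta> \<alpha>" using hcomp_prefix[OF assms(1,2)] assms(3) by simp
  then show ?thesis
  proof
    assume "prefix \<alpha> \<beta>"
    then show ?thesis using * assms by (fastforce simp: prefix_def)
  next
    assume "prefix \<beta> \<alpha>"
    then show ?thesis using * assms by (fastforce simp: prefix_def)
  qed
qed

section \<open>Potential along the computation tree\<close>

context potential_machine
begin

definition hconf_ok :: "'a tree \<Rightarrow> ('q, 'm, 'g) hconf \<Rightarrow> bool" where
  "hconf_ok t = (\<lambda>(u, s, \<mu>). (\<forall>v. \<mu> v \<in> mem H) \<and>
     (\<exists>\<sigma> q s0. lab t u = Some \<sigma> \<and> delta H q \<sigma> (\<mu> u) = Some s0 \<and> s \<in> subotrees s0))"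

lemma hconf_ok_leaf:
  assumes "hconf_ok t (u, Leaf (q', m', d), \<mu>)"
  shows "q' \<in> st H" "m' \<in> mem H" "pot (\<mu> u) < pot m'" "u \<in> nodes t"
    "\<exists>\<sigma>. lab t u = Some \<sigma> \<and> (d = Up \<or> (\<exists>i. d = Down i \<and> 1 \<le> i \<and> i \<le> rkS \<sigma>))"
proof -
  obtain \<sigma> q s0 where s0: "lab t u = Some \<sigma>" "delta H q \<sigma> (\<mu> u) = Some s0" "Leaf (q', m', d) \<in> subotrees s0"
    using assms by (auto simp: hconf_ok_def)
  have l: "(q', m', d) \<in> leaves s0" using subotrees_leaves[OF s0(3)] by simp
  show "q' \<in> st H" "m' \<in> mem H" "pot (\<mu> u) < pot m'" using delta_leaf[OF s0(2) l] pot_leaf[OF s0(2) l] by auto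
  show "u \<in> nodes t" using s0(1) by (auto simp: lab_def nodes_def)
  show "\<exists>\<sigma>. lab t u = Some \<sigma> \<and> (d = Up \<or> (\<exists>i. d = Down i \<and> 1 \<le> i \<and> i \<le> rkS \<sigma>))"
    using s0(1) delta_leaf(3)[OF s0(2) l] by simp
qed

lemma hnext_ok:
  assumes ok: "hconf_ok t c" and "hnext H t c j = Some c'"
  shows "hconf_ok t c'"
  using assms(2)
proof (cases rule: hnextE)
  case (node u g ss \<mu>)
  obtain \<sigma> q s0 where "lab t u = Some \<sigma>" "delta H q \<sigma> (\<mu> u) = Some s0" "ONode g ss \<in> subotrees s0" "\<forall>v. \<mu> v \<in> mem H"
    using ok node(1) by (auto simp: hconf_ok_def)
  moreover have "ss ! (j - 1) \<in> subotrees s0" using calculation(3) node by (auto intro: subotrees_child)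
  ultimately show ?thesis unfolding hconf_ok_def node(4) prod.case by blast
next
  case (leaf u q m d \<mu> v \<sigma> s)
  have "m \<in> mem H" using ok hconf_ok_leaf(2) unfolding leaf(1) by blast
  moreover have "\<forall>v. \<mu> v \<in> mem H" using ok leaf(1) by (simp add: hconf_ok_def)
  ultimately have "\<forall>x. (\<mu>(u := m)) x \<in> mem H" by simp
  then show ?thesis using leaf(4,5) subotrees_self[of s] unfolding hconf_ok_def leaf(6) prod.case by blast
qed

lemma hcomp_ok: "hconf_ok t c0 \<Longrightarrow> hcomp H t c0 \<alpha> = Some c \<Longrightarrow> hconf_ok t c"
  by (induction \<alpha> arbitrary: c rule: rev_induct) (auto simp: bind_eq_Some_conv intro: hnext_ok)

text \<open>The first move of H away from \<open>u\<close> raises the potential there, and it never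
  falls again. Until then each edge strips an output symbol off the pending tree.\<close>

lemma hcomp_progress:
  assumes "hconf_ok t (u, s, \<mu>)"
  shows "hcomp H t (u, s, \<mu>) \<beta> = Some (v, s', \<mu>') \<Longrightarrow> (\<forall>x. pot (\<mu> x) \<le> pot (\<mu>' x)) \<and>
    (pot (\<mu> u) < pot (\<mu>' u) \<or> v = u \<and> \<mu>' = \<mu> \<and> size s' + length \<beta> \<le> size s)"
proof (induction \<beta> arbitrary: v s' \<mu>' rule: rev_induct)
  case Nil
  then show ?case by simp
next
  case (snoc j \<beta>)
  then obtain c1 where c1: "hcomp H t (u, s, \<mu>) \<beta> = Some c1" "hnext H t c1 j = Some (v, s', \<mu>')"
    by (auto simp: bind_eq_Some_conv)
  have ok: "hconf_ok t c1" using hcomp_ok[OF assms c1(1)] .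
  from c1(2) show ?case
  proof (cases rule: hnextE)
    case (node u1 g ss \<mu>1)
    have "size (ss ! (j - 1)) \<le> size_list size ss" by (rule size_list_estimation'[of "ss ! (j - 1)"]) (use node in auto)
    then show ?thesis using snoc.IH[of u1 "ONode g ss" \<mu>1] c1(1) node by auto
  next
    case (leaf u1 q m d \<mu>1 v1 \<sigma> s1)
    have a: "pot (\<mu>1 u1) < pot m" using ok hconf_ok_leaf(3) leaf(1) by auto
    have b: "\<mu>' = \<mu>1(u1 := m)" using leaf by simp
    have c: "(\<forall>x. pot (\<mu> x) \<le> pot (\<mu>1 x)) \<and> (pot (\<mu> u) < pot (\<mu>1 u) \<or> u1 = u \<and> \<mu>1 = \<mu>)"
      using snoc.IH[of u1 "Leaf (q, m, d)" \<mu>1] c1(1) leaf(1) by auto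
    have cu: "pot (\<mu> u1) \<le> pot (\<mu>1 u1)" using c by blast
    have "pot (\<mu> x) \<le> pot (\<mu>' x)" for x
    proof (cases "x = u1")
      case True
      then show ?thesis using order.strict_implies_order[OF le_less_trans[OF cu a]] unfolding b by simp
    next
      case False
      then show ?thesis using c unfolding b by simp
    qed
    moreover have "pot (\<mu> u) < pot (\<mu>' u)"
    proof (cases "u = u1")
      case True
      then show ?thesis using a cu unfolding b by simp
    next
      case False
      then show ?thesis using c unfolding b by simp
    qed
    ultimately show ?thesis by blast
  qed
qed

definition rhs_parts :: "('g, 'q \<times> 'm \<times> dir) otree set" where
  "rhs_parts = (\<Union>(q, \<sigma>, m)\<in>st H \<times> Sig \<times> mem H. case delta H q \<sigma> m of None \<Rightarrow> {} | Some s \<Rightarrow> subotrees s)"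

lemma finite_rhs_parts: "finite rhs_parts"
  unfolding rhs_parts_def using uthm by (auto simp: is_uthm_def finite_subotrees split: option.splits)

lemma hconf_ok_rhs_parts: "hconf_ok t (u, s, \<mu>) \<Longrightarrow> s \<in> rhs_parts"
proof -
  assume "hconf_ok t (u, s, \<mu>)"
  then obtain \<sigma> q s0 where s0: "delta H q \<sigma> (\<mu> u) = Some s0" "s \<in> subotrees s0"
    by (auto simp: hconf_ok_def)
  then show ?thesis unfolding rhs_parts_def
    by (intro UN_I[of "(q, \<sigma>, \<mu> u)"]) (use delta_in[OF s0(1)] in auto)
qed

end

section \<open>The composed machine\<close>

text \<open>A record at a node y of the input describes a node of the computation tree of H that sits at y
  and has been touched so far: the pending output, the memory of H at y, a pointer to the record of
  the parent (direction, index there, edge number), whether its output address is the root, the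
  memory of N at that output node, and the number of departures from this record.\<close>

datatype ('q, 'm, 'g, 'n) rcd = Rcd (rtree: "('g, 'q \<times> 'm \<times> dir) otree") (rmem: 'm)
  (rpar: "(dir option \<times> nat \<times> nat) option") (rroot: bool) (rn: 'n) (rcnt: nat)

definition set_rn :: "('q, 'm, 'g, 'n) rcd \<Rightarrow> 'n \<Rightarrow> ('q, 'm, 'g, 'n) rcd" where
  "set_rn R n = Rcd (rtree R) (rmem R) (rpar R) (rroot R) n (rcnt R)"

definition bump :: "('q, 'm, 'g, 'n) rcd \<Rightarrow> ('q, 'm, 'g, 'n) rcd" where
  "bump R = Rcd (rtree R) (rmem R) (rpar R) (rroot R) (rn R) (Suc (rcnt R))"

lemma set_rn_sel [simp]: "rtree (set_rn R n) = rtree R" "rmem (set_rn R n) = rmem R" "rpar (set_rn R n) = rpar R"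
  "rroot (set_rn R n) = rroot R" "rn (set_rn R n) = n" "rcnt (set_rn R n) = rcnt R"
  by (simp_all add: set_rn_def)

lemma bump_sel [simp]: "rtree (bump R) = rtree R" "rmem (bump R) = rmem R" "rpar (bump R) = rpar R"
  "rroot (bump R) = rroot R" "rn (bump R) = rn R" "rcnt (bump R) = Suc (rcnt R)"
  by (simp_all add: bump_def)

datatype ('q, 'p) cst = Start | At nat 'p | Inc nat dir 'q 'p bool | Back nat 'p

text \<open>A node of the computation tree is determined by its parent and the edge from it, so the
  parent pointer serves as search key. Finding the old record recovers the memory that N left
  there.\<close>

definition find_or_create :: "dir option \<times> nat \<times> nat \<Rightarrow> ('g, 'q \<times> 'm \<times> dir) otree \<Rightarrow> 'm \<Rightarrow> bool \<Rightarrow> 'n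
    \<Rightarrow> ('q, 'm, 'g, 'n) rcd list \<Rightarrow> nat \<times> ('q, 'm, 'g, 'n) rcd list" where
  "find_or_create key s m rt n rs =
    (if \<exists>k<length rs. rpar (rs ! k) = Some key then (LEAST k. k < length rs \<and> rpar (rs ! k) = Some key, rs)
     else (length rs, rs @ [Rcd s m (Some key) rt n 0]))"

text \<open>A pointer without direction runs along an output edge, hence leads to the output parent
  sought. A pointer with a direction undoes one move of H, and the search continues in state
  \<open>Back\<close>. The case without pointer is a filler for the root of the computation tree,
  from which a correct simulation never goes back.\<close>

definition goback :: "nat \<Rightarrow> 'p \<Rightarrow> 'm \<Rightarrow> ('q, 'm, 'g, 'n) rcd list
    \<Rightarrow> ('q, 'p) cst \<times> ('m \<times> ('q, 'm, 'g, 'n) rcd list) \<times> dir option" where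
  "goback k p m rs = (case rpar (rs ! k) of
     None \<Rightarrow> (Back k p, (m, rs), None)
   | Some (None, k', j) \<Rightarrow> (At k' p, (m, rs), None)
   | Some (Some d, k', j) \<Rightarrow> (Back k' p, (m, rs[k := bump (rs ! k)]), Some d))"

text \<open>The potential for \<open>leaf_ok\<close>: every proper move of \<open>cdelta\<close>
  departs from one record and bumps it.\<close>

definition cpot :: "'m \<times> ('q, 'm, 'g, 'n) rcd list \<Rightarrow> nat" where
  "cpot mm = sum_list (map rcnt (snd mm))"

lemma cpot_bump: "k < length rs \<Longrightarrow> cpot (m, rs) < cpot (m', rs[k := bump (rs ! k)])"
  by (induction rs arbitrary: k) (auto simp: cpot_def nth_Cons' split: nat.splits)

lemma cpot_set_rn: "k < length rs \<Longrightarrow> cpot (m', rs[k := set_rn (rs ! k) n]) = cpot (m, rs)"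
  by (induction rs arbitrary: k) (auto simp: cpot_def nth_Cons' split: nat.splits)

lemma cpot_find_or_create: "find_or_create key s m rt n rs = (k, rs') \<Longrightarrow> cpot (m1, rs') = cpot (m2, rs)"
  by (auto simp: find_or_create_def cpot_def split: if_splits)

lemma child_le_rank:
  "wf_tree Sig rkS t \<Longrightarrow> lab t u = Some \<sigma> \<Longrightarrow> u @ [i] \<in> nodes t \<Longrightarrow> 1 \<le> i \<and> i \<le> rkS \<sigma>"
proof -
  assume wf: "wf_tree Sig rkS t" and l: "lab t u = Some \<sigma>" and n: "u @ [i] \<in> nodes t"
  obtain ts where ts: "subt t u = Some (Node \<sigma> ts)" using l by (rule lab_SomeE)
  have "length ts = rkS \<sigma>" using wf_tree_subt[OF wf ts] by simp
  then show ?thesis using n ts by (auto simp: nodes_def subt_append split: if_splits)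
qed

lemma card_le_fibers:
  assumes "finite (f ` A)" "\<And>b. finite {a \<in> A. f a = b} \<and> card {a \<in> A. f a = b} \<le> n"
  shows "card A \<le> n * card (f ` A)"
proof -
  have "A = (\<Union>b\<in>f ` A. {a \<in> A. f a = b})" by auto
  then have "card A \<le> (\<Sum>b\<in>f ` A. card {a \<in> A. f a = b})" using card_UN_le[OF assms(1)] by metis
  also have "\<dots> \<le> (\<Sum>b\<in>f ` A. n)" by (rule sum_mono) (use assms(2) in auto)
  finally show ?thesis by (simp add: mult.commute)
qed

fun width :: "('g, 'y) otree \<Rightarrow> nat" where
  "width (Leaf y) = 0"
| "width (ONode g ss) = length ss"

locale composition = potential_machine Sig rkS Gam rkG H pot C
  for Sig :: "'a set" and rkS and Gam :: "'g set" and rkG and H :: "('q, 'm, 'a, 'g) hm" and pot and C +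
  fixes Xi :: "'x set" and rkX :: "'x \<Rightarrow> nat" and N :: "('p, 'n, 'g, 'x) hm" and B :: nat
  assumes N_uthm: "is_uthm Gam rkG Xi rkX N"
begin

definition nleaf :: "nat \<Rightarrow> ('g, 'q \<times> 'm \<times> dir) otree list \<Rightarrow> 'm \<Rightarrow> ('q, 'm, 'g, 'n) rcd list \<Rightarrow> 'p \<times> 'n \<times> dir
    \<Rightarrow> ('q, 'p) cst \<times> ('m \<times> ('q, 'm, 'g, 'n) rcd list) \<times> dir option" where
  "nleaf k ss m rs = (\<lambda>(p', n', d). let rs' = rs[k := set_rn (rs ! k) n'] in
     case d of Up \<Rightarrow> goback k p' m rs'
     | Down j \<Rightarrow> (let (k', rs'') = find_or_create (None, k, j) (ss ! (j - 1)) m False (topm N) rs'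
                  in (At k' p', (m, rs''), None)))"

text \<open>In state At, N is about to read the output node of the current record, or the simulation of H
  runs forward towards it; Inc continues a move of H at the new node, and Back undoes moves of H to
  reach the parent in the output tree.\<close>

fun cdelta :: "(('q, 'p) cst, 'm \<times> ('q, 'm, 'g, 'n) rcd list, 'a, 'x) xdelta" where
  "cdelta Start \<sigma> c (m, rs) =
     map_option (\<lambda>s. Leaf (At 0 (qinit N), (m, [Rcd s m None True (topm N) 0]), None)) (delta H (qinit H) \<sigma> m)"
| "cdelta (At k p) \<sigma> c (m, rs) = (if k < length rs then
     (case rtree (rs ! k) of
        Leaf (q', m', d) \<Rightarrow> Some (Leaf (Inc k (case d of Up \<Rightarrow> Down c | Down _ \<Rightarrow> Up) q' p (rroot (rs ! k)),
          (m', rs[k := bump (rs ! k)]), Some d))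
      | ONode g ss \<Rightarrow> (case delta N p g (rn (rs ! k)) of None \<Rightarrow> None
         | Some s \<Rightarrow> if \<forall>(p', n', d)\<in>leaves s. case d of Up \<Rightarrow> \<not> rroot (rs ! k) | Down j \<Rightarrow> 1 \<le> j \<and> j \<le> length ss
             then Some (map_otree id (nleaf k ss m rs) s) else None))
     else None)"
| "cdelta (Inc k e q p rt) \<sigma> c (m, rs) =
     map_option (\<lambda>s. let (k', rs') = find_or_create (Some e, k, 0) s m rt (topm N) rs in Leaf (At k' p, (m, rs'), None))
       (delta H q \<sigma> m)"
| "cdelta (Back k p) \<sigma> c (m, rs) = (if k < length rs then Some (Leaf (goback k p (rmem (rs ! k)) rs)) else None)"

text \<open>At most \<open>B\<close> records at an input node share a given memory of H and a given
  pending output.\<close>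

definition maxrec :: nat where "maxrec = B * card (mem H \<times> rhs_parts)"

definition dirs :: "dir set" where "dirs = insert Up (Down ` (\<Union>\<sigma>\<in>Sig. {..rkS \<sigma>}))"

text \<open>Origin of \<open>2 * B\<close>: a single output node is an antichain, so N visits it at
  most \<open>B\<close> times, and each visit pays for two departures.\<close>

definition recs :: "('q, 'm, 'g, 'n) rcd set" where
  "recs = (\<lambda>(s, m, par, rt, n, c). Rcd s m par rt n c) ` (rhs_parts \<times> mem H \<times>
     insert None (Some ` (insert None (Some ` dirs) \<times> {..<maxrec} \<times> insert 0 (\<Union>s\<in>rhs_parts. {..width s}))) \<times>
     UNIV \<times> mem N \<times> {..2 * B})"

definition cM :: "('m \<times> ('q, 'm, 'g, 'n) rcd list) set" where
  "cM = mem H \<times> {rs. set rs \<subseteq> recs \<and> length rs \<le> maxrec}"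

definition cQ :: "('q, 'p) cst set" where
  "cQ = insert Start ((\<lambda>(k, p). At k p) ` ({..<maxrec} \<times> st N) \<union> (\<lambda>(k, p). Back k p) ` ({..<maxrec} \<times> st N) \<union>
     (\<lambda>(k, e, q, p, rt). Inc k e q p rt) ` ({..<maxrec} \<times> dirs \<times> st H \<times> st N \<times> UNIV))"

text \<open>The cap makes the conditions on an \<open>xmachine\<close> true by construction,
  whatever the input. That it is never hit on inputs in the domain of H follows from the invariant
  below, through \<open>Inv_records\<close> and \<open>Inv_mem\<close>.\<close>

definition capped :: "(('q, 'p) cst, 'm \<times> ('q, 'm, 'g, 'n) rcd list, 'a, 'x) xdelta" where
  "capped q \<sigma> c m = (case cdelta q \<sigma> c m of None \<Rightarrow> None
     | Some s \<Rightarrow> if wf_otree Xi rkX s \<and> (\<forall>l\<in>leaves s. leaf_ok rkS cQ cM cpot \<sigma> m l) then Some s else None)"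

lemma finite_sets: "finite Sig" "finite Xi" "finite (st H)" "finite (mem H)" "finite (st N)" "finite (mem N)"
  using uthm N_uthm by (auto simp: is_uthm_def)

lemma finite_dirs: "finite dirs"
  using finite_sets by (simp add: dirs_def)

lemma finite_recs: "finite recs"
  unfolding recs_def using finite_sets finite_dirs finite_rhs_parts by (intro finite_imageI finite_cartesian_product) auto

lemma finite_cM: "finite cM"
  unfolding cM_def using finite_sets finite_lists_length_le[OF finite_recs] by simp

lemma finite_cQ: "finite cQ"
  unfolding cQ_def using finite_sets finite_dirs by simp

lemma capped_xmachine: "xmachine Sig rkS Xi rkX cQ cM cpot capped Start (topm H, [])"
proof
  show "xclosed Sig rkS Xi rkX cQ cM cpot capped"
    unfolding xclosed_def capped_def by (auto split: option.splits if_splits)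
  show "(topm H, []) \<in> cM" using uthm by (simp add: cM_def is_uthm_def)
qed (use finite_sets finite_cQ finite_cM in \<open>auto simp: cQ_def\<close>)

end

locale composition_run = composition Sig rkS Gam rkG H pot C Xi rkX N B
  for Sig :: "'a set" and rkS and Gam :: "'g set" and rkG and H :: "('q, 'm, 'a, 'g) hm" and pot and C
    and Xi :: "'x set" and rkX and N :: "('p, 'n, 'g, 'x) hm" and B +
  fixes t :: "'a tree" and r :: "'g tree" and \<sigma>0 s0
  assumes wf: "wf_tree Sig rkS t"
    and root: "lab t [] = Some \<sigma>0" "delta H (qinit H) \<sigma>0 (topm H) = Some s0"
    and yields_r: "yields H t ([], s0, \<lambda>_. topm H) r"
    and narrow: "\<And>cs S. is_run N r cs \<Longrightarrow> antichain r S \<Longrightarrow> visits cs S \<le> B"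
begin

abbreviation cp :: "nat list \<Rightarrow> ('q, 'm, 'g) hconf option" where
  "cp \<equiv> hcomp H t ([], s0, \<lambda>_. topm H)"

abbreviation E where "E \<equiv> xstep capped t"

lemma c0_ok: "hconf_ok t ([], s0, \<lambda>_. topm H)"
  using root uthm by (auto simp: hconf_ok_def is_uthm_def intro: subotrees_self)

lemmas cp_ok = hcomp_ok[OF c0_ok]

lemma cp_nodes: "cp \<beta> = Some (x, s, \<mu>) \<Longrightarrow> x \<in> nodes t \<and> (\<exists>\<sigma>. lab t x = Some \<sigma>) \<and> (\<forall>v. \<mu> v \<in> mem H) \<and> s \<in> rhs_parts"
  using cp_ok[of \<beta> "(x, s, \<mu>)"] hconf_ok_rhs_parts[of t x s \<mu>] by (auto simp: hconf_ok_def lab_def nodes_def)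

text \<open>By \<open>hcomp_prefix\<close> one configuration lies below the other in the computation
  tree. By \<open>hcomp_progress\<close> a proper descendant at the same input node differs in the
  memory of H there or has a smaller pending output.\<close>

lemma cp_antichain:
  assumes "cp \<beta> = Some (y, s, \<mu>)" "cp \<beta>' = Some (y, s, \<mu>')" "\<mu>' y = \<mu> y" "prefix (addr \<beta>) (addr \<beta>')"
  shows "\<beta> = \<beta>'"
proof -
  have *: "\<gamma> = []" if c: "cp \<beta> = Some (y, s, \<mu>)" "cp (\<beta> @ \<gamma>) = Some (y, s, \<mu>')" "\<mu>' y = \<mu> y" for \<beta> \<gamma> \<mu> \<mu>'
  proof -
    have "hcomp H t (y, s, \<mu>) \<gamma> = Some (y, s, \<mu>')" using c(1,2) by (simp add: hcomp_append)
    from hcomp_progress[OF cp_ok[OF c(1)] this] show ?thesis using c(3) by simp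
  qed
  have "prefix \<beta> \<beta>' \<or> prefix \<beta>' \<beta>" using hcomp_prefix[OF assms(1,2,4)] .
  then show ?thesis using * assms(1,2,3) by (auto simp: prefix_def)
qed

definition par_ok :: "(nat list \<Rightarrow> nat list list) \<Rightarrow> nat list \<Rightarrow> nat list \<Rightarrow> (dir option \<times> nat \<times> nat) option \<Rightarrow> bool" where
  "par_ok \<nu> y \<beta> par \<longleftrightarrow> (\<beta> = [] \<and> par = None) \<or>
     (\<exists>\<gamma> j y' s' \<mu>' k' d. \<beta> = \<gamma> @ [j] \<and> cp \<gamma> = Some (y', s', \<mu>') \<and> k' < length (\<nu> y') \<and> \<nu> y' ! k' = \<gamma> \<and>
        xmove t y d = Some y' \<and> par = Some (d, k', j))"

text \<open>As \<open>V\<close> is twice a visit count, \<open>2 \<le> V (addr \<beta>)\<close> says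
  that N has been at this address; thus records count against narrowness. The entry
  \<open>rn\<close> is tied to the memory of N only at output nodes, because the moves of H before
  an output symbol share its address.\<close>

definition rec_ok :: "(nat list \<Rightarrow> nat list list) \<Rightarrow> (nat list \<Rightarrow> 'n) \<Rightarrow> (nat list \<Rightarrow> nat) \<Rightarrow> (nat list \<Rightarrow> nat)
    \<Rightarrow> nat list \<Rightarrow> nat list \<Rightarrow> ('q, 'm, 'g, 'n) rcd \<Rightarrow> bool" where
  "rec_ok \<nu> \<mu>N e V y \<beta> R \<longleftrightarrow>
     (\<exists>\<mu>. cp \<beta> = Some (y, rtree R, \<mu>) \<and> rmem R = \<mu> y) \<and>
     (\<forall>g ss. rtree R = ONode g ss \<longrightarrow> rn R = \<mu>N (addr \<beta>)) \<and> rroot R = (addr \<beta> = []) \<and> rn R \<in> mem N \<and>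
     rcnt R + e \<beta> \<le> V (addr \<beta>) \<and> 2 \<le> V (addr \<beta>) \<and> par_ok \<nu> y \<beta> (rpar R)"

text \<open>The ghost component \<open>\<nu> y\<close> lists the addresses described by the records at y; \<open>\<mu>\<close> is the memory of H
  at the current configuration of H and \<open>\<mu>N\<close> the memory of N. The departures from \<open>\<beta>\<close> are at most
  \<open>V (addr \<beta>)\<close>, twice the number of visits of N at \<open>addr \<beta>\<close>, and \<open>e \<beta>\<close> departures are held in reserve.\<close>

definition Inv :: "(nat list \<Rightarrow> nat list list) \<Rightarrow> (nat list \<Rightarrow> 'm \<times> ('q, 'm, 'g, 'n) rcd list) \<Rightarrow> (nat list \<Rightarrow> 'm)
    \<Rightarrow> (nat list \<Rightarrow> 'n) \<Rightarrow> (nat list \<Rightarrow> nat) \<Rightarrow> (nat list \<Rightarrow> nat) \<Rightarrow> bool" where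
  "Inv \<nu> \<mu>E \<mu> \<mu>N e V \<longleftrightarrow>
     (\<forall>y. length (snd (\<mu>E y)) = length (\<nu> y) \<and> distinct (\<nu> y) \<and> fst (\<mu>E y) = \<mu> y \<and>
        (\<forall>k<length (\<nu> y). rec_ok \<nu> \<mu>N e V y (\<nu> y ! k) (snd (\<mu>E y) ! k))) \<and>
     (\<forall>\<beta> y g ss \<mu>. cp \<beta> = Some (y, ONode g ss, \<mu>) \<longrightarrow> \<beta> \<notin> set (\<nu> y) \<longrightarrow> \<mu>N (addr \<beta>) = topm N)"

section \<open>Preservation of the invariant\<close>

lemma InvD:
  assumes "Inv \<nu> \<mu>E \<mu> \<mu>N e V"
  shows "length (snd (\<mu>E y)) = length (\<nu> y)" "distinct (\<nu> y)" "fst (\<mu>E y) = \<mu> y"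
    "k < length (\<nu> y) \<Longrightarrow> rec_ok \<nu> \<mu>N e V y (\<nu> y ! k) (snd (\<mu>E y) ! k)"
    "cp \<beta> = Some (y, ONode g ss, \<mu>') \<Longrightarrow> \<beta> \<notin> set (\<nu> y) \<Longrightarrow> \<mu>N (addr \<beta>) = topm N"
  using assms unfolding Inv_def by blast+

text \<open>Reserves may be given up at any time, and they may grow by as much as \<open>V\<close>
  grows at their address.\<close>

lemma Inv_slack:
  assumes "Inv \<nu> \<mu>E \<mu> \<mu>N e V" "\<And>\<beta>. e' \<beta> + V (addr \<beta>) \<le> V' (addr \<beta>) + e \<beta>" "\<And>v. V v \<le> V' v"
  shows "Inv \<nu> \<mu>E \<mu> \<mu>N e' V'"
proof -
  have "rec_ok \<nu> \<mu>N e V y \<beta> R \<Longrightarrow> rec_ok \<nu> \<mu>N e' V' y \<beta> R" for y \<beta> R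
    using assms(2)[of \<beta>] assms(3)[of "addr \<beta>"] unfolding rec_ok_def by auto
  then show ?thesis using assms(1) unfolding Inv_def by blast
qed

lemma Inv_mem_upd:
  assumes "Inv \<nu> \<mu>E \<mu> \<mu>N e V"
  shows "Inv \<nu> (\<mu>E(y := (m, snd (\<mu>E y)))) (\<mu>(y := m)) \<mu>N e V"
  using assms unfolding Inv_def by auto

lemma rec_ok_pos: "rec_ok \<nu> \<mu>N e V y \<beta> R \<Longrightarrow> rec_ok \<nu>' \<mu>N' e' V' y' \<beta> R' \<Longrightarrow> y = y'"
  unfolding rec_ok_def by auto

lemma rec_ok_parent:
  assumes "rec_ok \<nu> \<mu>N e V y (\<gamma> @ [j]) R"
  obtains y' s' \<mu>' k' d where "cp \<gamma> = Some (y', s', \<mu>')" "k' < length (\<nu> y')" "\<nu> y' ! k' = \<gamma>"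
    "xmove t y d = Some y'" "rpar R = Some (d, k', j)"
proof -
  have "par_ok \<nu> y (\<gamma> @ [j]) (rpar R)" using assms unfolding rec_ok_def by blast
  then show ?thesis using that unfolding par_ok_def by auto
qed

lemma Inv_index_unique:
  assumes "Inv \<nu> \<mu>E \<mu> \<mu>N e V" "k < length (\<nu> x)" "k' < length (\<nu> y)" "\<nu> x ! k = \<nu> y ! k'"
  shows "x = y \<and> k = k'"
proof -
  have "x = y" using InvD(4)[OF assms(1,2)] InvD(4)[OF assms(1,3)] assms(4) rec_ok_pos by metis
  then show ?thesis using assms InvD(2)[OF assms(1)] nth_eq_iff_index_eq by blast
qed

text \<open>A departure is paid with one unit from the reserve of its record.\<close>

lemma Inv_bump:
  assumes I: "Inv \<nu> \<mu>E \<mu> \<mu>N e V" and k: "k < length (\<nu> x)"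
    and e: "\<And>\<beta>. \<beta> \<noteq> \<nu> x ! k \<Longrightarrow> e' \<beta> \<le> e \<beta>" "e' (\<nu> x ! k) + 1 \<le> e (\<nu> x ! k)"
    and rs: "rs = snd (\<mu>E x)"
  shows "Inv \<nu> (\<mu>E(x := (m, rs[k := bump (rs ! k)]))) (\<mu>(x := m)) \<mu>N e' V"
proof -
  let ?\<mu>E = "\<mu>E(x := (m, rs[k := bump (rs ! k)]))"
  have "rec_ok \<nu> \<mu>N e' V y (\<nu> y ! k') (snd (?\<mu>E y) ! k')" if k': "k' < length (\<nu> y)" for y k'
  proof (cases "y = x \<and> k' = k")
    case True
    have l: "k < length rs" using k rs InvD(1)[OF I, of x] by simp
    show ?thesis using True InvD(4)[OF I k'] e(2) l rs unfolding rec_ok_def by auto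
  next
    case False
    then have "\<nu> y ! k' \<noteq> \<nu> x ! k" using Inv_index_unique[OF I k' k] by blast
    then have "e' (\<nu> y ! k') \<le> e (\<nu> y ! k')" by (rule e(1))
    moreover have "snd (?\<mu>E y) ! k' = snd (\<mu>E y) ! k'" using False rs by (auto simp: nth_list_update)
    ultimately show ?thesis using InvD(4)[OF I k'] unfolding rec_ok_def by auto
  qed
  then show ?thesis using I rs unfolding Inv_def by auto
qed

text \<open>An update of N touches one record only, as an output address determines the output node
  of the computation tree (\<open>hcomp_output_unique\<close>).\<close>

lemma Inv_set_rn:
  assumes I: "Inv \<nu> \<mu>E \<mu> \<mu>N e V" and k: "k < length (\<nu> x)"
    and b: "cp (\<nu> x ! k) = Some (x, ONode g ss, \<mu>0)" and n: "n \<in> mem N" and rs: "rs = snd (\<mu>E x)"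
  shows "Inv \<nu> (\<mu>E(x := (\<mu> x, rs[k := set_rn (rs ! k) n]))) \<mu> (\<mu>N(addr (\<nu> x ! k) := n)) e V"
proof -
  let ?\<mu>E = "\<mu>E(x := (\<mu> x, rs[k := set_rn (rs ! k) n]))" and ?\<mu>N = "\<mu>N(addr (\<nu> x ! k) := n)"
  have "rec_ok \<nu> ?\<mu>N e V y (\<nu> y ! k') (snd (?\<mu>E y) ! k')" if k': "k' < length (\<nu> y)" for y k'
  proof (cases "y = x \<and> k' = k")
    case True
    have l: "k < length rs" using k rs InvD(1)[OF I, of x] by simp
    show ?thesis using True InvD(4)[OF I k'] l rs n unfolding rec_ok_def by auto
  next
    case False
    then have ne: "\<nu> y ! k' \<noteq> \<nu> x ! k" using Inv_index_unique[OF I k' k] by blast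
    have "addr (\<nu> y ! k') \<noteq> addr (\<nu> x ! k)" if "cp (\<nu> y ! k') = Some (y, ONode g' ss', \<mu>')" for g' ss' \<mu>'
      using hcomp_output_unique[OF b that] ne by auto
    moreover have "snd (?\<mu>E y) ! k' = snd (\<mu>E y) ! k'" using False rs by (auto simp: nth_list_update)
    ultimately show ?thesis using InvD(4)[OF I k'] unfolding rec_ok_def by auto
  qed
  moreover have "?\<mu>N (addr \<beta>) = topm N" if "cp \<beta> = Some (y, ONode g' ss', \<mu>')" "\<beta> \<notin> set (\<nu> y)" for \<beta> y g' ss' \<mu>'
  proof -
    have "addr \<beta> \<noteq> addr (\<nu> x ! k)" using hcomp_output_unique[OF that(1) b] that b k by auto
    then show ?thesis using InvD(5)[OF I that] by simp
  qed
  ultimately show ?thesis using I rs unfolding Inv_def by auto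
qed

text \<open>If no record has the key, the address is new: an existing record of it would point to
  the same parent record by the same edge, and the direction is determined by the two
  positions.\<close>

lemma Inv_find_or_create:
  assumes I: "Inv \<nu> \<mu>E \<mu> \<mu>N e V"
    and \<gamma>: "cp \<gamma> = Some (y', s', \<mu>')" "k' < length (\<nu> y')" "\<nu> y' ! k' = \<gamma>"
    and \<beta>: "cp (\<gamma> @ [j]) = Some (y, s, \<mu>)" and d: "xmove t y d = Some y'"
    and V: "e (\<gamma> @ [j]) \<le> V (addr (\<gamma> @ [j]))" "2 \<le> V (addr (\<gamma> @ [j]))"
    and rs: "rs = snd (\<mu>E y)" and rt: "rt \<longleftrightarrow> addr (\<gamma> @ [j]) = []"
    and f: "find_or_create (d, k', j) s (\<mu> y) rt (topm N) rs = (k, rs')"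
  shows "\<exists>\<nu>'. Inv \<nu>' (\<mu>E(y := (\<mu> y, rs'))) \<mu> \<mu>N e V \<and> k < length (\<nu>' y) \<and> \<nu>' y ! k = \<gamma> @ [j]"
proof (cases "\<exists>k<length rs. rpar (rs ! k) = Some (d, k', j)")
  case True
  then have k: "k = (LEAST k. k < length rs \<and> rpar (rs ! k) = Some (d, k', j))" "rs' = rs"
    using f by (auto simp: find_or_create_def)
  have "k < length rs \<and> rpar (rs ! k) = Some (d, k', j)" unfolding k(1) by (rule LeastI_ex[OF True])
  then have k: "k < length (\<nu> y)" "rpar (rs ! k) = Some (d, k', j)" using InvD(1)[OF I, of y] rs by auto
  have "\<nu> y ! k = \<gamma> @ [j]"
    using InvD(4)[OF I k(1)] k(2) d \<gamma>(3) unfolding rec_ok_def par_ok_def rs by auto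
  moreover have "\<mu>E(y := (\<mu> y, rs')) = \<mu>E" using InvD(3)[OF I, of y] rs \<open>rs' = rs\<close> by (auto simp: fun_eq_iff prod_eq_iff)
  ultimately show ?thesis using I k(1) by (intro exI[of _ \<nu>]) simp
next
  case False
  then have k: "k = length rs" "rs' = rs @ [Rcd s (\<mu> y) (Some (d, k', j)) rt (topm N) 0]"
    using f unfolding find_or_create_def if_not_P[OF False] by simp_all
  have new: "\<gamma> @ [j] \<notin> set (\<nu> y)"
  proof
    assume "\<gamma> @ [j] \<in> set (\<nu> y)"
    then obtain i where i: "i < length (\<nu> y)" "\<nu> y ! i = \<gamma> @ [j]" by (auto simp: in_set_conv_nth)
    obtain y1 s1 \<mu>1 k1 d1 where 1: "cp \<gamma> = Some (y1, s1, \<mu>1)" "k1 < length (\<nu> y1)"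
        "\<nu> y1 ! k1 = \<gamma>" "xmove t y d1 = Some y1" "rpar (rs ! i) = Some (d1, k1, j)"
      using InvD(4)[OF I i(1)] unfolding i(2) rs by (rule rec_ok_parent)
    have "y1 = y'" using 1(1) \<gamma>(1) by simp
    moreover have "k1 = k'" using Inv_index_unique[OF I 1(2) \<gamma>(2)] 1(3) \<gamma>(3) by simp
    moreover have "d1 = d" using xmove_inj[OF 1(4)] d calculation(1) by simp
    ultimately show False using False 1(5) i(1) InvD(1)[OF I, of y] rs by auto
  qed
  let ?\<nu> = "\<nu>(y := \<nu> y @ [\<gamma> @ [j]])"
  have ext: "i < length (?\<nu> z) \<and> ?\<nu> z ! i = \<nu> z ! i" if "i < length (\<nu> z)" for z i
    using that by (auto simp: nth_append)
  have par: "par_ok ?\<nu> z \<beta> p" if "par_ok \<nu> z \<beta> p" for z \<beta> p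
    using that ext unfolding par_ok_def by metis
  have old: "rec_ok ?\<nu> \<mu>N e V z \<beta> R" if "rec_ok \<nu> \<mu>N e V z \<beta> R" for z \<beta> R
    using that par unfolding rec_ok_def by blast
  have "par_ok ?\<nu> y (\<gamma> @ [j]) (Some (d, k', j))"
    unfolding par_ok_def using \<gamma> d ext[OF \<gamma>(2)] by blast
  then have "rec_ok ?\<nu> \<mu>N e V y (\<gamma> @ [j]) (Rcd s (\<mu> y) (Some (d, k', j)) rt (topm N) 0)"
    unfolding rec_ok_def using \<beta> V rt InvD(5)[OF I _ new] N_uthm by (auto simp: is_uthm_def)
  then have "Inv ?\<nu> (\<mu>E(y := (\<mu> y, rs'))) \<mu> \<mu>N e V"
    using I old new unfolding Inv_def k by (auto simp: nth_append less_Suc_eq rs)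
  moreover have "k < length (?\<nu> y)" "?\<nu> y ! k = \<gamma> @ [j]" using k(1) InvD(1)[OF I, of y] rs by auto
  ultimately show ?thesis by blast
qed

text \<open>The factor 2: a visit of N pays, for each record at the visited address, one departure
  on the way forward to the output symbol and one on the way back when N moves up.\<close>

definition Vis :: "('p, 'n) conf list \<Rightarrow> nat list \<Rightarrow> nat" where
  "Vis cs v = 2 * visits cs {v}"

lemma Inv_records:
  assumes I: "Inv \<nu> \<mu>E \<mu> \<mu>N e (Vis cs)" and run: "is_run N r cs"
  shows "length (\<nu> y) \<le> maxrec"
proof -
  have pos: "\<exists>s \<mu>. cp \<beta> = Some (y, s, \<mu>)" "2 \<le> Vis cs (addr \<beta>)" if "\<beta> \<in> set (\<nu> y)" for \<beta>
    using that InvD(4)[OF I] unfolding rec_ok_def in_set_conv_nth by blast+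
  let ?f = "\<lambda>\<beta>. case the (cp \<beta>) of (_, s, \<mu>) \<Rightarrow> (\<mu> y, s)"
  have im: "?f ` set (\<nu> y) \<subseteq> mem H \<times> rhs_parts" using pos(1) cp_nodes by fastforce
  have fib: "card {\<beta> \<in> set (\<nu> y). ?f \<beta> = b} \<le> B" for b
  proof -
    let ?F = "{\<beta> \<in> set (\<nu> y). ?f \<beta> = b}"
    have anti: "\<beta> = \<beta>'" if b: "\<beta> \<in> ?F" "\<beta>' \<in> ?F" "prefix (addr \<beta>) (addr \<beta>')" for \<beta> \<beta>'
    proof -
      obtain s \<mu> s' \<mu>' where c: "cp \<beta> = Some (y, s, \<mu>)" "cp \<beta>' = Some (y, s', \<mu>')" using b pos(1) by blast
      then have "s' = s" "\<mu>' y = \<mu> y" using b by auto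
      then show ?thesis using cp_antichain c b(3) by blast
    qed
    then have inj: "inj_on addr ?F" by (auto intro!: inj_onI)
    have ac: "antichain r (addr ` ?F)"
      unfolding antichain_def using pos(1) hcomp_addr_nodes[OF yields_r] anti by blast
    \<comment> \<open>Each address is visited at some time of the run, and different addresses at
      different times, so there are no more addresses than visits.\<close>
    have "addr ` ?F \<subseteq> (\<lambda>i. fst (cs ! i)) ` {i. i < length cs \<and> fst (cs ! i) \<in> addr ` ?F}"
    proof
      fix v assume v: "v \<in> addr ` ?F"
      then have "visits cs {v} \<noteq> 0" using pos(2) by (fastforce simp: Vis_def)
      then obtain i where "i < length cs" "fst (cs ! i) = v" unfolding visits_def by (auto simp: card_gt_0_iff)
      then show "v \<in> (\<lambda>i. fst (cs ! i)) ` {i. i < length cs \<and> fst (cs ! i) \<in> addr ` ?F}" using v by blast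
    qed
    then have "card (addr ` ?F) \<le> visits cs (addr ` ?F)"
      unfolding visits_def by (rule surj_card_le[rotated]) simp
    also have "\<dots> \<le> B" using narrow[OF run ac] .
    finally show ?thesis using card_image[OF inj] by simp
  qed
  have "card (set (\<nu> y)) \<le> B * card (?f ` set (\<nu> y))"
    by (rule card_le_fibers) (use fib in auto)
  also have "\<dots> \<le> maxrec" unfolding maxrec_def using im finite_sets finite_rhs_parts
    by (intro mult_le_mono2 card_mono) auto
  finally show ?thesis using distinct_card[OF InvD(2)[OF I, of y]] by simp
qed

lemma xmove_dirs: "lab t y = Some \<sigma> \<Longrightarrow> xmove t y (Some d) = Some y' \<Longrightarrow>
    d \<in> dirs \<and> (d = Up \<or> (\<exists>i. d = Down i \<and> 1 \<le> i \<and> i \<le> rkS \<sigma>))"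
  using child_le_rank[OF wf, of y \<sigma>] lab_in_alphabet[OF wf, of y \<sigma>]
  by (cases d) (auto simp: dirs_def split: if_splits)

lemma Inv_mem:
  assumes I: "Inv \<nu> \<mu>E \<mu> \<mu>N e (Vis cs)" and run: "is_run N r cs" and \<mu>: "\<forall>v. \<mu> v \<in> mem H"
  shows "\<mu>E y \<in> cM"
proof -
  have "snd (\<mu>E y) ! k \<in> recs" if k: "k < length (\<nu> y)" for k
  proof -
    let ?R = "snd (\<mu>E y) ! k" and ?\<beta> = "\<nu> y ! k"
    have R: "rec_ok \<nu> \<mu>N e (Vis cs) y ?\<beta> ?R" using InvD(4)[OF I k] .
    then obtain \<mu>1 where c: "cp ?\<beta> = Some (y, rtree ?R, \<mu>1)" "rmem ?R = \<mu>1 y" unfolding rec_ok_def by blast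
    then have 1: "rtree ?R \<in> rhs_parts" "rmem ?R \<in> mem H" and "\<exists>\<sigma>. lab t y = Some \<sigma>" using cp_nodes[OF c(1)] by auto
    then obtain \<sigma> where \<sigma>: "lab t y = Some \<sigma>" by blast
    have an: "addr ?\<beta> \<in> nodes r" using hcomp_addr_nodes[OF yields_r c(1)] .
    have "visits cs {addr ?\<beta>} \<le> B" by (rule narrow[OF run]) (use an in \<open>auto simp: antichain_def\<close>)
    then have 2: "rcnt ?R \<le> 2 * B" using R unfolding rec_ok_def Vis_def by auto
    have "rpar ?R \<in> insert None (Some ` (insert None (Some ` dirs) \<times> {..<maxrec} \<times> insert 0 (\<Union>s\<in>rhs_parts. {..width s})))"
    proof (cases "rpar ?R")
      case (Some p)
      obtain \<gamma> j y' s' \<mu>' k' d where p: "?\<beta> = \<gamma> @ [j]" "cp \<gamma> = Some (y', s', \<mu>')" "k' < length (\<nu> y')"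
        "xmove t y d = Some y'" "p = (d, k', j)"
        using R Some unfolding rec_ok_def par_ok_def by auto
      have "k' < maxrec" using p(3) Inv_records[OF I run, of y'] by simp
      moreover have "d \<in> insert None (Some ` dirs)" using xmove_dirs[OF \<sigma>, of _ y'] p(4) by (cases d) auto
      moreover have "j \<in> insert 0 (\<Union>s\<in>rhs_parts. {..width s})"
      proof -
        have "hnext H t (y', s', \<mu>') j = Some (y, rtree ?R, \<mu>1)" using c(1) p(1,2) by simp
        then show ?thesis
        proof (cases rule: hnextE)
          case (node u g ss \<mu>)
          then have "s' \<in> rhs_parts" "j \<le> width s'" using cp_nodes[OF p(2)] by auto
          then show ?thesis by blast
        qed simp
      qed
      ultimately show ?thesis using Some p(5) by blast
    qed simp
    moreover have "rn ?R \<in> mem N" using R unfolding rec_ok_def by blast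
    ultimately show ?thesis unfolding recs_def
      by (intro image_eqI[of _ _ "(rtree ?R, rmem ?R, rpar ?R, rroot ?R, rn ?R, rcnt ?R)"]) (use 1 2 in auto)
  qed
  then have "set (snd (\<mu>E y)) \<subseteq> recs" using InvD(1)[OF I, of y] by (auto simp: in_set_conv_nth)
  moreover have "length (snd (\<mu>E y)) \<le> maxrec" using Inv_records[OF I run, of y] InvD(1)[OF I, of y] by simp
  moreover have "fst (\<mu>E y) \<in> mem H" using \<mu> InvD(3)[OF I, of y] by simp
  ultimately show ?thesis unfolding cM_def by (cases "\<mu>E y") auto
qed

lemma cQ_simps:
  "At k p \<in> cQ \<longleftrightarrow> k < maxrec \<and> p \<in> st N" "Back k p \<in> cQ \<longleftrightarrow> k < maxrec \<and> p \<in> st N"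
  "Inc k d q p rt \<in> cQ \<longleftrightarrow> k < maxrec \<and> d \<in> dirs \<and> q \<in> st H \<and> p \<in> st N"
  by (auto simp: cQ_def image_iff)

lemma E_Leaf:
  assumes "lab t x = Some \<sigma>" "cdelta q \<sigma> (child_index x) (\<mu>E x) = Some (Leaf (q', m', d))"
    "leaf_ok rkS cQ cM cpot \<sigma> (\<mu>E x) (q', m', d)" "xmove t x d = Some y"
  shows "E (x, q, \<mu>E) = Some (Leaf (y, q', \<mu>E(x := m')))"
  using assms by (simp add: xstep_def capped_def)

text \<open>The synchronization points, where N is about to read an output symbol. One unit stays
  reserved for each record with the current output address, to pay for a later way back.\<close>

definition Rest :: "('p, 'n) conf list \<Rightarrow> (('q, 'p) cst, 'm \<times> ('q, 'm, 'g, 'n) rcd list) conf \<Rightarrow> bool" where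
  "Rest cs c \<longleftrightarrow> (\<exists>\<nu> k x g ss \<mu> \<mu>E p \<mu>N. last cs = (addr (\<nu> x ! k), p, \<mu>N) \<and> c = (x, At k p, \<mu>E) \<and>
     k < length (\<nu> x) \<and> cp (\<nu> x ! k) = Some (x, ONode g ss, \<mu>) \<and>
     Inv \<nu> \<mu>E \<mu> \<mu>N (\<lambda>\<beta>. if addr \<beta> = addr (\<nu> x ! k) then 1 else 0) (Vis cs))"

end

section \<open>Correctness of the composition\<close>

context composition_run
begin

text \<open>Following a derivation of \<open>yields\<close>, each edge 0 costs two steps, a move out
  of \<open>At\<close> and the completion in \<open>Inc\<close>. Records at address \<open>v\<close>
  start with two units of reserve; the ones already passed, strict prefixes of
  \<open>\<beta>\<close>, have one left.\<close>

lemma forward: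
  assumes run: "is_run N r cs" and last: "last cs = (v, p, \<mu>N)" and p: "p \<in> st N"
  shows "yields H t c r' \<Longrightarrow> c = (x, s, \<mu>) \<Longrightarrow> cp \<beta> = Some c \<Longrightarrow> addr \<beta> = v \<Longrightarrow> k < length (\<nu> x) \<Longrightarrow> \<nu> x ! k = \<beta> \<Longrightarrow>
    Inv \<nu> \<mu>E \<mu> \<mu>N (\<lambda>\<beta>'. if addr \<beta>' = v then (if strict_prefix \<beta>' \<beta> then 1 else 2) else 0) (Vis cs) \<Longrightarrow>
    \<exists>d. silent E (x, At k p, \<mu>E) d \<and> Rest cs d"
proof (induction arbitrary: x s \<mu> \<beta> k \<nu> \<mu>E rule: yields.induct)
  case (node rs ss u \<mu>' g)
  have "Inv \<nu> \<mu>E \<mu> \<mu>N (\<lambda>\<beta>'. if addr \<beta>' = v then 1 else 0) (Vis cs)"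
    by (rule Inv_slack[OF node.prems(6)]) auto
  then have "Rest cs (x, At k p, \<mu>E)"
    unfolding Rest_def using node.prems last
    by (intro exI[of _ \<nu>] exI[of _ k] exI[of _ x] exI[of _ g] exI[of _ ss] exI[of _ \<mu>] exI[of _ \<mu>E] exI[of _ p] exI[of _ \<mu>N]) auto
  then show ?case by blast
next
  case (leaf u l \<mu>' c r')
  obtain q' m' d where l: "l = (q', m', d)" by (metis prod_cases3)
  have [simp]: "u = x" "s = Leaf (q', m', d)" "\<mu>' = \<mu>" using leaf.prems(1) l by auto
  have cpb: "cp \<beta> = Some (x, Leaf (q', m', d), \<mu>)" using leaf.prems(2) l by simp
  from leaf.hyps(1) obtain y \<sigma>' s2 where y: "move t x d = Some y" "lab t y = Some \<sigma>'"
      "delta H q' \<sigma>' ((\<mu>(x := m')) y) = Some s2" "c = (y, s2, \<mu>(x := m'))"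
    by (cases rule: hnextE) (auto simp: l)
  let ?\<mu> = "\<mu>(x := m')" and ?e = "\<lambda>\<beta>'. if addr \<beta>' = v then (if strict_prefix \<beta>' (\<beta> @ [0]) then 1 else 2) else 0"
  note lo = hconf_ok_leaf[OF cp_ok[OF cpb]]
  obtain \<sigma> where \<sigma>: "lab t x = Some \<sigma>" "d = Up \<or> (\<exists>i. d = Down i \<and> 1 \<le> i \<and> i \<le> rkS \<sigma>)" using lo(5) by blast
  have cpb': "cp (\<beta> @ [0]) = Some c" using leaf.prems(2) leaf.hyps(1) by simp
  have mem\<mu>: "\<forall>w. ?\<mu> w \<in> mem H" using cp_nodes[of "\<beta> @ [0]"] cpb' y(4) by blast
  note I = leaf.prems(6) and k = leaf.prems(4) and \<nu>k = leaf.prems(5)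
  define rs where "rs = snd (\<mu>E x)"
  have len: "k < length rs" using k InvD(1)[OF I, of x] by (simp add: rs_def)
  have rk: "rec_ok \<nu> \<mu>N (\<lambda>\<beta>'. if addr \<beta>' = v then (if strict_prefix \<beta>' \<beta> then 1 else 2) else 0) (Vis cs) x \<beta> (rs ! k)"
    using InvD(4)[OF I k] \<nu>k by (simp add: rs_def)
  have rt: "rtree (rs ! k) = Leaf (q', m', d)" "rroot (rs ! k) \<longleftrightarrow> addr \<beta> = []" using rk cpb unfolding rec_ok_def by auto
  have Ex: "\<mu>E x = (\<mu> x, rs)" using InvD(3)[OF I, of x] by (simp add: rs_def prod_eq_iff)
  define \<mu>E1 where "\<mu>E1 = \<mu>E(x := (m', rs[k := bump (rs ! k)]))"
  have sp: "strict_prefix \<beta>' (\<beta> @ [0]) \<longleftrightarrow> \<beta>' = \<beta> \<or> strict_prefix \<beta>' \<beta>" for \<beta>' by (auto simp: strict_prefix_def)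
  \<comment> \<open>\<open>\<beta>\<close> becomes a strict prefix of the new address
    \<open>\<beta> @ [0]\<close>, so its reserve drops from 2 to 1, which pays for the bump.\<close>
  have I1: "Inv \<nu> \<mu>E1 ?\<mu> \<mu>N ?e (Vis cs)"
    unfolding \<mu>E1_def by (rule Inv_bump[OF I k]) (use \<nu>k leaf.prems(3) sp in \<open>auto simp: rs_def\<close>)
  let ?d = "case d of Up \<Rightarrow> Down (child_index x) | Down _ \<Rightarrow> Up"
  have bck: "move t y ?d = Some x" using move_back[OF lo(4) y(1)] .
  have kmax: "k < maxrec" using k Inv_records[OF I run, of x] by simp
  have "leaf_ok rkS cQ cM cpot \<sigma> (\<mu>E x) (Inc k ?d q' p (rroot (rs ! k)), (m', rs[k := bump (rs ! k)]), Some d)"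
    using kmax xmove_dirs[of y _ ?d x] y(2) bck lo(1) p Inv_mem[OF I1 run mem\<mu>, of x] cpot_bump[OF len, of "\<mu> x" m'] \<sigma>(2)
    unfolding leaf_ok_def Ex by (simp add: cQ_simps \<mu>E1_def)
  then have step1: "E (x, At k p, \<mu>E) = Some (Leaf (y, Inc k ?d q' p (rroot (rs ! k)), \<mu>E1))"
    unfolding \<mu>E1_def by (intro E_Leaf[OF \<sigma>(1)]) (use len rt y(1) in \<open>auto simp: Ex\<close>)
  define rs1 where "rs1 = snd (\<mu>E1 y)"
  obtain k2 rs2 where f: "find_or_create (Some ?d, k, 0) s2 (?\<mu> y) (rroot (rs ! k)) (topm N) rs1 = (k2, rs2)" by fastforce
  \<comment> \<open>The run ends at \<open>v\<close>; hence a new record with this address meets the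
    demand \<open>2 \<le> V\<close>.\<close>
  have "visits cs {v} \<noteq> 0"
  proof -
    have "cs \<noteq> []" using run by (simp add: is_run_def)
    then have "cs = butlast cs @ [(v, p, \<mu>N)]" using last by (metis append_butlast_last_id)
    then show ?thesis using visits_snoc[of "butlast cs" "(v, p, \<mu>N)" "{v}"] by simp
  qed
  then have V2: "2 \<le> Vis cs v" by (simp add: Vis_def)
  have "\<exists>\<nu>'. Inv \<nu>' (\<mu>E1(y := (?\<mu> y, rs2))) ?\<mu> \<mu>N ?e (Vis cs) \<and> k2 < length (\<nu>' y) \<and> \<nu>' y ! k2 = \<beta> @ [0]"
    by (rule Inv_find_or_create[OF I1 cpb k \<nu>k _ _ _ _ rs1_def _ f])
      (use cpb' y bck leaf.prems(3) V2 rt(2) in auto)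
  then obtain \<nu>' where I2: "Inv \<nu>' (\<mu>E1(y := (?\<mu> y, rs2))) ?\<mu> \<mu>N ?e (Vis cs)" and k2: "k2 < length (\<nu>' y)" "\<nu>' y ! k2 = \<beta> @ [0]"
    by blast
  have E1y: "\<mu>E1 y = (?\<mu> y, rs1)" using InvD(3)[OF I1, of y] by (simp add: rs1_def prod_eq_iff)
  have "leaf_ok rkS cQ cM cpot \<sigma>' (\<mu>E1 y) (At k2 p, (?\<mu> y, rs2), None)"
    using k2 Inv_records[OF I2 run, of y] p Inv_mem[OF I2 run mem\<mu>, of y] cpot_find_or_create[OF f, of "?\<mu> y" "?\<mu> y"]
    unfolding leaf_ok_def E1y by (auto simp: cQ_simps)
  then have step2: "E (y, Inc k ?d q' p (rroot (rs ! k)), \<mu>E1) = Some (Leaf (y, At k2 p, \<mu>E1(y := (?\<mu> y, rs2))))"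
    by (intro E_Leaf[OF y(2)]) (use y(3) f in \<open>auto simp: E1y\<close>)
  have ad0: "addr (\<beta> @ [0]) = v" using leaf.prems(3) by simp
  obtain e where "silent E (y, At k2 p, \<mu>E1(y := (?\<mu> y, rs2))) e" "Rest cs e"
    using leaf.IH[OF y(4) cpb' ad0 k2 I2] by blast
  then show ?case using silent_step[of E, OF step1 silent_step[of E, OF step2]] by blast
qed

text \<open>Phrased for \<open>goback\<close> because both an upward leaf of N and the state
  \<open>Back\<close> call it. The old memory \<open>a\<close> of H is left free: in state
  \<open>Back\<close> it differs from the restored value, and \<open>cpot\<close> ignores it. The
  recursion peels edges off the address until an output edge appears.\<close>

lemma backward:
  assumes run: "is_run N r cs" and last: "last cs = (w, p, \<mu>N)" and p: "p \<in> st N"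
  shows "cp \<beta> = Some (x, s, \<mu>) \<Longrightarrow> addr \<beta> = w @ [j] \<Longrightarrow> k < length (\<nu> x) \<Longrightarrow> \<nu> x ! k = \<beta> \<Longrightarrow> lab t x = Some \<sigma> \<Longrightarrow>
    Inv \<nu> (\<mu>E(x := (\<mu> x, rs))) \<mu> \<mu>N (\<lambda>\<beta>'. if addr \<beta>' = w \<or> addr \<beta>' = w @ [j] \<and> prefix \<beta>' \<beta> then 1 else 0) (Vis cs) \<Longrightarrow>
    \<exists>q' m' d y. goback k p (\<mu> x) rs = (q', m', d) \<and> leaf_ok rkS cQ cM cpot \<sigma> (a, rs) (q', m', d) \<and>
      xmove t x d = Some y \<and> (\<exists>e. silent E (y, q', \<mu>E(x := m')) e \<and> Rest cs e)"
proof (induction \<beta> arbitrary: x s \<mu> k \<sigma> \<mu>E rs a rule: rev_induct)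
  case Nil
  then show ?case by simp
next
  case (snoc i \<gamma>)
  note I = snoc.prems(6) and k = snoc.prems(3) and \<nu>k = snoc.prems(4)
  let ?\<mu>E = "\<mu>E(x := (\<mu> x, rs))"
  let ?e = "\<lambda>\<beta> \<beta>'. if addr \<beta>' = w \<or> addr \<beta>' = w @ [j] \<and> prefix \<beta>' \<beta> then 1 else 0"
  have mem\<mu>: "\<forall>v. \<mu> v \<in> mem H" using cp_nodes[OF snoc.prems(1)] by blast
  have rk: "rec_ok \<nu> \<mu>N (?e (\<gamma> @ [i])) (Vis cs) x (\<gamma> @ [i]) (rs ! k)" using InvD(4)[OF I k] \<nu>k by simp
  have len: "k < length rs" using k InvD(1)[OF I, of x] by simp
  obtain y' s' \<mu>' k' d where par: "cp \<gamma> = Some (y', s', \<mu>')" "k' < length (\<nu> y')" "\<nu> y' ! k' = \<gamma>"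
      "xmove t x d = Some y'" "rpar (rs ! k) = Some (d, k', i)"
    using rk by (rule rec_ok_parent)
  have k'max: "k' < maxrec" using par(2) Inv_records[OF I run, of y'] by simp
  have "hnext H t (y', s', \<mu>') i = Some (x, s, \<mu>)" using snoc.prems(1) par(1) by simp
  then show ?case
  proof (cases rule: hnextE)
    case (node u g ss \<mu>1)
    then have eq: "y' = x" "\<mu>' = \<mu>" "s' = ONode g ss" "i \<noteq> 0" by auto
    have d: "d = None" using xmove_inj[OF par(4), of None] eq(1) by simp
    have gb: "goback k p (\<mu> x) rs = (At k' p, (\<mu> x, rs), None)" using par(5) d by (simp add: goback_def)
    have ad: "addr \<gamma> = w" using snoc.prems(2) eq(4) by simp
    have lok: "leaf_ok rkS cQ cM cpot \<sigma> (a, rs) (At k' p, (\<mu> x, rs), None)"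
      unfolding leaf_ok_def using k'max p Inv_mem[OF I run mem\<mu>, of x] by (simp add: cQ_simps cpot_def)
    have "Inv \<nu> ?\<mu>E \<mu> \<mu>N (\<lambda>\<beta>. if addr \<beta> = addr (\<nu> x ! k') then 1 else 0) (Vis cs)"
      by (rule Inv_slack[OF I]) (use par(3) ad eq(1) in auto)
    then have "Rest cs (x, At k' p, ?\<mu>E)"
      unfolding Rest_def using par last ad eq
      by (intro exI[of _ \<nu>] exI[of _ k'] exI[of _ x] exI[of _ g] exI[of _ ss] exI[of _ \<mu>] exI[of _ ?\<mu>E] exI[of _ p] exI[of _ \<mu>N]) auto
    moreover have "xmove t x None = Some x" by simp
    ultimately show ?thesis using gb lok silent_refl[of E] by blast
  next
    case (leaf u q m dd \<mu>1 v1 \<sigma>1 s1)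
    then have eq: "s' = Leaf (q, m, dd)" "i = 0" "move t y' dd = Some x" "\<mu> = \<mu>'(y' := m)" by auto
    have "d \<noteq> None" using move_neq[OF eq(3)] par(4) by (cases d) auto
    then obtain d' where d': "d = Some d'" by blast
    define rs1 where "rs1 = rs[k := bump (rs ! k)]"
    have gb: "goback k p (\<mu> x) rs = (Back k' p, (\<mu> x, rs1), Some d')" using par(5) d' by (simp add: goback_def rs1_def)
    let ?\<mu>E1 = "\<mu>E(x := (\<mu> x, rs1))"
    have ad: "addr \<gamma> = w @ [j]" using snoc.prems(2) eq(2) by simp
    \<comment> \<open>The reserve of \<open>\<gamma> @ [i]\<close> pays for this bump; the prefixes
      of \<open>\<gamma>\<close> with address \<open>w @ [j]\<close> keep theirs for the rest of the
      way.\<close>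
    have "Inv \<nu> (?\<mu>E(x := (\<mu> x, rs[k := bump (rs ! k)]))) (\<mu>(x := \<mu> x)) \<mu>N (?e \<gamma>) (Vis cs)"
      by (rule Inv_bump[OF I k]) (use \<nu>k snoc.prems(2) in \<open>auto simp: prefix_def\<close>)
    then have I1: "Inv \<nu> ?\<mu>E1 \<mu> \<mu>N (?e \<gamma>) (Vis cs)" by (simp add: rs1_def)
    have lok: "leaf_ok rkS cQ cM cpot \<sigma> (a, rs) (Back k' p, (\<mu> x, rs1), Some d')"
      unfolding leaf_ok_def using k'max p Inv_mem[OF I1 run mem\<mu>, of x] cpot_bump[OF len, of a "\<mu> x"]
        xmove_dirs[OF snoc.prems(5), of d' y'] par(4) d' by (simp add: cQ_simps rs1_def)
    define rs2 where "rs2 = snd (?\<mu>E1 y')"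
    obtain \<sigma>' where \<sigma>': "lab t y' = Some \<sigma>'" using cp_nodes[OF par(1)] by blast
    have E1y: "?\<mu>E1 y' = (\<mu> y', rs2)" using InvD(3)[OF I1, of y'] by (simp add: rs2_def prod_eq_iff)
    have len2: "k' < length rs2" using par(2) InvD(1)[OF I1, of y'] by (simp add: rs2_def)
    have rm: "rmem (rs2 ! k') = \<mu>' y'"
      using InvD(4)[OF I1 par(2)] par(1,3) unfolding rec_ok_def rs2_def by auto
    \<comment> \<open>The undone move of H changed its memory only at \<open>y'\<close>, so
      resetting this one entry from \<open>rmem\<close> restores the whole earlier memory.\<close>
    have "Inv \<nu> (?\<mu>E1(y' := (\<mu>' y', rs2))) (\<mu>(y' := \<mu>' y')) \<mu>N (?e \<gamma>) (Vis cs)"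
      unfolding rs2_def by (rule Inv_mem_upd[OF I1])
    then have I2: "Inv \<nu> (?\<mu>E1(y' := (\<mu>' y', rs2))) \<mu>' \<mu>N (?e \<gamma>) (Vis cs)" by (simp add: eq(4))
    from snoc.IH[OF par(1) ad par(2,3) \<sigma>' I2, of "\<mu> y'"] obtain q2 m2 d2 y2 e where
      2: "goback k' p (\<mu>' y') rs2 = (q2, m2, d2)" "leaf_ok rkS cQ cM cpot \<sigma>' (\<mu> y', rs2) (q2, m2, d2)"
        "xmove t y' d2 = Some y2" "silent E (y2, q2, ?\<mu>E1(y' := m2)) e" "Rest cs e"
      by blast
    have "E (y', Back k' p, ?\<mu>E1) = Some (Leaf (y2, q2, ?\<mu>E1(y' := m2)))"
      by (rule E_Leaf[OF \<sigma>' _ _ 2(3)]) (use 2(1,2) len2 rm in \<open>simp_all only: E1y cdelta.simps if_True\<close>)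
    then have "silent E (y', Back k' p, ?\<mu>E1) e" using silent_step[of E] 2(4) by blast
    then show ?thesis using gb lok par(4) d' 2(5) by blast
  qed
qed

text \<open>A run of N is carried along because narrowness and the budget \<open>Vis\<close> speak
  about runs.\<close>

definition sim :: "('p, 'n) conf \<Rightarrow> (('q, 'p) cst, 'm \<times> ('q, 'm, 'g, 'n) rcd list) conf \<Rightarrow> bool" where
  "sim c1 c2 \<longleftrightarrow> (\<exists>cs d. is_run N r cs \<and> last cs = c1 \<and> fst (snd c1) \<in> st N \<and> silent E c2 d \<and> Rest cs d)"

lemma N_step:
  assumes run: "is_run N r cs" and R: "Rest cs c2"
  shows "rel_option (rel_otree (=) sim) (step N r (last cs)) (E c2)"
proof -
  obtain \<nu> k x g ss \<mu> \<mu>E p \<mu>N where last: "last cs = (addr (\<nu> x ! k), p, \<mu>N)" and c2: "c2 = (x, At k p, \<mu>E)"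
    and k: "k < length (\<nu> x)" and cpb: "cp (\<nu> x ! k) = Some (x, ONode g ss, \<mu>)"
    and I: "Inv \<nu> \<mu>E \<mu> \<mu>N (\<lambda>\<beta>. if addr \<beta> = addr (\<nu> x ! k) then 1 else 0) (Vis cs)"
    using R unfolding Rest_def by blast
  define \<beta> where "\<beta> = \<nu> x ! k"
  define v where "v = addr \<beta>"
  define rs where "rs = snd (\<mu>E x)"
  have len: "k < length rs" using k InvD(1)[OF I, of x] by (simp add: rs_def)
  have Ex: "\<mu>E x = (\<mu> x, rs)" using InvD(3)[OF I, of x] by (simp add: rs_def prod_eq_iff)
  have rt: "rtree (rs ! k) = ONode g ss" using InvD(4)[OF I k] cpb unfolding rec_ok_def rs_def by auto
  then have rk: "rtree (rs ! k) = ONode g ss" "rroot (rs ! k) \<longleftrightarrow> v = []" "rn (rs ! k) = \<mu>N v"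
    using InvD(4)[OF I k] unfolding rec_ok_def rs_def v_def \<beta>_def by blast+
  obtain \<sigma> where \<sigma>: "lab t x = Some \<sigma>" using cp_nodes[OF cpb] by blast
  have mem\<mu>: "\<forall>v. \<mu> v \<in> mem H" using cp_nodes[OF cpb] by blast
  have labv: "lab r v = Some g" "v @ [j] \<in> nodes r \<longleftrightarrow> 1 \<le> j \<and> j \<le> length ss" for j
    using hcomp_output_node[OF yields_r cpb] by (auto simp: v_def \<beta>_def)
  have last': "last cs = (v, p, \<mu>N)" using last by (simp add: v_def \<beta>_def)
  show ?thesis
  proof (cases "delta N p g (\<mu>N v)")
    case None
    then show ?thesis using labv(1) rk \<sigma> Ex len by (simp add: last' c2 step_def xstep_def capped_def)
  next
    case (Some s)
    let ?ok = "\<forall>(p', n', d)\<in>leaves s. case d of Up \<Rightarrow> \<not> rroot (rs ! k) | Down j \<Rightarrow> 1 \<le> j \<and> j \<le> length ss"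
    have ok: "(\<forall>(p', n', d)\<in>leaves s. move r v d \<noteq> None) \<longleftrightarrow> ?ok"
    proof -
      have "move r v d \<noteq> None \<longleftrightarrow> (case d of Up \<Rightarrow> \<not> rroot (rs ! k) | Down j \<Rightarrow> 1 \<le> j \<and> j \<le> length ss)" for d
        using rk(2) labv(2) by (cases d) auto
      then show ?thesis by simp
    qed
    show ?thesis
    proof (cases ?ok)
      case False
      then have "cdelta (At k p) \<sigma> (child_index x) (\<mu>E x) = None" using Some rk len Ex by auto
      then have "E c2 = None" using \<sigma> by (simp add: c2 xstep_def capped_def)
      moreover have "step N r (last cs) = None" using False ok Some labv(1) by (simp add: last' step_def)
      ultimately show ?thesis by simp
    next
      case okT: True
      have st1: "step N r (last cs) = Some (map_otree id (\<lambda>(q', m', d). (the (move r v d), q', \<mu>N(v := m'))) s)"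
        using okT ok Some labv(1) by (simp add: last' step_def)
      have leaf: "leaf_ok rkS cQ cM cpot \<sigma> (\<mu>E x) (nleaf k ss (\<mu> x) rs l) \<and>
         (case nleaf k ss (\<mu> x) rs l of (q', m', d) \<Rightarrow> xmove t x d \<noteq> None \<and>
            sim (case l of (q', m', d) \<Rightarrow> (the (move r v d), q', \<mu>N(v := m'))) (the (xmove t x d), q', \<mu>E(x := m')))"
        if l: "l \<in> leaves s" for l
      proof -
        obtain p' n' d where ld: "l = (p', n', d)" by (metis prod_cases3)
        have Nl: "\<forall>(q', m', d) \<in> leaves s. q' \<in> st N \<and> m' \<in> mem N" using N_uthm Some unfolding is_uthm_def by blast
        then have pn: "p' \<in> st N" "n' \<in> mem N" using l ld by auto
        have dok: "case d of Up \<Rightarrow> \<not> rroot (rs ! k) | Down j \<Rightarrow> 1 \<le> j \<and> j \<le> length ss" using okT l ld by auto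
        define v' where "v' = the (move r v d)"
        define cs' where "cs' = cs @ [(v', p', \<mu>N(v := n'))]"
        have run': "is_run N r cs'" unfolding cs'_def
          by (rule is_run_snoc[OF run st1]) (use l ld in \<open>force simp: otree.set_map v'_def\<close>)
        have V': "Vis cs' w = Vis cs w + (if w = v' then 2 else 0)" for w
          by (auto simp: Vis_def cs'_def visits_snoc)
        define rs1 where "rs1 = rs[k := set_rn (rs ! k) n']"
        define \<mu>E1 where "\<mu>E1 = \<mu>E(x := (\<mu> x, rs1))"
        have I1: "Inv \<nu> \<mu>E1 \<mu> (\<mu>N(v := n')) (\<lambda>\<beta>. if addr \<beta> = v then 1 else 0) (Vis cs)"
          using Inv_set_rn[OF I k cpb pn(2) rs_def] unfolding \<mu>E1_def rs1_def v_def \<beta>_def .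
        have pot1: "cpot (\<mu> x, rs1) = cpot (\<mu>E x)" using cpot_set_rn[OF len] unfolding rs1_def Ex .
        show ?thesis
        proof (cases d)
          case Up
          then have "v \<noteq> []" using dok rk(2) by simp
          then obtain w j where w: "v = w @ [j]" by (metis rev_exhaust)
          have v'w: "v' = w" using Up w by (simp add: v'_def)
          \<comment> \<open>The new visit at \<open>w\<close> finances the reserve there. At the old
            address \<open>w @ [j]\<close> only the records on the way back keep their unit.\<close>
          have I2: "Inv \<nu> (\<mu>E(x := (\<mu> x, rs1))) \<mu> (\<mu>N(v := n'))
              (\<lambda>\<beta>'. if addr \<beta>' = w \<or> addr \<beta>' = w @ [j] \<and> prefix \<beta>' \<beta> then 1 else 0) (Vis cs')"
            unfolding \<mu>E1_def[symmetric] by (rule Inv_slack[OF I1]) (auto simp: V' v'w w)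
          have l': "last cs' = (w, p', \<mu>N(v := n'))" by (simp add: cs'_def v'w)
          have ab: "addr \<beta> = w @ [j]" using w by (simp add: v_def)
          obtain q2 m2 d2 y e where 2: "goback k p' (\<mu> x) rs1 = (q2, m2, d2)"
              "leaf_ok rkS cQ cM cpot \<sigma> (\<mu> x, rs1) (q2, m2, d2)" "xmove t x d2 = Some y"
              "silent E (y, q2, \<mu>E(x := m2)) e" "Rest cs' e"
            using backward[where a = "\<mu> x", OF run' l' pn(1) cpb[folded \<beta>_def] ab k \<beta>_def[symmetric] \<sigma> I2] by blast
          have nl: "nleaf k ss (\<mu> x) rs l = (q2, m2, d2)" using 2(1) Up by (simp add: nleaf_def ld rs1_def)
          have "sim (v', p', \<mu>N(v := n')) (y, q2, \<mu>E(x := m2))"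
            unfolding sim_def using run' 2(4,5) pn(1) by (intro exI[of _ cs'] exI[of _ e]) (simp add: cs'_def)
          moreover have "leaf_ok rkS cQ cM cpot \<sigma> (\<mu>E x) (q2, m2, d2)"
            using 2(2) unfolding leaf_ok_def pot1 .
          ultimately show ?thesis using nl 2(3) by (simp add: ld v'_def)
        next
          case (Down j)
          then have j: "1 \<le> j" "j \<le> length ss" using dok by auto
          have v'j: "v' = v @ [j]" using Down labv(2)[of j] j by (simp add: v'_def)
          have cpj: "cp (\<beta> @ [j]) = Some (x, ss ! (j - 1), \<mu>)" using cpb j by (simp add: \<beta>_def)
          have adj: "addr (\<beta> @ [j]) = v'" using j v'j by (simp add: v_def)
          let ?e = "\<lambda>\<beta>'. if addr \<beta>' = v' then (if strict_prefix \<beta>' (\<beta> @ [j]) then 1 else 2) else 0"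
          \<comment> \<open>The new visit at \<open>v'\<close> adds 2 to \<open>V\<close>, which
            finances the reserves that \<open>forward\<close> starts with; the unit left at
            \<open>v\<close> is given up.\<close>
          have I2: "Inv \<nu> \<mu>E1 \<mu> (\<mu>N(v := n')) ?e (Vis cs')"
            by (rule Inv_slack[OF I1]) (auto simp: V')
          obtain k2 rs2 where f: "find_or_create (None, k, j) (ss ! (j - 1)) (\<mu> x) False (topm N) rs1 = (k2, rs2)" by fastforce
          have nl: "nleaf k ss (\<mu> x) rs l = (At k2 p', (\<mu> x, rs2), None)" using f Down by (simp add: nleaf_def ld rs1_def)
          have "\<exists>\<nu>'. Inv \<nu>' (\<mu>E1(x := (\<mu> x, rs2))) \<mu> (\<mu>N(v := n')) ?e (Vis cs') \<and> k2 < length (\<nu>' x) \<and> \<nu>' x ! k2 = \<beta> @ [j]"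
            by (rule Inv_find_or_create[OF I2 cpb[folded \<beta>_def] k \<beta>_def[symmetric] cpj _ _ _ _ _ f])
              (use adj V' v'j in \<open>auto simp: \<mu>E1_def\<close>)
          then obtain \<nu>' where I3: "Inv \<nu>' (\<mu>E(x := (\<mu> x, rs2))) \<mu> (\<mu>N(v := n')) ?e (Vis cs')"
              and k2: "k2 < length (\<nu>' x)" "\<nu>' x ! k2 = \<beta> @ [j]"
            unfolding \<mu>E1_def by auto
          have lok: "leaf_ok rkS cQ cM cpot \<sigma> (\<mu>E x) (At k2 p', (\<mu> x, rs2), None)"
            using k2 Inv_records[OF I3 run', of x] pn(1) Inv_mem[OF I3 run' mem\<mu>, of x] cpot_find_or_create[OF f, of "\<mu> x" "\<mu> x"] pot1
            unfolding leaf_ok_def by (auto simp: cQ_simps)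
          obtain r' where "yields H t (x, ss ! (j - 1), \<mu>) r'" using hcomp_yields[OF yields_r cpj] by blast
          from forward[OF run' _ pn(1) this refl cpj adj k2 I3] obtain e where
            "silent E (x, At k2 p', \<mu>E(x := (\<mu> x, rs2))) e" "Rest cs' e"
            by (auto simp: cs'_def)
          then have "sim (v', p', \<mu>N(v := n')) (x, At k2 p', \<mu>E(x := (\<mu> x, rs2)))"
            unfolding sim_def using run' pn(1) by (intro exI[of _ cs'] exI[of _ e]) (simp add: cs'_def)
          then show ?thesis using nl lok by (simp add: ld v'_def)
        qed
      qed
      let ?s = "map_otree id (nleaf k ss (\<mu> x) rs) s"
      have "wf_otree Xi rkX s" using N_uthm Some unfolding is_uthm_def by blast
      moreover have "cdelta (At k p) \<sigma> (child_index x) (\<mu>E x) = Some ?s"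
        unfolding Ex cdelta.simps if_P[OF len] rk(1,3) Some otree.case option.case if_P[OF okT] ..
      ultimately have "capped (At k p) \<sigma> (child_index x) (\<mu>E x) = Some ?s"
        using leaf by (simp add: capped_def wf_otree_map otree.set_map)
      moreover have "\<forall>(q', m', d)\<in>leaves ?s. xmove t x d \<noteq> None" using leaf by (fastforce simp: otree.set_map)
      ultimately have st2: "E c2 = Some (map_otree id (\<lambda>(q', m', d). (the (xmove t x d), q', \<mu>E(x := m'))) ?s)"
        using \<sigma> by (simp add: c2 xstep_def)
      have "rel_otree (=) sim (map_otree id (\<lambda>(q', m', d). (the (move r v d), q', \<mu>N(v := m'))) s)
          (map_otree id (\<lambda>(q', m', d). (the (xmove t x d), q', \<mu>E(x := m'))) ?s)"
        unfolding otree.map_comp id_o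
        by (rule rel_otree_map) (use leaf in \<open>fastforce split: prod.splits\<close>)
      then show ?thesis using st1 st2 by simp
    qed
  qed
qed

lemma sim_init: "sim (init_conf N) ([], Start, \<lambda>_. (topm H, []))"
proof -
  let ?cs = "[init_conf N]" and ?rs = "[Rcd s0 (topm H) None True (topm N) 0]"
  let ?\<nu> = "(\<lambda>_. [])([] := [[]])"
  let ?\<mu>E = "(\<lambda>_. (topm H, []))([] := (topm H, ?rs))"
  let ?e = "\<lambda>\<beta>'. if addr \<beta>' = [] then (if strict_prefix \<beta>' [] then 1 else 2) else 0"
  have N0: "qinit N \<in> st N" "topm N \<in> mem N" and H0: "topm H \<in> mem H" using N_uthm uthm by (auto simp: is_uthm_def)
  have V: "Vis ?cs [] = 2" using visits_snoc[of "[]" "init_conf N" "{[]}"]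
    by (simp add: Vis_def init_conf_def visits_def)
  have I: "Inv ?\<nu> ?\<mu>E (\<lambda>_. topm H) (\<lambda>_. topm N) ?e (Vis ?cs)"
    unfolding Inv_def rec_ok_def par_ok_def using V N0 by auto
  have lok: "leaf_ok rkS cQ cM cpot \<sigma>0 (topm H, []) (At 0 (qinit N), (topm H, ?rs), None)"
    using Inv_records[OF I is_run_init, of "[]"] Inv_mem[OF I is_run_init, of "[]"] N0 H0
    unfolding leaf_ok_def by (simp add: cQ_simps cpot_def)
  have step: "E ([], Start, \<lambda>_. (topm H, [])) = Some (Leaf ([], At 0 (qinit N), ?\<mu>E))"
    by (rule E_Leaf[OF root(1)]) (use root(2) lok in auto)
  obtain e where "silent E ([], At 0 (qinit N), ?\<mu>E) e" "Rest ?cs e"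
    using forward[where k = 0, OF is_run_init _ N0(1) yields_r refl _ _ _ _ I] by (auto simp: init_conf_def)
  then show ?thesis unfolding sim_def using silent_step[of E, OF step] is_run_init N0(1)
    by (intro exI[of _ ?cs] exI[of _ e]) (auto simp: init_conf_def)
qed

theorem capped_out: "out (step N r) (init_conf N) x \<longleftrightarrow> out E ([], Start, \<lambda>_. (topm H, [])) x"
proof (rule simulation_out[of sim])
  fix c1 c2 assume "sim c1 c2"
  then obtain cs d where "is_run N r cs" "last cs = c1" "silent E c2 d" "Rest cs d" unfolding sim_def by blast
  then show "\<exists>d. silent E c2 d \<and> rel_option (rel_otree (=) sim) (step N r c1) (E d)" using N_step by blast
qed (rule sim_init)

end

theorem mainTheorem10:
  fixes Sig :: "'a set" and rkS :: "'a \<Rightarrow> nat"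
    and Gam :: "'b set" and rkG :: "'b \<Rightarrow> nat"
    and Xi :: "'c set" and rkX :: "'c \<Rightarrow> nat"
    and H :: "('q, 'm, 'a, 'b) hm" and N :: "('p, 'n, 'b, 'c) hm"
  assumes "is_thm Sig rkS Gam rkG H"
    and "is_uthm Gam rkG Xi rkX N"
    and "narrow_visit N (range_sem Sig rkS H)"
  shows "\<exists>K :: (nat, nat, 'a, 'c) hm. is_thm Sig rkS Xi rkX K \<and>
           (\<forall>t. wf_tree Sig rkS t \<longrightarrow> sem K t = Option.bind (sem H t) (sem N))"
proof -
  obtain C where C: "\<And>t cs u. wf_tree Sig rkS t \<Longrightarrow> is_run H t cs \<Longrightarrow> u \<in> nodes t \<Longrightarrow> visits cs {u} \<le> C"
    using assms(1) unfolding is_thm_def bounded_visit_def by blast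
  obtain B where B: "\<And>r cs S. r \<in> range_sem Sig rkS H \<Longrightarrow> is_run N r cs \<Longrightarrow> antichain r S \<Longrightarrow> visits cs S \<le> B"
    using assms(3) unfolding narrow_visit_def by blast
  let ?H = "counted C H"
  have semH: "sem ?H t = sem H t" if "wf_tree Sig rkS t" for t using counted_sem C[OF that] by blast
  interpret composition Sig rkS Gam rkG ?H snd C Xi rkX N B
    by unfold_locales (use assms(1,2) counted_uthm counted_delta in \<open>auto simp: is_thm_def\<close>)
  obtain ty :: "'a tree \<Rightarrow> nat" and F Acc where ty: "finite (range ty)" "\<And>\<sigma> ts. ty (Node \<sigma> ts) = F \<sigma> (map ty ts)"
    "\<And>t. wf_tree Sig rkS t \<Longrightarrow> ty t \<in> Acc \<longleftrightarrow> halts (step ?H t) (init_conf ?H)"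
    by (rule domain_recognizable, rule that) assumption+
  interpret x: xmachine Sig rkS Xi rkX cQ cM cpot capped Start "(topm ?H, [])" by (rule capped_xmachine)
  interpret guarded_xmachine Sig rkS Xi rkX cQ cM cpot capped Start "(topm ?H, [])" ty F Acc
    by unfold_locales (use ty in auto)
  obtain K :: "(nat, nat, 'a, 'c) hm" where K: "is_thm Sig rkS Xi rkX K"
    "\<And>t x. wf_tree Sig rkS t \<Longrightarrow> sem K t = Some x \<longleftrightarrow>
       ty t \<in> Acc \<and> out (xstep capped t) ([], Start, \<lambda>_. (topm ?H, [])) x"
    using guarded_machine by blast
  have "sem K t = Option.bind (sem H t) (sem N)" if wf: "wf_tree Sig rkS t" for t
  proof -
    have "sem K t = Some x \<longleftrightarrow> Option.bind (sem H t) (sem N) = Some x" for x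
    proof (cases "sem H t")
      case None
      then have "\<not> halts (step ?H t) (init_conf ?H)" using sem_Some semH[OF wf] unfolding halts_def by (metis option.distinct(1))
      then show ?thesis using K(2)[OF wf] ty(3)[OF wf] None by simp
    next
      case (Some r)
      then have o: "out (step ?H t) (init_conf ?H) r" using sem_Some semH[OF wf] by metis
      obtain \<sigma>0 s0 where s0: "lab t [] = Some \<sigma>0" "delta ?H (qinit ?H) \<sigma>0 (topm ?H) = Some s0"
          "yields ?H t ([], s0, \<lambda>_. topm ?H) r"
        using out_yields[OF o init_conf_def] by auto
      have "r \<in> range_sem Sig rkS H" using Some wf by (auto simp: range_sem_def)
      \<comment> \<open>Only here is \<open>r\<close> known to lie in the range, so that narrowness
        applies to it.\<close>
      then interpret composition_run Sig rkS Gam rkG ?H snd C Xi rkX N B t r \<sigma>0 s0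
        by unfold_locales (use wf s0 B in auto)
      have "ty t \<in> Acc" using ty(3)[OF wf] o by (auto simp: halts_def)
      then show ?thesis using K(2)[OF wf] capped_out Some sem_Some[of N r x] by simp
    qed
    then show ?thesis by (metis option.exhaust)
  qed
  then show ?thesis using K(1) by blast
qed

end
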